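(* Let $X$ be a path-connected, locally path-connected, semilocally simply connected space having the homotopy type of a CW complex, which is moreover Hausdorff, paracompact and locally contractible. If $\pi_1(X)$ is a free group and $H^2(X;\mathbb Z)=0$, then every countably infinite-sheeted covering $p:E\to X$ is equivalent (isomorphic as a covering of $X$) to the Weierstrass entire covering $p_1:Z(F)\to X$ of some Weierstrass entire family $F:X\times\mathbb C\to\mathbb C$.
   Context: A Weierstrass entire family on $X$ is a continuous map $F:X\times\mathbb C\to\mathbb C$ such that for each $x\in X$, $z\mapsto F(x,z)$ is entire, and such that the zero locus $Z(F)=\{(x,z):F(x,z)=0\}$ with the first projection $p_1:Z(F)\to X$ is a countably infinite-sheeted covering; this is the associated Weierstrass entire covering. A countably infinite-sheeted covering is a covering map whose fibers are countably infinite. *)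

theory Defs
  imports "HOL-Analysis.Analysis" "HOL-Complex_Analysis.Complex_Analysis"
    "HOL-Homology.Homology" "HOL-Algebra.Generated_Groups"
begin

definition loop_in :: "'a topology \<Rightarrow> 'a \<Rightarrow> (real \<Rightarrow> 'a) \<Rightarrow> bool" where
  "loop_in X x0 g \<equiv> pathin X g \<and> g 0 = x0 \<and> g 1 = x0"

definition path_homotopic :: "'a topology \<Rightarrow> (real \<Rightarrow> 'a) \<Rightarrow> (real \<Rightarrow> 'a) \<Rightarrow> bool" where
  "path_homotopic X g h \<equiv>
     pathin X g \<and> pathin X h \<and> g 0 = h 0 \<and> g 1 = h 1 \<and>
     homotopic_with (\<lambda>k. k 0 = g 0 \<and> k 1 = g 1) (top_of_set {0..1}) X g h"

definition path_join :: "(real \<Rightarrow> 'a) \<Rightarrow> (real \<Rightarrow> 'a) \<Rightarrow> real \<Rightarrow> 'a" where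
  "path_join g h \<equiv> (\<lambda>t. if t \<le> 1/2 then g (2 * t) else h (2 * t - 1))"

definition loop_class :: "'a topology \<Rightarrow> 'a \<Rightarrow> (real \<Rightarrow> 'a) \<Rightarrow> (real \<Rightarrow> 'a) set" where
  "loop_class X x0 g \<equiv> {h. loop_in X x0 h \<and> path_homotopic X g h}"

definition fundamental_group :: "'a topology \<Rightarrow> 'a \<Rightarrow> ((real \<Rightarrow> 'a) set) monoid" where
  "fundamental_group X x0 \<equiv>
     \<lparr> carrier = {loop_class X x0 g | g. loop_in X x0 g},
       mult = (\<lambda>A B. loop_class X x0 (path_join (SOME g. g \<in> A) (SOME h. h \<in> B))),
       one = loop_class X x0 (\<lambda>t. x0) \<rparr>"

definition word_eval :: "('g, 'b) monoid_scheme \<Rightarrow> ('g \<times> bool) list \<Rightarrow> 'g" where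
  "word_eval G w \<equiv> foldr (\<lambda>(s, e) acc. (if e then s else inv\<^bsub>G\<^esub> s) \<otimes>\<^bsub>G\<^esub> acc) w \<one>\<^bsub>G\<^esub>"

definition reduced_word :: "('g \<times> bool) list \<Rightarrow> bool" where
  "reduced_word w \<equiv> (\<forall>i. Suc i < length w \<longrightarrow>
       \<not> (fst (w ! i) = fst (w ! Suc i) \<and> snd (w ! i) \<noteq> snd (w ! Suc i)))"

definition free_group_on :: "('g, 'b) monoid_scheme \<Rightarrow> 'g set \<Rightarrow> bool" where
  "free_group_on G S \<equiv> group G \<and> S \<subseteq> carrier G \<and> generate G S = carrier G \<and>
     (\<forall>w. set (map fst w) \<subseteq> S \<and> w \<noteq> [] \<and> reduced_word w \<longrightarrow> word_eval G w \<noteq> \<one>\<^bsub>G\<^esub>)"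

definition is_free_group :: "('g, 'b) monoid_scheme \<Rightarrow> bool" where
  "is_free_group G \<equiv> \<exists>S. free_group_on G S"

definition H2_int_vanishes :: "'a topology \<Rightarrow> bool" where
  "H2_int_vanishes X \<equiv>
     (\<forall>\<phi> :: ((nat \<Rightarrow> real) \<Rightarrow> 'a) \<Rightarrow> int.
        (\<forall>\<sigma>. singular_simplex 3 X \<sigma> \<longrightarrow>
              (\<Sum>k\<le>3. (-1) ^ k * \<phi> (singular_face 3 k \<sigma>)) = 0)
        \<longrightarrow> (\<exists>\<psi> :: ((nat \<Rightarrow> real) \<Rightarrow> 'a) \<Rightarrow> int.
              \<forall>\<sigma>. singular_simplex 2 X \<sigma> \<longrightarrow>
                  \<phi> \<sigma> = (\<Sum>k\<le>2. (-1) ^ k * \<psi> (singular_face 2 k \<sigma>))))"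

definition semilocally_simply_connected_space :: "'a topology \<Rightarrow> bool" where
  "semilocally_simply_connected_space X \<equiv>
     \<forall>x \<in> topspace X. \<exists>U. openin X U \<and> x \<in> U \<and>
        (\<forall>g. loop_in (subtopology X U) x g \<longrightarrow> path_homotopic X g (\<lambda>t. x))"

definition paracompact_space :: "'a topology \<Rightarrow> bool" where
  "paracompact_space X \<equiv>
     \<forall>\<U>. (\<forall>U\<in>\<U>. openin X U) \<and> \<Union>\<U> = topspace X \<longrightarrow>
        (\<exists>\<V>. (\<forall>V\<in>\<V>. openin X V) \<and> \<Union>\<V> = topspace X \<and>
              (\<forall>V\<in>\<V>. \<exists>U\<in>\<U>. V \<subseteq> U) \<and> locally_finite_in X \<V>)"

definition locally_contractible_space :: "'a topology \<Rightarrow> bool" where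
  "locally_contractible_space X \<equiv>
     \<forall>x \<in> topspace X. \<forall>U. openin X U \<and> x \<in> U \<longrightarrow>
        (\<exists>V. openin X V \<and> x \<in> V \<and> V \<subseteq> U \<and> contractible_space (subtopology X V))"

section \<open>CW complexes (Whitehead's definition)\<close>

definition closed_nball :: "nat \<Rightarrow> (nat \<Rightarrow> real) set" where
  "closed_nball n \<equiv> {x. (\<forall>i\<ge>n. x i = 0) \<and> (\<Sum>i<n. (x i)\<^sup>2) \<le> 1}"

definition open_nball :: "nat \<Rightarrow> (nat \<Rightarrow> real) set" where
  "open_nball n \<equiv> {x. (\<forall>i\<ge>n. x i = 0) \<and> (\<Sum>i<n. (x i)\<^sup>2) < 1}"

definition cw_structure :: "'b topology \<Rightarrow> (nat \<times> ((nat \<Rightarrow> real) \<Rightarrow> 'b)) set \<Rightarrow> bool" where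
  "cw_structure Y C \<equiv>
     Hausdorff_space Y \<and>
     (\<forall>(n, \<phi>) \<in> C.
        continuous_map (subtopology (Euclidean_space n) (closed_nball n)) Y \<phi> \<and>
        homeomorphic_map (subtopology (Euclidean_space n) (open_nball n))
                         (subtopology Y (\<phi> ` open_nball n)) \<phi>) \<and>
     (\<Union>(n, \<phi>) \<in> C. \<phi> ` open_nball n) = topspace Y \<and>
     (\<forall>c1 \<in> C. \<forall>c2 \<in> C. c1 \<noteq> c2 \<longrightarrow>
        disjnt (snd c1 ` open_nball (fst c1)) (snd c2 ` open_nball (fst c2))) \<and>
     (\<forall>(n, \<phi>) \<in> C. \<exists>F. F \<subseteq> C \<and> finite F \<and> (\<forall>(m, \<psi>) \<in> F. m < n) \<and>
        \<phi> ` (closed_nball n - open_nball n) \<subseteq> (\<Union>(m, \<psi>) \<in> F. \<psi> ` open_nball m)) \<and>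
     (\<forall>A. A \<subseteq> topspace Y \<longrightarrow>
        (closedin Y A \<longleftrightarrow> (\<forall>(n, \<phi>) \<in> C. closedin Y (A \<inter> \<phi> ` closed_nball n))))"

definition cw_complex :: "'b topology \<Rightarrow> bool" where
  "cw_complex Y \<equiv> \<exists>C. cw_structure Y C"

definition covering_map :: "'e topology \<Rightarrow> 'a topology \<Rightarrow> ('e \<Rightarrow> 'a) \<Rightarrow> bool" where
  "covering_map E X p \<equiv>
     continuous_map E X p \<and> p ` topspace E = topspace X \<and>
     (\<forall>x \<in> topspace X. \<exists>U. openin X U \<and> x \<in> U \<and>
        (\<exists>\<V>. \<Union>\<V> = {e \<in> topspace E. p e \<in> U} \<and> pairwise disjnt \<V> \<and>
              (\<forall>V \<in> \<V>. openin E V \<and> homeomorphic_map (subtopology E V) (subtopology X U) p)))"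

definition countably_infinite_sheeted :: "'e topology \<Rightarrow> 'a topology \<Rightarrow> ('e \<Rightarrow> 'a) \<Rightarrow> bool" where
  "countably_infinite_sheeted E X p \<equiv>
     covering_map E X p \<and>
     (\<forall>x \<in> topspace X. countable {e \<in> topspace E. p e = x} \<and> infinite {e \<in> topspace E. p e = x})"

definition zero_space :: "'a topology \<Rightarrow> ('a \<Rightarrow> complex \<Rightarrow> complex) \<Rightarrow> ('a \<times> complex) topology" where
  "zero_space X F \<equiv> subtopology (prod_topology X euclidean) {(x, z). x \<in> topspace X \<and> F x z = 0}"

definition weierstrass_entire_family :: "'a topology \<Rightarrow> ('a \<Rightarrow> complex \<Rightarrow> complex) \<Rightarrow> bool" where
  "weierstrass_entire_family X F \<equiv>
     continuous_map (prod_topology X euclidean) euclidean (\<lambda>(x, z). F x z) \<and>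
     (\<forall>x \<in> topspace X. F x holomorphic_on UNIV) \<and>
     countably_infinite_sheeted (zero_space X F) X fst"

definition equivalent_coverings ::
  "'e topology \<Rightarrow> ('e \<Rightarrow> 'a) \<Rightarrow> 'f topology \<Rightarrow> ('f \<Rightarrow> 'a) \<Rightarrow> bool" where
  "equivalent_coverings E p E' p' \<equiv>
     \<exists>h. homeomorphic_map E E' h \<and> (\<forall>e \<in> topspace E. p' (h e) = p e)"

end

theory Submission
  imports Defs
begin

text \<open>
  It suffices to find a continuous \<open>\<zeta> : E \<rightarrow> \<complex>\<close> that is injective on fibres and for which
  \<open>\<Sum> 1/|\<zeta> e|\<^sup>2\<close> over a fibre converges locally uniformly: the canonical product of genus one with
  zeros \<open>\<zeta> e\<close> does not depend on an enumeration of the fibre, so these products form a globally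
  defined entire family with zero set \<open>E\<close>.

  Homotopy classes of paths from \<open>x0\<close> to \<open>x\<close> are vertices of a copy of the Cayley tree of the free
  group \<open>\<pi>\<^sub>1(X)\<close>. A partition of unity subordinate to a cover by sets \<open>U\<close> with coherent paths from \<open>x0\<close>
  gives a probability measure on these vertices, and its barycentre is a point of the tree that
  varies continuously with \<open>x\<close>. Transport along a vertex \<open>q\<close> identifies the fibre over \<open>x\<close> with the
  one over \<open>x0\<close>, hence with the positive integers. If the barycentre is the vertex \<open>q\<close>, let \<open>\<zeta>\<close> be
  this labelling. If it lies at distance \<open>t\<close> from \<open>q\<close> on an edge, interpolate between the
  labellings of the ends, with an imaginary part that keeps the points of the fibre apart.
\<close>

section \<open>Free groups and their Cayley trees\<close>

text \<open>Freeness of the group enters through the shape of the tree: stars of neighbouring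
  vertices overlap only along an edge, so labellings have to be interpolated in a single real
  parameter and no compatibility over higher cells arises. The tree is never built as a space. On
  the edge leaving a vertex in direction \<open>a\<close>, the point at distance t from that vertex
  has squared distance (t - \<open>edge_coord a\<close>)^2 to any given vertex. The weighted energy
  is therefore quadratic in t on each edge, and its minimum sits at the weighted mean of these
  coordinates. So the barycentre, the minimiser of the energy, is described by weighted sums of
  integers, which vary continuously with the weights. The vertex used to read off its position is
  ambiguous only when it lies inside an edge; there both ends must produce the same complex number,
  and this dictates the form of the interpolation. Genus one is forced by the labels 1, 2, 3, ...:
  the product of the factors 1 - z/k does not converge, whereas the sum of 1/k^2 does.\<close>

definition inv_letter :: "'g \<times> bool \<Rightarrow> 'g \<times> bool" where
  "inv_letter a = (fst a, \<not> snd a)"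

definition letter_val :: "('g, 'b) monoid_scheme \<Rightarrow> 'g \<times> bool \<Rightarrow> 'g" where
  "letter_val G a = (if snd a then fst a else inv\<^bsub>G\<^esub> (fst a))"

lemma inv_letter_simps [simp]:
  "inv_letter (inv_letter a) = a" "fst (inv_letter a) = fst a" "inv_letter a \<noteq> a" "a \<noteq> inv_letter a"
  by (auto simp: inv_letter_def prod_eq_iff)

lemma inv_letter_eq_iff: "b = inv_letter a \<longleftrightarrow> fst a = fst b \<and> snd a \<noteq> snd b"
  by (auto simp: inv_letter_def prod_eq_iff)

lemma reduced_word_iff_successively:
  "reduced_word w \<longleftrightarrow> successively (\<lambda>a b. b \<noteq> inv_letter a) w"
  unfolding reduced_word_def successively_conv_nth inv_letter_eq_iff by blast

lemma reduced_word_Nil [simp]: "reduced_word []"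
  by (simp add: reduced_word_def)

lemma reduced_word_Cons:
  "reduced_word (a # w) \<longleftrightarrow> reduced_word w \<and> (w \<noteq> [] \<longrightarrow> hd w \<noteq> inv_letter a)"
  by (auto simp: reduced_word_iff_successively successively_Cons)

lemma word_eval_Nil [simp]: "word_eval G [] = \<one>\<^bsub>G\<^esub>"
  by (simp add: word_eval_def)

lemma word_eval_Cons [simp]: "word_eval G (a # w) = letter_val G a \<otimes>\<^bsub>G\<^esub> word_eval G w"
  by (simp add: word_eval_def letter_val_def case_prod_beta)

section \<open>Reduced words and normal forms\<close>

locale free_basis = group G for G (structure) +
  fixes S
  assumes basis_subset: "S \<subseteq> carrier G"
    and generates: "generate G S = carrier G"
    and relation_free: "\<And>w. fst ` set w \<subseteq> S \<Longrightarrow> w \<noteq> [] \<Longrightarrow> reduced_word w \<Longrightarrow> word_eval G w \<noteq> \<one>"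
begin

definition word_over :: "('a \<times> bool) list \<Rightarrow> bool" where
  "word_over w \<longleftrightarrow> fst ` set w \<subseteq> S"

lemma word_over_simps [simp]:
  "word_over []" "word_over (a # w) \<longleftrightarrow> fst a \<in> S \<and> word_over w"
  "word_over (u @ v) \<longleftrightarrow> word_over u \<and> word_over v"
  by (auto simp: word_over_def)

lemma letter_val_closed [simp]: "fst a \<in> S \<Longrightarrow> letter_val G a \<in> carrier G"
  using basis_subset by (auto simp: letter_val_def)

lemma letter_val_inv [simp]: "fst a \<in> S \<Longrightarrow> letter_val G (inv_letter a) = inv (letter_val G a)"
  using basis_subset by (auto simp: letter_val_def inv_letter_def)

lemma word_eval_closed [simp]: "word_over w \<Longrightarrow> word_eval G w \<in> carrier G"
  by (induction w) auto

lemma word_eval_append: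
  "word_over u \<Longrightarrow> word_over v \<Longrightarrow> word_eval G (u @ v) = word_eval G u \<otimes> word_eval G v"
  by (induction u) (auto simp: m_assoc)

definition inv_word :: "('a \<times> bool) list \<Rightarrow> ('a \<times> bool) list" where
  "inv_word w = rev (map inv_letter w)"

lemma inv_word_over [simp]: "word_over (inv_word w) \<longleftrightarrow> word_over w"
  by (simp add: inv_word_def word_over_def image_image)

lemma word_eval_inv_word: "word_over w \<Longrightarrow> word_eval G (inv_word w) = inv (word_eval G w)"
proof (induction w)
  case (Cons a w)
  have "inv_word (a # w) = inv_word w @ [inv_letter a]"
    by (simp add: inv_word_def)
  then show ?case
    using Cons by (simp add: word_eval_append inv_mult_group)
qed (simp add: inv_word_def)

lemma reduced_inv_word: "reduced_word w \<Longrightarrow> reduced_word (inv_word w)"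
  unfolding reduced_word_iff_successively inv_word_def successively_rev successively_map
  by (erule successively_mono) (metis inv_letter_simps(1))

text \<open>Only the seam of \<open>inv_word u @ v\<close> can cancel, and it does so exactly when
  the first letters agree. If they agree, they are stripped from both words; if not, the
  concatenation is a nonempty reduced relation, which freeness forbids.\<close>

lemma reduced_word_unique:
  "word_over u \<Longrightarrow> word_over v \<Longrightarrow> reduced_word u \<Longrightarrow> reduced_word v \<Longrightarrow>
   word_eval G u = word_eval G v \<Longrightarrow> u = v"
proof (induction u arbitrary: v)
  case Nil
  then show ?case
    using relation_free[of v] by (auto simp: word_over_def)
next
  case (Cons a u)
  show ?case
  proof (cases "v \<noteq> [] \<and> hd v = a")
    case True
    then obtain v' where v: "v = a # v'"
      by (cases v) auto
    with Cons show ?thesis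
      by (auto simp: reduced_word_Cons)
  next
    case False
    let ?w = "inv_word (a # u) @ v"
    have "last (inv_word (a # u)) = inv_letter a"
      by (simp add: inv_word_def)
    then have "reduced_word ?w"
      using reduced_inv_word[OF Cons.prems(3)] Cons.prems(4) False
      by (auto simp: reduced_word_iff_successively successively_append_iff)
    moreover have "?w \<noteq> []"
      by (simp add: inv_word_def)
    moreover have "word_over ?w"
      using Cons.prems(1,2) by simp
    moreover have "word_eval G ?w = \<one>"
      using Cons.prems by (simp only: word_eval_append inv_word_over word_eval_inv_word) auto
    ultimately show ?thesis
      using relation_free[of ?w] unfolding word_over_def by blast
  qed
qed

lemma word_exists: 
  assumes "g \<in> carrier G"
  shows "\<exists>w. word_over w \<and> word_eval G w = g"
proof -
  have "g \<in> generate G S"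
    using assms generates by simp
  then show ?thesis
  proof induction
    case one
    show ?case by (intro exI[of _ "[]"]) simp
  next
    case (incl h)
    with basis_subset show ?case
      by (intro exI[of _ "[(h, True)]"]) (auto simp: letter_val_def)
  next
    case (inv h)
    with basis_subset show ?case
      by (intro exI[of _ "[(h, False)]"]) (auto simp: letter_val_def)
  next
    case (eng g h)
    then show ?case
      by (metis word_eval_append word_over_simps(3))
  qed
qed

lemma reduced_exists: "word_over w \<Longrightarrow> \<exists>v. word_over v \<and> reduced_word v \<and> word_eval G v = word_eval G w"
proof (induction w)
  case Nil
  show ?case by (intro exI[of _ "[]"]) simp
next
  case (Cons a w)
  then obtain v where v: "word_over v" "reduced_word v" "word_eval G v = word_eval G w"
    by auto
  show ?case
  proof (cases "v \<noteq> [] \<and> hd v = inv_letter a")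
    case True
    then obtain u where "v = inv_letter a # u"
      by (cases v) auto
    with v Cons.prems have u: "word_over u" "reduced_word u" "word_eval G w = inv (letter_val G a) \<otimes> word_eval G u"
      by (auto simp: reduced_word_Cons)
    then have "word_eval G u = letter_val G a \<otimes> word_eval G w"
      using Cons.prems by (simp add: inv_solve_left)
    with u show ?thesis
      by (intro exI[of _ u]) simp
  next
    case False
    then show ?thesis
      using v Cons.prems by (intro exI[of _ "a # v"]) (auto simp: reduced_word_Cons)
  qed
qed

definition normal_form :: "'a \<Rightarrow> ('a \<times> bool) list" where
  "normal_form g = (SOME w. word_over w \<and> reduced_word w \<and> word_eval G w = g)"

lemma normal_form:
  assumes "g \<in> carrier G"
  shows "word_over (normal_form g)" "reduced_word (normal_form g)" "word_eval G (normal_form g) = g"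
proof -
  have "\<exists>w. word_over w \<and> reduced_word w \<and> word_eval G w = g"
    using word_exists[OF assms] reduced_exists by blast
  then have "word_over (normal_form g) \<and> reduced_word (normal_form g) \<and> word_eval G (normal_form g) = g"
    unfolding normal_form_def by (rule someI_ex)
  then show "word_over (normal_form g)" "reduced_word (normal_form g)" "word_eval G (normal_form g) = g"
    by blast+
qed

lemma normal_form_eqI:
  "word_over w \<Longrightarrow> reduced_word w \<Longrightarrow> word_eval G w = g \<Longrightarrow> normal_form g = w"
  by (metis normal_form reduced_word_unique word_eval_closed)

section \<open>Signed coordinates along the edges of the Cayley tree\<close>

definition starts_with :: "'a \<times> bool \<Rightarrow> 'a \<Rightarrow> bool" where
  "starts_with a g \<longleftrightarrow> normal_form g \<noteq> [] \<and> hd (normal_form g) = a"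

text \<open>The signed coordinate of the vertex \<open>g\<close> of the Cayley tree along the edge from \<open>\<one>\<close> to \<open>a\<close>.\<close>

definition edge_coord :: "'a \<times> bool \<Rightarrow> 'a \<Rightarrow> real" where
  "edge_coord a g = (if starts_with a g then 1 else -1) * real (length (normal_form g))"

text \<open>One step in the tree: the distance to the other vertex drops by one in the direction of
  its first letter and grows by one in every other direction.\<close>

lemma normal_form_letter_mult:
  assumes "fst a \<in> S" "g \<in> carrier G"
  shows "normal_form (inv (letter_val G a) \<otimes> g) =
    (if starts_with a g then tl (normal_form g) else inv_letter a # normal_form g)"
proof (cases "starts_with a g")
  case True
  then obtain u where u: "normal_form g = a # u"
    unfolding starts_with_def by (cases "normal_form g") auto
  then have u': "word_over u" "reduced_word u" "letter_val G a \<otimes> word_eval G u = g"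
    using normal_form[OF assms(2)] by (auto simp: reduced_word_Cons)
  then have "inv (letter_val G a) \<otimes> g = word_eval G u"
    using assms by (auto simp flip: m_assoc)
  with u' u True show ?thesis
    by (auto intro!: normal_form_eqI)
next
  case False
  with assms normal_form[OF assms(2)] show ?thesis
    unfolding starts_with_def by (auto intro!: normal_form_eqI simp: reduced_word_Cons)
qed

text \<open>The same edge read from its other end: the origin moves to coordinate 1 and the axis is
  reversed.\<close>

lemma edge_coord_flip:
  assumes "fst a \<in> S" "g \<in> carrier G"
  shows "edge_coord (inv_letter a) (inv (letter_val G a) \<otimes> g) = 1 - edge_coord a g"
proof (cases "starts_with a g")
  case True
  then obtain u where u: "normal_form g = a # u"
    unfolding starts_with_def by (cases "normal_form g") auto
  then have "\<not> starts_with (inv_letter a) (inv (letter_val G a) \<otimes> g)"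
    using assms True normal_form(2)[OF assms(2)]
    by (subst starts_with_def) (auto simp: normal_form_letter_mult reduced_word_Cons)
  with True u assms show ?thesis
    by (simp add: edge_coord_def normal_form_letter_mult)
next
  case False
  then have "starts_with (inv_letter a) (inv (letter_val G a) \<otimes> g)"
    using assms by (subst starts_with_def) (simp add: normal_form_letter_mult)
  with False assms show ?thesis
    by (simp add: edge_coord_def normal_form_letter_mult)
qed

text \<open>Absence of cycles: a vertex lies beyond at most one of the edges at the base vertex. The
  coordinates in two directions have the same absolute value, and at most one of them is
  positive.\<close>

lemma edge_coord_add_le: "a \<noteq> b \<Longrightarrow> edge_coord a g + edge_coord b g \<le> 0"
  by (auto simp: edge_coord_def starts_with_def)

lemma edge_coord_le_0: "normal_form g = [] \<or> a \<noteq> hd (normal_form g) \<Longrightarrow> edge_coord a g \<le> 0"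
  by (auto simp: edge_coord_def starts_with_def)

text \<open>The squared length is the squared coordinate, and a step shifts the coordinate by 1.
  Squaring removes the case distinction between approaching and receding.\<close>

lemma length_letter_mult:
  assumes "fst a \<in> S" "g \<in> carrier G"
  shows "(real (length (normal_form (inv (letter_val G a) \<otimes> g))))\<^sup>2 =
    (real (length (normal_form g)))\<^sup>2 - 2 * edge_coord a g + 1"
proof (cases "starts_with a g")
  case True
  then obtain u where "normal_form g = a # u"
    unfolding starts_with_def by (cases "normal_form g") auto
  with True assms show ?thesis
    by (simp add: normal_form_letter_mult edge_coord_def power2_eq_square algebra_simps)
qed (use assms in \<open>simp add: normal_form_letter_mult edge_coord_def power2_eq_square algebra_simps\<close>)

section \<open>Weighted means and central vertices\<close>

definition mean_coord :: "'i set \<Rightarrow> ('i \<Rightarrow> real) \<Rightarrow> ('i \<Rightarrow> 'a) \<Rightarrow> 'a \<times> bool \<Rightarrow> 'a \<Rightarrow> real" where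
  "mean_coord I w k a g = (\<Sum>i\<in>I. w i * edge_coord a (g \<otimes> k i))"

text \<open>Moving along an edge changes the energy \<open>\<Sum> w i |g k i|\<^sup>2\<close> by \<open>1 - 2 * mean_coord\<close>, so any
  almost minimal vertex works.\<close>

lemma central_vertex_exists:
  assumes "finite I" "\<And>i. i \<in> I \<Longrightarrow> w i \<ge> 0" "sum w I = 1" "\<And>i. i \<in> I \<Longrightarrow> k i \<in> carrier G"
  obtains g where "g \<in> carrier G" "\<And>a. fst a \<in> S \<Longrightarrow> mean_coord I w k a g < 1"
proof -
  define V where "V g = (\<Sum>i\<in>I. w i * (real (length (normal_form (g \<otimes> k i))))\<^sup>2)" for g
  have V0: "V g \<ge> 0" for g
    unfolding V_def using assms by (intro sum_nonneg) auto
  have bdd: "bdd_below (V ` carrier G)"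
    using V0 by (auto intro!: bdd_belowI2)
  have "V ` carrier G \<noteq> {}"
    by blast
  \<comment> \<open>A slack of 1 suffices in place of a minimiser: a neighbour has energy at least
    the infimum, hence more than \<open>V g - 1\<close>, and this energy is
    \<open>V g + 1 - 2 * mean_coord\<close>, so \<open>mean_coord\<close> is below 1.\<close>
  from cInf_lessD[OF this, of "Inf (V ` carrier G) + 1"]
  obtain g where g: "g \<in> carrier G" "V g < Inf (V ` carrier G) + 1"
    by auto
  have "mean_coord I w k a g < 1" if a: "fst a \<in> S" for a
  proof -
    let ?h = "inv (letter_val G a) \<otimes> g"
    have "V ?h = (\<Sum>i\<in>I. w i * ((real (length (normal_form (g \<otimes> k i))))\<^sup>2 - 2 * edge_coord a (g \<otimes> k i) + 1))"
      unfolding V_def using a g assms(4)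
      by (intro sum.cong refl) (simp add: m_assoc length_letter_mult)
    also have "\<dots> = V g - 2 * mean_coord I w k a g + 1"
      using assms(3) by (simp add: V_def mean_coord_def algebra_simps sum.distrib sum_subtractf sum_distrib_left)
    finally have "V ?h = V g - 2 * mean_coord I w k a g + 1" .
    moreover have "Inf (V ` carrier G) \<le> V ?h"
      using a g bdd by (intro cInf_lower) auto
    ultimately show ?thesis
      using g(2) by linarith
  qed
  with g that show ?thesis by blast
qed

context
  fixes I :: "'i set" and w :: "'i \<Rightarrow> real" and k :: "'i \<Rightarrow> 'a"
  assumes weights: "finite I" "\<And>i. i \<in> I \<Longrightarrow> w i \<ge> 0" "sum w I = 1" "\<And>i. i \<in> I \<Longrightarrow> k i \<in> carrier G"
begin

lemma mean_coord_add_le: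
  assumes "a \<noteq> b"
  shows "mean_coord I w k a g + mean_coord I w k b g \<le> 0"
proof -
  have "mean_coord I w k a g + mean_coord I w k b g =
    (\<Sum>i\<in>I. w i * (edge_coord a (g \<otimes> k i) + edge_coord b (g \<otimes> k i)))"
    by (simp add: mean_coord_def sum.distrib algebra_simps)
  also have "\<dots> \<le> 0"
    using edge_coord_add_le[OF assms] weights(2) by (intro sum_nonpos mult_nonneg_nonpos) auto
  finally show ?thesis .
qed

lemma mean_coord_flip:
  assumes "fst a \<in> S" "g \<in> carrier G"
  shows "mean_coord I w k (inv_letter a) (inv (letter_val G a) \<otimes> g) = 1 - mean_coord I w k a g"
proof -
  have "mean_coord I w k (inv_letter a) (inv (letter_val G a) \<otimes> g) = (\<Sum>i\<in>I. w i * (1 - edge_coord a (g \<otimes> k i)))"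
    unfolding mean_coord_def using assms weights(4)
    by (intro sum.cong refl) (simp add: m_assoc edge_coord_flip)
  also have "\<dots> = 1 - mean_coord I w k a g"
    using weights(3) by (simp add: mean_coord_def algebra_simps sum_subtractf)
  finally show ?thesis .
qed

text \<open>Convexity of the energy along a geodesic. After the first edge the coordinate pointing
  back exceeds 1 - c, so by \<open>mean_coord_add_le\<close> every other direction there lies below
  c - 1. Each further step lowers the bound by 1 again, and reducedness of \<open>u\<close> means
  that the walk never turns back.\<close>

lemma mean_coord_walk:
  assumes "word_over u" "reduced_word u" "u \<noteq> []" "g \<in> carrier G" "mean_coord I w k (hd u) g < c"
  shows "mean_coord I w k (inv_letter (last u)) (inv (word_eval G u) \<otimes> g) > real (length u) - c"
  using assms
proof (induction u arbitrary: g c)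
  case (Cons a u)
  let ?h = "inv (letter_val G a) \<otimes> g"
  have flip: "mean_coord I w k (inv_letter a) ?h > 1 - c"
    using Cons.prems by (simp add: mean_coord_flip)
  show ?case
  proof (cases "u = []")
    case True
    with flip Cons.prems show ?thesis by simp
  next
    case False
    have "hd u \<noteq> inv_letter a"
      using Cons.prems(2) False by (simp add: reduced_word_Cons)
    then have "mean_coord I w k (hd u) ?h < c - 1"
      using mean_coord_add_le[of "hd u" "inv_letter a" ?h] flip by linarith
    with Cons.IH[of ?h "c - 1"] Cons.prems False show ?thesis
      by (simp add: reduced_word_Cons inv_mult_group m_assoc)
  qed
qed simp

text \<open>On arrival at \<open>h\<close> the coordinate pointing back exceeds the length of the
  walk minus 1, while centrality of \<open>h\<close> keeps it below 1; so the walk has one edge.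
  Geometrically, the barycentre lies in the open stars of both vertices, hence inside the edge that
  joins them.\<close>

lemma central_vertex_adjacent:
  assumes "g \<in> carrier G" "h \<in> carrier G" "h \<noteq> g"
    and "\<And>a. fst a \<in> S \<Longrightarrow> mean_coord I w k a g < 1"
    and "\<And>a. fst a \<in> S \<Longrightarrow> mean_coord I w k a h < 1"
  obtains a where "fst a \<in> S" "h = inv (letter_val G a) \<otimes> g"
    "mean_coord I w k a g > 0" "mean_coord I w k (inv_letter a) h = 1 - mean_coord I w k a g"
proof -
  define u where "u = normal_form (g \<otimes> inv h)"
  have gh: "g \<otimes> inv h \<in> carrier G"
    using assms(1,2) by simp
  have ne: "g \<otimes> inv h \<noteq> \<one>"
    using assms(1-3) inv_solve_right'[of \<one> g h] by auto
  have u: "word_over u" "reduced_word u" "word_eval G u = g \<otimes> inv h"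
    unfolding u_def using normal_form[OF gh] by auto
  then have "u \<noteq> []"
    using ne by auto
  have h: "inv (word_eval G u) \<otimes> g = h"
    using assms(1,2) u(3) by (simp add: inv_mult_group m_assoc)
  have hd: "fst (hd u) \<in> S" "fst (last u) \<in> S"
    using u(1) \<open>u \<noteq> []\<close> by (auto simp: word_over_def)
  have "mean_coord I w k (inv_letter (last u)) h > real (length u) - 1"
    using mean_coord_walk[OF u(1,2) \<open>u \<noteq> []\<close> assms(1), of 1] assms(4) hd h by simp
  moreover have "mean_coord I w k (inv_letter (last u)) h < 1"
    using assms(5)[of "inv_letter (last u)"] hd by simp
  ultimately have "length u < 2"
    by linarith
  then obtain a where a: "u = [a]"
    using \<open>u \<noteq> []\<close> by (cases u) (auto simp: less_Suc_eq)
  with hd h have "fst a \<in> S" "h = inv (letter_val G a) \<otimes> g"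
    by auto
  moreover from this have "mean_coord I w k (inv_letter a) h = 1 - mean_coord I w k a g"
    using mean_coord_flip assms(1) by simp
  moreover have "mean_coord I w k (inv_letter a) h < 1"
    using assms(5)[of "inv_letter a"] \<open>fst a \<in> S\<close> by simp
  ultimately show ?thesis
    using that by auto
qed

end

end

lemma free_basis_of_free_group_on: "free_group_on G S \<Longrightarrow> free_basis G S"
  unfolding free_group_on_def free_basis_def free_basis_axioms_def by simp

section \<open>Paths up to homotopy\<close>

definition path_rev :: "(real \<Rightarrow> 'a) \<Rightarrow> real \<Rightarrow> 'a" where
  "path_rev g = (\<lambda>t. g (1 - t))"

definition path_between :: "'a topology \<Rightarrow> 'a \<Rightarrow> 'a \<Rightarrow> (real \<Rightarrow> 'a) \<Rightarrow> bool" where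
  "path_between X x y g \<longleftrightarrow> pathin X g \<and> g 0 = x \<and> g 1 = y"

lemma continuous_map_paste:
  fixes a :: "'a::topological_space \<Rightarrow> real"
  assumes "continuous_on K a"
    and "continuous_map (top_of_set {x \<in> K. a x \<le> c}) X f"
    and "continuous_map (top_of_set {x \<in> K. c \<le> a x}) X g"
    and "\<And>x. x \<in> K \<Longrightarrow> a x = c \<Longrightarrow> f x = g x"
  shows "continuous_map (top_of_set K) X (\<lambda>x. if a x \<le> c then f x else g x)"
proof (rule continuous_map_cases_le)
  have *: "K \<inter> {x \<in> K. P x} = {x \<in> K. P x}" for P
    by auto
  show "continuous_map (subtopology (top_of_set K) {x \<in> topspace (top_of_set K). a x \<le> c}) X f"
    "continuous_map (subtopology (top_of_set K) {x \<in> topspace (top_of_set K). c \<le> a x}) X g"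
    using assms(2,3) by (simp_all add: subtopology_subtopology *)
qed (use assms in auto)

text \<open>\<open>homotopic_with\<close> prescribes its end maps at every real argument, also
  outside the unit interval. Here only values on the unit square count, so homotopies may be pasted
  and reparametrised freely.\<close>

lemma path_homotopic_iff:
  "path_homotopic X g h \<longleftrightarrow>
    (\<exists>H. continuous_map (top_of_set ({0..1} \<times> {0..1})) X H \<and> g 1 = h 1 \<and>
      (\<forall>t\<in>{0..1}. H (0, t) = g t \<and> H (1, t) = h t \<and> H (t, 0) = g 0 \<and> H (t, 1) = g 1))"
  (is "?lhs \<longleftrightarrow> ?rhs")
proof
  assume L: ?lhs
  then have "homotopic_with (\<lambda>k. k 0 = g 0 \<and> k 1 = g 1) (top_of_set {0..1}) X g h"
    unfolding path_homotopic_def by blast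
  then obtain H where "continuous_map (prod_topology (top_of_set {0..1::real}) (top_of_set {0..1::real})) X H"
    "\<forall>t. H (0, t) = g t" "\<forall>t. H (1, t) = h t" "\<forall>t\<in>{0..1}. H (t, 0) = g 0 \<and> H (t, 1) = g 1"
    unfolding homotopic_with_def by blast
  with L show ?rhs
    unfolding path_homotopic_def by (intro exI[of _ H]) auto
next
  assume ?rhs
  then obtain H where H: "continuous_map (top_of_set ({0..1} \<times> {0..1})) X H"
    "\<And>t. t \<in> {0..1} \<Longrightarrow> H (0, t) = g t \<and> H (1, t) = h t \<and> H (t, 0) = g 0 \<and> H (t, 1) = g 1" "g 1 = h 1"
    by blast
  then have hom: "homotopic_with (\<lambda>k. k 0 = g 0 \<and> k 1 = g 1) (top_of_set {0..1}) X g h"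
    by (subst homotopic_with) auto
  moreover have "h 0 = g 0"
    using H(2)[of 1] H(2)[of 0] by force
  ultimately show ?lhs
    using H(3) homotopic_with_imp_continuous_maps[OF hom] by (simp add: path_homotopic_def pathin_def)
qed

lemma path_homotopic_refl: "pathin X g \<Longrightarrow> path_homotopic X g g"
  by (simp add: path_homotopic_def pathin_def)

lemma path_homotopic_sym: "path_homotopic X g h \<Longrightarrow> path_homotopic X h g"
  unfolding path_homotopic_def using homotopic_with_symD by auto

lemma path_homotopic_trans [trans]:
  "path_homotopic X f g \<Longrightarrow> path_homotopic X g h \<Longrightarrow> path_homotopic X f h"
  unfolding path_homotopic_def using homotopic_with_trans by auto

lemma path_homotopic_eq:
  assumes "pathin X g" "\<And>t. t \<in> {0..1} \<Longrightarrow> g t = h t"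
  shows "path_homotopic X g h"
proof -
  have "pathin X h"
    unfolding pathin_def
    by (rule continuous_map_eq[OF assms(1)[unfolded pathin_def]]) (use assms(2) in simp)
  moreover have ends: "h 0 = g 0" "h 1 = g 1"
    using assms(2)[of 0] assms(2)[of 1] by auto
  moreover have "homotopic_with (\<lambda>k. k 0 = g 0 \<and> k 1 = g 1) (top_of_set {0..1}) X g h"
    by (rule homotopic_with_equal) (use assms ends in \<open>auto simp: pathin_def\<close>)
  ultimately show ?thesis
    unfolding path_homotopic_def using assms(1) by simp
qed

lemma path_homotopic_imp_pathin:
  assumes "path_homotopic X g h"
  shows "pathin X g" "pathin X h" "g 0 = h 0" "g 1 = h 1"
  using assms by (auto simp: path_homotopic_def)

lemma path_between_homotopic:
  "path_homotopic X g h \<Longrightarrow> path_between X x y g \<longleftrightarrow> path_between X x y h"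
  by (auto simp: path_between_def path_homotopic_def)

text \<open>The straight-line homotopy between two parametrisations stays in the convex unit
  interval. Associativity, the unit laws and cancellation of a path against its reverse are all
  instances.\<close>

lemma path_homotopic_reparam:
  assumes "pathin X k" "continuous_on {0..1} r" "continuous_on {0..1} s"
    and "r \<in> {0..1} \<rightarrow> {0..1}" "s \<in> {0..1} \<rightarrow> {0..1}" "r 0 = s 0" "r 1 = s 1"
  shows "path_homotopic X (k \<circ> r) (k \<circ> s)"
  unfolding path_homotopic_iff
proof (intro exI conjI ballI)
  let ?R = "\<lambda>z::real \<times> real. (1 - fst z) * r (snd z) + fst z * s (snd z)"
  have "continuous_on ({0..1} \<times> {0..1}) ?R"
    by (intro continuous_intros continuous_on_compose2[OF assms(2)] continuous_on_compose2[OF assms(3)]) auto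
  moreover have "?R ` ({0..1} \<times> {0..1}) \<subseteq> {0..1}"
  proof clarify
    fix u t :: real
    assume "u \<in> {0..1}" "t \<in> {0..1}"
    then show "?R (u, t) \<in> {0..1}"
      using convexD_alt[of "{0..1::real}" "r t" "s t" u] assms(4,5) by fastforce
  qed
  ultimately have "continuous_map (top_of_set ({0..1} \<times> {0..1})) (top_of_set {0..1}) ?R"
    by (simp add: continuous_map_in_subtopology image_subset_iff_funcset)
  then show "continuous_map (top_of_set ({0..1} \<times> {0..1})) X (k \<circ> ?R)"
    using assms(1) unfolding pathin_def by (rule continuous_map_compose)
qed (use assms in \<open>auto simp: algebra_simps\<close>)

lemma pathin_join:
  assumes "pathin X f" "pathin X g" "f 1 = g 0"
  shows "pathin X (path_join f g)"
proof -
  have "continuous_map (top_of_set {x \<in> {0..1}. x \<le> 1/2}) X (f \<circ> (\<lambda>t. 2 * t))"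
    by (rule continuous_map_compose[OF _ assms(1)[unfolded pathin_def]])
       (auto simp: continuous_map_in_subtopology intro!: continuous_intros)
  moreover have "continuous_map (top_of_set {x \<in> {0..1}. 1/2 \<le> x}) X (g \<circ> (\<lambda>t. 2 * t - 1))"
    by (rule continuous_map_compose[OF _ assms(2)[unfolded pathin_def]])
       (auto simp: continuous_map_in_subtopology intro!: continuous_intros)
  ultimately show ?thesis
    unfolding pathin_def path_join_def o_def
  proof (intro continuous_map_paste)
    fix t :: real
    assume t: "t = 1/2"
    show "f (2 * t) = g (2 * t - 1)"
      unfolding t using assms(3) by simp
  qed auto
qed

lemma path_join_ends [simp]: "path_join f g 0 = f 0" "path_join f g 1 = g 1"
  by (auto simp: path_join_def)

lemma path_rev_ends [simp]: "path_rev f 0 = f 1" "path_rev f 1 = f 0"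
  by (auto simp: path_rev_def)

lemma path_rev_rev [simp]: "path_rev (path_rev f) = f"
  by (simp add: path_rev_def)

lemma pathin_rev: "pathin X f \<Longrightarrow> pathin X (path_rev f)"
  unfolding pathin_def path_rev_def
  by (rule continuous_map_compose[of _ "top_of_set {0..1}" "\<lambda>t. 1 - t", unfolded o_def])
     (auto simp: continuous_map_in_subtopology intro!: continuous_intros)

lemma path_between_join:
  "path_between X x y f \<Longrightarrow> path_between X y z g \<Longrightarrow> path_between X x z (path_join f g)"
  by (auto simp: path_between_def pathin_join)

lemma path_between_rev: "path_between X x y f \<Longrightarrow> path_between X y x (path_rev f)"
  by (auto simp: path_between_def pathin_rev)

lemma path_between_const: "x \<in> topspace X \<Longrightarrow> path_between X x x (\<lambda>t. x)"
  by (auto simp: path_between_def)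

lemma path_between_topspace: "path_between X x y f \<Longrightarrow> x \<in> topspace X \<and> y \<in> topspace X"
  by (auto simp: path_between_def path_start_in_topspace path_finish_in_topspace)

lemma path_between_subtopology:
  "path_between (subtopology X S) x y g \<longleftrightarrow> path_between X x y g \<and> g \<in> {0..1} \<rightarrow> S"
  by (auto simp: path_between_def pathin_subtopology)

lemma path_join_cong:
  assumes "path_homotopic X f f'" "path_homotopic X g g'" "f 1 = g 0"
  shows "path_homotopic X (path_join f g) (path_join f' g')"
proof -
  let ?Q = "{0..1::real} \<times> {0..1::real}"
  obtain H where H: "continuous_map (top_of_set ?Q) X H" "f 1 = f' 1"
    "\<And>t. t \<in> {0..1} \<Longrightarrow> H (0, t) = f t \<and> H (1, t) = f' t \<and> H (t, 0) = f 0 \<and> H (t, 1) = f 1"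
    using assms(1) unfolding path_homotopic_iff by metis
  obtain K where K: "continuous_map (top_of_set ?Q) X K" "g 1 = g' 1"
    "\<And>t. t \<in> {0..1} \<Longrightarrow> K (0, t) = g t \<and> K (1, t) = g' t \<and> K (t, 0) = g 0 \<and> K (t, 1) = g 1"
    using assms(2) unfolding path_homotopic_iff by metis
  let ?h = "\<lambda>z. (fst z, 2 * snd z)" and ?k = "\<lambda>z. (fst z, 2 * snd z - 1)"
  have "continuous_map (top_of_set {z \<in> ?Q. snd z \<le> 1/2}) X (H \<circ> ?h)"
    by (rule continuous_map_compose[OF _ H(1)])
       (auto simp: continuous_map_in_subtopology intro!: continuous_intros)
  moreover have "continuous_map (top_of_set {z \<in> ?Q. 1/2 \<le> snd z}) X (K \<circ> ?k)"
    by (rule continuous_map_compose[OF _ K(1)])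
       (auto simp: continuous_map_in_subtopology intro!: continuous_intros)
  moreover have "(H \<circ> ?h) z = (K \<circ> ?k) z" if "z \<in> ?Q" "snd z = 1/2" for z
  proof -
    from that obtain u where "z = (u, 1/2)" "u \<in> {0..1}"
      by (cases z) auto
    with H(3)[of u] K(3)[of u] assms(3) show ?thesis
      by simp
  qed
  moreover have "continuous_on ?Q snd"
    by (intro continuous_intros)
  ultimately have "continuous_map (top_of_set ?Q) X (\<lambda>z. if snd z \<le> 1/2 then (H \<circ> ?h) z else (K \<circ> ?k) z)"
    (is "continuous_map _ _ ?L")
    by (intro continuous_map_paste)
  then show ?thesis
    unfolding path_homotopic_iff
    by (intro exI[of _ ?L] conjI ballI) (use H(2,3) K(2,3) in \<open>auto simp: path_join_def\<close>)
qed

lemma path_rev_cong: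
  assumes "path_homotopic X f g"
  shows "path_homotopic X (path_rev f) (path_rev g)"
proof -
  let ?Q = "{0..1::real} \<times> {0..1::real}"
  obtain H where H: "continuous_map (top_of_set ?Q) X H" "f 1 = g 1"
    "\<And>t. t \<in> {0..1} \<Longrightarrow> H (0, t) = f t \<and> H (1, t) = g t \<and> H (t, 0) = f 0 \<and> H (t, 1) = f 1"
    using assms unfolding path_homotopic_iff by metis
  have "continuous_map (top_of_set ?Q) X (H \<circ> (\<lambda>z. (fst z, 1 - snd z)))"
    by (rule continuous_map_compose[OF _ H(1)])
       (auto simp: continuous_map_in_subtopology intro!: continuous_intros)
  then show ?thesis
    unfolding path_homotopic_iff path_rev_def
    using H(2,3) path_homotopic_imp_pathin(3)[OF assms]
    by (intro exI[of _ "H \<circ> (\<lambda>z. (fst z, 1 - snd z))"] conjI ballI) auto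
qed

lemma path_join_assoc:
  assumes "pathin X f" "pathin X g" "pathin X h" "f 1 = g 0" "g 1 = h 0"
  shows "path_homotopic X (path_join (path_join f g) h) (path_join f (path_join g h))"
proof -
  let ?k = "path_join f (path_join g h)"
  let ?r = "\<lambda>t::real. if t \<le> 1/4 then 2 * t else if t \<le> 1/2 then t + 1/4 else (t + 1) / 2"
  have k: "pathin X ?k"
    using assms by (simp add: pathin_join)
  have "pathin X (path_join (path_join f g) h)"
    using assms by (simp add: pathin_join)
  then have "path_homotopic X (path_join (path_join f g) h) (?k \<circ> ?r)"
    by (rule path_homotopic_eq) (auto simp: path_join_def add_divide_distrib diff_divide_distrib algebra_simps)
  also have "path_homotopic X (?k \<circ> ?r) (?k \<circ> id)"
  proof (rule path_homotopic_reparam[OF k])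
    \<comment> \<open>The slopes 2, 1, 1/2 decrease, so the piecewise affine \<open>?r\<close> is
      the minimum of its three pieces, which makes its continuity immediate.\<close>
    have "?r = (\<lambda>t. min (2 * t) (min (t + 1/4) ((t + 1) / 2)))"
      by (auto simp: fun_eq_iff min_def field_simps)
    moreover have "continuous_on {0..1} \<dots>"
      by (intro continuous_intros) auto
    ultimately show "continuous_on {0..1} ?r"
      by (simp only:)
  qed (auto intro: continuous_intros)
  finally show ?thesis by simp
qed

lemma path_join_const_left:
  assumes "pathin X f" "f 0 = x"
  shows "path_homotopic X (path_join (\<lambda>t. x) f) f"
proof -
  have "path_join (\<lambda>t. x) f = f \<circ> (\<lambda>t. max 0 (2 * t - 1))"
  proof
    fix t :: real
    have "max 0 (2 * t - 1) = (if t \<le> 1/2 then 0 else 2 * t - 1)"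
      by (simp add: max_def)
    then show "path_join (\<lambda>t. x) f t = (f \<circ> (\<lambda>t. max 0 (2 * t - 1))) t"
      using assms(2) by (simp add: path_join_def)
  qed
  moreover have "path_homotopic X (f \<circ> (\<lambda>t. max 0 (2 * t - 1))) (f \<circ> id)"
    by (rule path_homotopic_reparam[OF assms(1)]) (auto intro!: continuous_intros)
  ultimately show ?thesis by simp
qed

lemma path_join_const_right:
  assumes "pathin X f" "f 1 = x"
  shows "path_homotopic X (path_join f (\<lambda>t. x)) f"
proof -
  have "path_join f (\<lambda>t. x) = f \<circ> (\<lambda>t. min 1 (2 * t))"
  proof
    fix t :: real
    have "min 1 (2 * t) = (if t \<le> 1/2 then 2 * t else 1)"
      by (simp add: min_def)
    then show "path_join f (\<lambda>t. x) t = (f \<circ> (\<lambda>t. min 1 (2 * t))) t"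
      using assms(2) by (simp add: path_join_def)
  qed
  moreover have "path_homotopic X (f \<circ> (\<lambda>t. min 1 (2 * t))) (f \<circ> id)"
    by (rule path_homotopic_reparam[OF assms(1)]) (auto intro!: continuous_intros)
  ultimately show ?thesis by simp
qed

lemma path_join_rev_right:
  assumes "pathin X f"
  shows "path_homotopic X (path_join f (path_rev f)) (\<lambda>t. f 0)"
proof -
  have "path_join f (path_rev f) = f \<circ> (\<lambda>t. min (2 * t) (2 - 2 * t))"
    by (auto simp: path_join_def path_rev_def fun_eq_iff min_def)
  moreover have "path_homotopic X (f \<circ> (\<lambda>t. min (2 * t) (2 - 2 * t))) (f \<circ> (\<lambda>t. 0))"
    by (rule path_homotopic_reparam[OF assms(1)]) (auto intro!: continuous_intros)
  ultimately show ?thesis by (simp add: o_def)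
qed

lemma path_rev_join:
  assumes "pathin X f" "pathin X g" "f 1 = g 0"
  shows "path_homotopic X (path_rev (path_join f g)) (path_join (path_rev g) (path_rev f))"
proof (rule path_homotopic_eq)
  show "pathin X (path_rev (path_join f g))"
    using assms by (intro pathin_rev pathin_join)
  fix t :: real
  \<comment> \<open>At \<open>t = 1/2\<close> the two sides evaluate different paths, because
    \<open>path_join\<close> gives the midpoint to its first argument; there
    \<open>f 1 = g 0\<close> is needed.\<close>
  consider "t < 1/2" | "t = 1/2" | "t > 1/2"
    by linarith
  then show "path_rev (path_join f g) t = path_join (path_rev g) (path_rev f) t"
    using assms(3) by cases (auto simp: path_rev_def path_join_def algebra_simps)
qed

lemma path_homotopic_cancel_right:
  assumes "path_between X x y f" "path_between X y z g"
  shows "path_homotopic X (path_join (path_join f g) (path_rev g)) f"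
proof -
  have "path_homotopic X (path_join (path_join f g) (path_rev g)) (path_join f (path_join g (path_rev g)))"
    using assms by (intro path_join_assoc) (auto simp: path_between_def pathin_rev)
  also have "path_homotopic X \<dots> (path_join f (\<lambda>t. y))"
    using assms path_join_rev_right[of X g]
    by (intro path_join_cong path_homotopic_refl) (auto simp: path_between_def)
  also have "path_homotopic X \<dots> f"
    using assms by (intro path_join_const_right) (auto simp: path_between_def)
  finally show ?thesis .
qed

lemma path_homotopic_cancel_middle:
  assumes "path_between X x y f" "path_between X y z g" "path_between X x' y h"
  shows "path_homotopic X (path_join (path_join f g) (path_rev (path_join h g))) (path_join f (path_rev h))"
proof -
  note ps = assms[unfolded path_between_def]
  have "path_homotopic X (path_join (path_join f g) (path_rev (path_join h g)))
      (path_join (path_join f g) (path_join (path_rev g) (path_rev h)))"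
    using ps by (intro path_join_cong path_homotopic_refl path_rev_join) (auto simp: pathin_join)
  also have "path_homotopic X \<dots> (path_join (path_join (path_join f g) (path_rev g)) (path_rev h))"
    using ps by (intro path_homotopic_sym[OF path_join_assoc]) (auto simp: pathin_join pathin_rev)
  also have "path_homotopic X \<dots> (path_join f (path_rev h))"
    using ps path_homotopic_cancel_right[OF assms(1,2)]
    by (intro path_join_cong path_homotopic_refl) (auto simp: pathin_rev)
  finally show ?thesis .
qed

section \<open>The fundamental group through representatives\<close>

lemma loop_in_iff_path_between: "loop_in X x g \<longleftrightarrow> path_between X x x g"
  by (simp add: loop_in_def path_between_def)

lemma loop_class_eq_iff:
  assumes "loop_in X x g" "loop_in X x h"
  shows "loop_class X x g = loop_class X x h \<longleftrightarrow> path_homotopic X g h"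
proof
  assume "loop_class X x g = loop_class X x h"
  moreover have "h \<in> loop_class X x h"
    using assms by (auto simp: loop_class_def loop_in_def path_homotopic_refl)
  ultimately show "path_homotopic X g h"
    by (auto simp: loop_class_def)
next
  assume "path_homotopic X g h"
  then show "loop_class X x g = loop_class X x h"
    unfolding loop_class_def using path_homotopic_sym path_homotopic_trans by blast
qed

lemma fundamental_group_closed:
  "loop_in X x g \<Longrightarrow> loop_class X x g \<in> carrier (fundamental_group X x)"
  by (auto simp: fundamental_group_def)

lemma fundamental_group_rep:
  assumes "A \<in> carrier (fundamental_group X x)"
  obtains g where "loop_in X x g" "A = loop_class X x g"
  using assms by (auto simp: fundamental_group_def)

text \<open>The product is defined through representatives picked by choice. Since joining respects
  homotopy, any representatives give the same class.\<close>

lemma fundamental_group_mult: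
  assumes "loop_in X x g" "loop_in X x h"
  shows "loop_class X x g \<otimes>\<^bsub>fundamental_group X x\<^esub> loop_class X x h = loop_class X x (path_join g h)"
proof -
  define g' where "g' = (SOME k. k \<in> loop_class X x g)"
  define h' where "h' = (SOME k. k \<in> loop_class X x h)"
  have "g \<in> loop_class X x g" "h \<in> loop_class X x h"
    using assms by (auto simp: loop_class_def loop_in_def path_homotopic_refl)
  then have "g' \<in> loop_class X x g" "h' \<in> loop_class X x h"
    unfolding g'_def h'_def by (auto simp del: Collect_mem_eq intro: someI[where P="\<lambda>k. k \<in> loop_class X x g"] someI[where P="\<lambda>k. k \<in> loop_class X x h"])
  then have gh: "loop_in X x g'" "path_homotopic X g g'" "loop_in X x h'" "path_homotopic X h h'"
    by (auto simp: loop_class_def)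
  have "loop_class X x (path_join g' h') = loop_class X x (path_join g h)"
    using gh assms
    by (subst loop_class_eq_iff) (auto simp: loop_in_def pathin_join intro!: path_join_cong intro: path_homotopic_sym)
  then show ?thesis
    by (simp add: fundamental_group_def g'_def h'_def)
qed

section \<open>Transport in covering spaces\<close>

locale covering =
  fixes E :: "'e topology" and X :: "'a topology" and p :: "'e \<Rightarrow> 'a"
  assumes covering: "covering_map E X p"
begin

definition sheet :: "'e set \<Rightarrow> 'a set \<Rightarrow> bool" where
  "sheet V U \<longleftrightarrow> openin E V \<and> openin X U \<and> homeomorphic_map (subtopology E V) (subtopology X U) p"

definition evenly_covered :: "'a set \<Rightarrow> bool" where
  "evenly_covered U \<longleftrightarrow> openin X U \<and> (\<exists>\<V>. \<Union>\<V> = {e \<in> topspace E. p e \<in> U} \<and>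
     pairwise disjnt \<V> \<and> (\<forall>V\<in>\<V>. sheet V U))"

definition fibre :: "'a \<Rightarrow> 'e set" where
  "fibre x = {e \<in> topspace E. p e = x}"

lemma evenly_covered_exists:
  assumes "x \<in> topspace X"
  obtains U where "evenly_covered U" "x \<in> U"
  using assms covering unfolding covering_map_def evenly_covered_def sheet_def by metis

lemma continuous_p: "continuous_map E X p"
  using covering by (simp add: covering_map_def)

lemma p_in_topspace: "e \<in> topspace E \<Longrightarrow> p e \<in> topspace X"
  using continuous_p by (auto simp: continuous_map_def)

lemma sheet_bij:
  assumes "sheet V U"
  shows "bij_betw p V U"
proof -
  have "V \<subseteq> topspace E" "U \<subseteq> topspace X"
    using assms openin_subset unfolding sheet_def by blast+
  moreover have "homeomorphic_map (subtopology E V) (subtopology X U) p"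
    using assms by (simp add: sheet_def)
  ultimately show ?thesis
    unfolding bij_betw_def by (metis homeomorphic_imp_injective_map homeomorphic_imp_surjective_map
      topspace_subtopology_subset)
qed

lemma sheet_inverse:
  assumes "sheet V U"
  shows "continuous_map (subtopology X U) E (inv_into V p)"
proof -
  have sub: "V \<subseteq> topspace E" "U \<subseteq> topspace X"
    using assms openin_subset unfolding sheet_def by blast+
  have "homeomorphic_map (subtopology E V) (subtopology X U) p"
    using assms by (simp add: sheet_def)
  then obtain q where q: "homeomorphic_maps (subtopology E V) (subtopology X U) p q"
    using homeomorphic_map_maps by blast
  have tops: "topspace (subtopology X U) = U"
    using sub by (simp add: inf.absorb2)
  have q': "continuous_map (subtopology X U) E q" "q \<in> U \<rightarrow> V" "\<forall>y\<in>U. p (q y) = y"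
    using q unfolding homeomorphic_maps_def continuous_map_in_subtopology tops by auto
  show ?thesis
  proof (rule continuous_map_eq[OF q'(1)])
    fix y assume "y \<in> topspace (subtopology X U)"
    then have "y \<in> U"
      by simp
    with q'(2,3) have "q y \<in> V" "p (q y) = y"
      by auto
    with sheet_bij[OF assms] show "q y = inv_into V p y"
      by (simp add: bij_betw_def inv_into_f_eq)
  qed
qed

lemma sheet_at:
  assumes "evenly_covered U" "e \<in> topspace E" "p e \<in> U"
  obtains V where "sheet V U" "e \<in> V"
  using assms unfolding evenly_covered_def by blast

section \<open>Unique lifting and lifting of squares\<close>

lemma two_sheets:
  assumes "e \<in> topspace E" "e' \<in> topspace E" "p e = p e'" "e \<noteq> e'"
  obtains V V' U where "sheet V U" "sheet V' U" "e \<in> V" "e' \<in> V'" "disjnt V V'"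
proof -
  obtain U where U: "evenly_covered U" "p e \<in> U"
    using evenly_covered_exists p_in_topspace assms(1) by metis
  from U(1)[unfolded evenly_covered_def, THEN conjunct2]
  obtain \<V> where \<V>: "\<Union>\<V> = {e \<in> topspace E. p e \<in> U}" "pairwise disjnt \<V>" "\<forall>V\<in>\<V>. sheet V U"
    by (elim exE conjE)
  have "e \<in> \<Union>\<V>" "e' \<in> \<Union>\<V>"
    using assms U(2) unfolding \<V>(1) by auto
  then obtain V V' where V: "V \<in> \<V>" "e \<in> V" "V' \<in> \<V>" "e' \<in> V'"
    by blast
  have "inj_on p V"
    using sheet_bij V(1) \<V>(3) by (auto simp: bij_betw_def)
  with V assms(3,4) have "V \<noteq> V'"
    by (auto dest: inj_onD)
  with \<V>(2) V have "disjnt V V'"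
    by (auto simp: pairwise_def)
  with V \<V>(3) show ?thesis
    by (intro that[of V U V']) auto
qed

text \<open>The coincidence set is open because \<open>p\<close> is injective on a sheet, and closed
  because two distinct points of one fibre lie in disjoint sheets by \<open>two_sheets\<close>. A
  nonempty clopen subset of a connected set is everything.\<close>

lemma lift_unique:
  fixes K :: "'k::topological_space set"
  assumes "connected K" "continuous_map (top_of_set K) E l" "continuous_map (top_of_set K) E m"
    and lifts: "\<And>w. w \<in> K \<Longrightarrow> p (l w) = p (m w)" and "z \<in> K" "l z = m z" "w \<in> K"
  shows "l w = m w"
proof -
  let ?T = "{w \<in> K. l w = m w}"
  have top: "l w \<in> topspace E" "m w \<in> topspace E" if "w \<in> K" for w
    using that assms(2,3) by (auto simp: continuous_map_def)
  have pre: "openin (top_of_set K) {w \<in> K. l w \<in> V}" "openin (top_of_set K) {w \<in> K. m w \<in> V}" if "openin E V" for V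
    using that assms(2,3) by (auto simp: continuous_map_def)
  have "openin (top_of_set K) ?T"
  proof (subst openin_subopen, intro ballI)
    fix w assume w: "w \<in> ?T"
    obtain U where U: "evenly_covered U" "p (l w) \<in> U"
      using evenly_covered_exists p_in_topspace top w by (metis (no_types, lifting) mem_Collect_eq)
    obtain V where V: "sheet V U" "l w \<in> V"
      using sheet_at[OF U(1) _ U(2)] top w by blast
    let ?W = "{w \<in> K. l w \<in> V} \<inter> {w \<in> K. m w \<in> V}"
    have "openin (top_of_set K) ?W"
      using pre V(1) unfolding sheet_def by (intro openin_Int) blast+
    moreover have "?W \<subseteq> ?T"
      using sheet_bij[OF V(1)] lifts by (auto simp: bij_betw_def dest: inj_onD)
    moreover have "w \<in> ?W"
      using w V(2) by simp
    ultimately show "\<exists>W. openin (top_of_set K) W \<and> w \<in> W \<and> W \<subseteq> ?T"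
      by blast
  qed
  moreover have "openin (top_of_set K) (K - ?T)"
  proof (subst openin_subopen, intro ballI)
    fix w assume w: "w \<in> K - ?T"
    then have lm: "l w \<in> topspace E" "m w \<in> topspace E" "p (l w) = p (m w)" "l w \<noteq> m w"
      using top lifts by auto
    obtain V V' U where V: "sheet V U" "sheet V' U" "l w \<in> V" "m w \<in> V'" "disjnt V V'"
      by (rule two_sheets[OF lm])
    let ?W = "{w \<in> K. l w \<in> V} \<inter> {w \<in> K. m w \<in> V'}"
    have "openin (top_of_set K) ?W"
      using pre V(1,2) unfolding sheet_def by (intro openin_Int) blast+
    moreover have "?W \<subseteq> K - ?T"
      using V(5) by (auto simp: disjnt_iff)
    moreover have "w \<in> ?W"
      using w V(3,4) by simp
    ultimately show "\<exists>W. openin (top_of_set K) W \<and> w \<in> W \<and> W \<subseteq> K - ?T"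
      by blast
  qed
  then have "closedin (top_of_set K) ?T"
    by (simp add: closedin_def)
  ultimately show ?thesis
    using assms(1,5-7) unfolding connected_clopen by blast
qed

text \<open>The prescribed point may lie anywhere in \<open>K\<close>, so that two pieces can be
  glued no matter which of them contains it.\<close>

definition lifts_over :: "('k::topological_space \<Rightarrow> 'a) \<Rightarrow> 'k set \<Rightarrow> bool" where
  "lifts_over h K \<longleftrightarrow> (\<forall>z\<in>K. \<forall>e\<in>fibre (h z). \<exists>l. continuous_map (top_of_set K) E l \<and>
     l z = e \<and> (\<forall>w\<in>K. p (l w) = h w))"

lemma lifts_over_local:
  assumes "evenly_covered U" "continuous_map (top_of_set K) X h" "h ` K \<subseteq> U"
  shows "lifts_over h K"
  unfolding lifts_over_def
proof (intro ballI)
  fix z e assume z: "z \<in> K" "e \<in> fibre (h z)"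
  then obtain V where V: "sheet V U" "e \<in> V"
    using sheet_at[OF assms(1), of e] assms(3) unfolding fibre_def by auto
  have "continuous_map (top_of_set K) (subtopology X U) h"
    using assms(2,3) by (auto simp: continuous_map_in_subtopology)
  then have "continuous_map (top_of_set K) E (inv_into V p \<circ> h)"
    using sheet_inverse[OF V(1)] by (rule continuous_map_compose)
  moreover have "p (inv_into V p (h w)) = h w" if "w \<in> K" for w
    using that assms(3) sheet_bij[OF V(1)] by (metis bij_betw_inv_into_right image_subset_iff)
  moreover have "inv_into V p (h z) = e"
    using z(2) bij_betw_inv_into_left[OF sheet_bij[OF V(1)] V(2)] by (simp add: fibre_def)
  ultimately show "\<exists>l. continuous_map (top_of_set K) E l \<and> l z = e \<and> (\<forall>w\<in>K. p (l w) = h w)"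
    by (intro exI[of _ "inv_into V p \<circ> h"]) auto
qed

text \<open>Lift first over the piece that contains \<open>z\<close>, read off the value at one
  point \<open>y\<close> of the common wall, and start the second lift there. Agreement at
  \<open>y\<close> spreads over the whole wall by \<open>lift_unique\<close>, since the wall is
  connected.\<close>

lemma lifts_over_paste:
  fixes a :: "'k::topological_space \<Rightarrow> real"
  assumes cont: "continuous_on K a" and lifts: "lifts_over h {w\<in>K. a w \<le> c}" "lifts_over h {w\<in>K. c \<le> a w}"
    and conn: "connected {w\<in>K. a w = c}" and ne: "{w\<in>K. a w = c} \<noteq> {}"
  shows "lifts_over h K"
  unfolding lifts_over_def
proof (intro ballI)
  let ?A = "{w\<in>K. a w \<le> c}" and ?B = "{w\<in>K. c \<le> a w}" and ?C = "{w\<in>K. a w = c}"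
  fix z e assume z: "z \<in> K" "e \<in> fibre (h z)"
  obtain y where y: "y \<in> K" "a y = c"
    using ne by blast
  have "\<exists>l m. continuous_map (top_of_set ?A) E l \<and> continuous_map (top_of_set ?B) E m \<and>
    (\<forall>w\<in>?A. p (l w) = h w) \<and> (\<forall>w\<in>?B. p (m w) = h w) \<and> l y = m y \<and> (if a z \<le> c then l z else m z) = e"
  proof (cases "a z \<le> c")
    case True
    then obtain l where l: "continuous_map (top_of_set ?A) E l" "l z = e" "\<forall>w\<in>?A. p (l w) = h w"
      using lifts(1) z unfolding lifts_over_def by blast
    have "l y \<in> fibre (h y)"
      using l y by (auto simp: fibre_def continuous_map_def)
    then obtain m where "continuous_map (top_of_set ?B) E m" "m y = l y" "\<forall>w\<in>?B. p (m w) = h w"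
      using lifts(2) y unfolding lifts_over_def by force
    with l True show ?thesis
      by (intro exI[of _ l] exI[of _ m]) simp
  next
    case False
    then obtain m where m: "continuous_map (top_of_set ?B) E m" "m z = e" "\<forall>w\<in>?B. p (m w) = h w"
      using lifts(2) z unfolding lifts_over_def by force
    have "m y \<in> fibre (h y)"
      using m y by (auto simp: fibre_def continuous_map_def)
    then obtain l where "continuous_map (top_of_set ?A) E l" "l y = m y" "\<forall>w\<in>?A. p (l w) = h w"
      using lifts(1) y unfolding lifts_over_def by force
    with m False show ?thesis
      by (intro exI[of _ l] exI[of _ m]) simp
  qed
  then obtain l m where lm: "continuous_map (top_of_set ?A) E l" "continuous_map (top_of_set ?B) E m"
    "\<forall>w\<in>?A. p (l w) = h w" "\<forall>w\<in>?B. p (m w) = h w" "l y = m y" "(if a z \<le> c then l z else m z) = e"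
    by (elim exE conjE)
  have "l w = m w" if "w \<in> K" "a w = c" for w
  proof (rule lift_unique[OF conn])
    show "continuous_map (top_of_set ?C) E l" "continuous_map (top_of_set ?C) E m"
      using lm(1,2) by (auto elim!: continuous_map_from_subtopology_mono)
  qed (use lm y that in auto)
  then have "continuous_map (top_of_set K) E (\<lambda>w. if a w \<le> c then l w else m w)"
    by (intro continuous_map_paste cont lm)
  with lm show "\<exists>l. continuous_map (top_of_set K) E l \<and> l z = e \<and> (\<forall>w\<in>K. p (l w) = h w)"
    by (intro exI[of _ "\<lambda>w. if a w \<le> c then l w else m w"]) auto
qed

text \<open>Bisection is applied twice in place of a grid of small squares. For fixed
  \<open>x\<close>, bisecting the vertical interval gives a width that works for the whole strip
  around \<open>x\<close>, since only finitely many widths have to be compared; bisecting the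
  horizontal interval then joins the strips.\<close>

lemma lifts_over_rectangle:
  fixes h :: "real \<times> real \<Rightarrow> 'a"
  assumes h: "continuous_map euclidean X h"
  shows "lifts_over h ({0..1} \<times> {0..1})"
proof -
  have strip: "\<exists>\<delta>>0. \<forall>a b. a \<le> x \<and> x \<le> b \<and> b - a < \<delta> \<longrightarrow> lifts_over h ({a..b} \<times> {0..1})" for x
    using zero_le_one[where 'a=real]
  proof (induction rule: Bolzano[where P = "\<lambda>c d. \<exists>\<delta>>0. \<forall>a b. a \<le> x \<and> x \<le> b \<and> b - a < \<delta> \<longrightarrow> lifts_over h ({a..b} \<times> {c..d})"])
    case (trans c d e)
    then obtain \<delta> \<delta>' where \<delta>: "\<delta> > 0" "\<forall>a b. a \<le> x \<and> x \<le> b \<and> b - a < \<delta> \<longrightarrow> lifts_over h ({a..b} \<times> {c..d})"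
      "\<delta>' > 0" "\<forall>a b. a \<le> x \<and> x \<le> b \<and> b - a < \<delta>' \<longrightarrow> lifts_over h ({a..b} \<times> {d..e})"
      by blast
    have "lifts_over h ({a..b} \<times> {c..e})" if ab: "a \<le> x" "x \<le> b" "b - a < min \<delta> \<delta>'" for a b
    proof (rule lifts_over_paste[where a = snd and c = d])
      have eq: "{w \<in> {a..b} \<times> {c..e}. snd w \<le> d} = {a..b} \<times> {c..d}" "{w \<in> {a..b} \<times> {c..e}. d \<le> snd w} = {a..b} \<times> {d..e}"
        "{w \<in> {a..b} \<times> {c..e}. snd w = d} = {a..b} \<times> {d}"
        using trans(3,4) by auto
      show "lifts_over h {w \<in> {a..b} \<times> {c..e}. snd w \<le> d}" "lifts_over h {w \<in> {a..b} \<times> {c..e}. d \<le> snd w}"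
        unfolding eq using \<delta> ab by auto
      show "connected {w \<in> {a..b} \<times> {c..e}. snd w = d}" "{w \<in> {a..b} \<times> {c..e}. snd w = d} \<noteq> {}"
        unfolding eq using ab by (auto intro: connected_Times)
    qed (intro continuous_intros)
    with \<delta> show ?case by (intro exI[of _ "min \<delta> \<delta>'"]) auto
  next
    case (local y)
    have "h (x, y) \<in> topspace X"
      using h by (auto simp: continuous_map_def)
    then obtain U where U: "evenly_covered U" "h (x, y) \<in> U"
      using evenly_covered_exists by metis
    have "open {w. h w \<in> U}"
      using U(1) h by (auto simp: continuous_map_def evenly_covered_def)
    moreover have "(x, y) \<in> {w. h w \<in> U}"
      using U(2) by simp
    ultimately obtain A B where AB: "open A" "open B" "(x, y) \<in> A \<times> B" "A \<times> B \<subseteq> {w. h w \<in> U}"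
      by (rule open_prod_elim)
    obtain r s where rs: "r > 0" "ball x r \<subseteq> A" "s > 0" "ball y s \<subseteq> B"
      using AB(1-3) openE by (metis mem_Sigma_iff)
    have "lifts_over h ({a..b} \<times> {c..d})"
      if "a \<le> x" "x \<le> b" "b - a < r" "c \<le> y" "y \<le> d" "d - c < s" for a b c d
    proof (rule lifts_over_local[OF U(1)])
      show "continuous_map (top_of_set ({a..b} \<times> {c..d})) X h"
        using h by (rule continuous_map_from_subtopology)
      have "{a..b} \<subseteq> ball x r" "{c..d} \<subseteq> ball y s"
        using that by (auto simp: dist_real_def)
      then show "h ` ({a..b} \<times> {c..d}) \<subseteq> U"
        using AB(4) rs by blast
    qed
    with rs(1,3) show ?case by blast
  qed
  show ?thesis
    using zero_le_one[where 'a=real]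
  proof (induction rule: Bolzano[where P = "\<lambda>a b. lifts_over h ({a..b} \<times> {0..1})"])
    case (trans a b c)
    show ?case
    proof (rule lifts_over_paste[where a = fst and c = b])
      have eq: "{w \<in> {a..c} \<times> {0..1::real}. fst w \<le> b} = {a..b} \<times> {0..1}" "{w \<in> {a..c} \<times> {0..1::real}. b \<le> fst w} = {b..c} \<times> {0..1}"
        "{w \<in> {a..c} \<times> {0..1::real}. fst w = b} = {b} \<times> {0..1}"
        using trans(3,4) by auto
      show "lifts_over h {w \<in> {a..c} \<times> {0..1}. fst w \<le> b}" "lifts_over h {w \<in> {a..c} \<times> {0..1}. b \<le> fst w}"
        unfolding eq using trans by auto
      show "connected {w \<in> {a..c} \<times> {0..1::real}. fst w = b}" "{w \<in> {a..c} \<times> {0..1::real}. fst w = b} \<noteq> {}"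
        unfolding eq by (auto intro: connected_Times)
    qed (intro continuous_intros)
  next
    case (local x)
    show ?case by (rule strip)
  qed
qed

lemma square_lift:
  fixes h :: "real \<times> real \<Rightarrow> 'a"
  assumes "continuous_map (top_of_set ({0..1} \<times> {0..1})) X h" "e \<in> fibre (h (0, 0))"
  obtains l where "continuous_map (top_of_set ({0..1::real} \<times> {0..1::real})) E l" "l (0, 0) = e"
    "\<And>w. w \<in> {0..1} \<times> {0..1} \<Longrightarrow> p (l w) = h w"
proof -
  \<comment> \<open>Clamping both coordinates retracts the plane onto the square and so extends
    \<open>h\<close> to the total map that \<open>lifts_over_rectangle\<close> asks for.\<close>
  define r :: "real \<times> real \<Rightarrow> real \<times> real" where "r = (\<lambda>w. (max 0 (min 1 (fst w)), max 0 (min 1 (snd w))))"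
  have r: "r w = w" if "w \<in> {0..1} \<times> {0..1}" for w
    using that by (auto simp: r_def)
  have "continuous_map euclidean (top_of_set ({0..1} \<times> {0..1})) r"
    unfolding r_def by (auto simp: continuous_map_in_subtopology intro!: continuous_intros)
  then have "continuous_map euclidean X (h \<circ> r)"
    using assms(1) by (rule continuous_map_compose)
  then have "lifts_over (h \<circ> r) ({0..1} \<times> {0..1})"
    by (rule lifts_over_rectangle)
  moreover have "e \<in> fibre ((h \<circ> r) (0, 0))"
    using assms(2) by (simp add: r_def)
  moreover have "(0, 0) \<in> {0..1::real} \<times> {0..1::real}"
    by simp
  ultimately obtain l where l: "continuous_map (top_of_set ({0..1::real} \<times> {0..1::real})) E l" "l (0, 0) = e"
    "\<forall>w\<in>{0..1} \<times> {0..1}. p (l w) = (h \<circ> r) w"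
    unfolding lifts_over_def by blast
  show ?thesis
    by (rule that[OF l(1,2)]) (use l(3) r in force)
qed

section \<open>Transport of fibres along paths\<close>

definition transport :: "(real \<Rightarrow> 'a) \<Rightarrow> 'e \<Rightarrow> 'e" where
  "transport g e = (SOME e'. \<exists>l. pathin E l \<and> l 0 = e \<and> l 1 = e' \<and> (\<forall>t\<in>{0..1}. p (l t) = g t))"

lemma path_lift:
  assumes "pathin X g" "e \<in> fibre (g 0)"
  obtains l where "pathin E l" "l 0 = e" "\<And>t. t \<in> {0..1} \<Longrightarrow> p (l t) = g t"
proof -
  \<comment> \<open>A path is treated as a map of the square that ignores the first
    coordinate.\<close>
  have "continuous_map (top_of_set ({0..1} \<times> {0..1})) (top_of_set {0..1}) (snd :: real \<times> real \<Rightarrow> real)"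
    by (auto simp: continuous_map_in_subtopology intro!: continuous_intros)
  from continuous_map_compose[OF this assms(1)[unfolded pathin_def]]
  have g: "continuous_map (top_of_set ({0..1} \<times> {0..1})) X (\<lambda>w::real \<times> real. g (snd w))"
    by (simp add: o_def)
  have e: "e \<in> fibre (g (snd (0::real, 0::real)))"
    using assms(2) by simp
  obtain l where l: "continuous_map (top_of_set ({0..1::real} \<times> {0..1::real})) E l" "l (0, 0) = e"
    "\<And>w. w \<in> {0..1} \<times> {0..1} \<Longrightarrow> p (l w) = g (snd w)"
    using square_lift[OF g e] by blast
  have "continuous_map (top_of_set {0..1}) (top_of_set ({0..1} \<times> {0..1})) (\<lambda>t::real. (0::real, t))"
    by (auto simp: continuous_map_in_subtopology intro!: continuous_intros)
  then have "pathin E (l \<circ> (\<lambda>t. (0, t)))"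
    unfolding pathin_def using l(1) by (rule continuous_map_compose)
  then show ?thesis
    using l by (intro that[of "l \<circ> (\<lambda>t. (0, t))"]) auto
qed

lemma transport_eq:
  assumes "pathin E l" "\<And>t. t \<in> {0..1} \<Longrightarrow> p (l t) = g t"
  shows "transport g (l 0) = l 1"
  unfolding transport_def
proof (rule some_equality)
  fix e' assume "\<exists>m. pathin E m \<and> m 0 = l 0 \<and> m 1 = e' \<and> (\<forall>t\<in>{0..1}. p (m t) = g t)"
  then obtain m where m: "pathin E m" "m 0 = l 0" "m 1 = e'" "\<forall>t\<in>{0..1}. p (m t) = g t"
    by blast
  have "m 1 = l 1"
    by (rule lift_unique[of "{0..1}" m l 0]) (use m assms in \<open>auto simp: pathin_def\<close>)
  with m(3) show "e' = l 1" by simp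
qed (use assms in blast)

lemma transport_lift:
  assumes "path_between X x y g" "e \<in> fibre x"
  obtains l where "path_between E e (transport g e) l" "\<And>t. t \<in> {0..1} \<Longrightarrow> p (l t) = g t"
proof -
  have g: "pathin X g" "e \<in> fibre (g 0)"
    using assms by (auto simp: path_between_def)
  obtain l where l: "pathin E l" "l 0 = e" "\<And>t. t \<in> {0..1} \<Longrightarrow> p (l t) = g t"
    using path_lift[OF g] by blast
  moreover from this have "transport g e = l 1"
    using transport_eq by blast
  ultimately show ?thesis
    using that[of l] by (auto simp: path_between_def)
qed

lemma transport_in_fibre:
  assumes "path_between X x y g" "e \<in> fibre x"
  shows "transport g e \<in> fibre y"
proof -
  obtain l where l: "path_between E e (transport g e) l" "\<And>t. t \<in> {0..1} \<Longrightarrow> p (l t) = g t"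
    using transport_lift[OF assms] by blast
  have "transport g e = l 1" "g 1 = y"
    using l(1) assms(1) by (simp_all add: path_between_def)
  then show ?thesis
    using l(2)[of 1] path_between_topspace[OF l(1)] by (simp add: fibre_def)
qed

lemma transport_join:
  assumes "path_between X x y f" "path_between X y z g" "e \<in> fibre x"
  shows "transport (path_join f g) e = transport g (transport f e)"
proof -
  obtain l where l: "path_between E e (transport f e) l" "\<And>t. t \<in> {0..1} \<Longrightarrow> p (l t) = f t"
    using transport_lift[OF assms(1,3)] by blast
  obtain m where m: "path_between E (transport f e) (transport g (transport f e)) m" "\<And>t. t \<in> {0..1} \<Longrightarrow> p (m t) = g t"
    using transport_lift[OF assms(2) transport_in_fibre[OF assms(1,3)]] by blast
  have "transport (path_join f g) (path_join l m 0) = path_join l m 1"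
    using path_between_join[OF l(1) m(1)] l(2) m(2)
    by (intro transport_eq) (auto simp: path_between_def path_join_def)
  with l(1) m(1) show ?thesis
    by (simp add: path_between_def)
qed

lemma transport_const: "e \<in> fibre x \<Longrightarrow> transport (\<lambda>t. x) e = e"
  using transport_eq[of "\<lambda>t. e" "\<lambda>t. x"] by (simp add: fibre_def)

text \<open>Lift the whole homotopy. Its sides over the two fixed ends lift constant paths, so these
  lifts are constant, and the lifts of \<open>f\<close> and \<open>g\<close> share their start and
  their end.\<close>

lemma transport_homotopic:
  assumes "path_homotopic X f g" "e \<in> fibre (f 0)"
  shows "transport f e = transport g e"
proof -
  let ?Q = "{0..1::real} \<times> {0..1::real}"
  obtain H where H: "continuous_map (top_of_set ?Q) X H" "f 1 = g 1"
    "\<And>t. t \<in> {0..1} \<Longrightarrow> H (0, t) = f t \<and> H (1, t) = g t \<and> H (t, 0) = f 0 \<and> H (t, 1) = f 1"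
    using assms(1) unfolding path_homotopic_iff by blast
  have e: "e \<in> fibre (H (0, 0))"
    using assms(2) H(3)[of 0] by simp
  obtain l where l: "continuous_map (top_of_set ?Q) E l" "l (0, 0) = e" "\<And>w. w \<in> ?Q \<Longrightarrow> p (l w) = H w"
    using square_lift[OF H(1) e] by blast
  have edge: "pathin E (\<lambda>t. l (k t))" if "continuous_on {0..1} k" "k ` {0..1} \<subseteq> ?Q" for k
    unfolding pathin_def
    by (rule continuous_map_compose[OF _ l(1), unfolded o_def])
       (use that in \<open>auto simp: continuous_map_in_subtopology\<close>)
  have edges: "pathin E (\<lambda>t. l (0, t))" "pathin E (\<lambda>t. l (1, t))" "pathin E (\<lambda>t. l (t, 0))" "pathin E (\<lambda>t. l (t, 1))"
    by (intro edge; auto intro!: continuous_intros)+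
  have top: "l w \<in> topspace E" if "w \<in> ?Q" for w
    using l(1) that by (auto simp: continuous_map_def)
  have "transport (\<lambda>t. f 0) (l (0, 0)) = l (1, 0)" "transport (\<lambda>t. f 1) (l (0, 1)) = l (1, 1)"
    "transport f (l (0, 0)) = l (0, 1)" "transport g (l (1, 0)) = l (1, 1)"
    using transport_eq[OF edges(3)] transport_eq[OF edges(4)] transport_eq[OF edges(1)] transport_eq[OF edges(2)]
      l(3) H(3) by auto
  moreover have "transport (\<lambda>t. f 0) (l (0, 0)) = l (0, 0)" "transport (\<lambda>t. f 1) (l (0, 1)) = l (0, 1)"
    using l(3) H(3)[of 0] H(3)[of 1] top by (auto intro!: transport_const simp: fibre_def)
  ultimately show ?thesis
    using l(2) by simp
qed

lemma transport_rev:
  assumes "path_between X x y g" "e \<in> fibre x"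
  shows "transport (path_rev g) (transport g e) = e"
proof -
  have "transport (path_rev g) (transport g e) = transport (path_join g (path_rev g)) e"
    using transport_join[OF assms(1) path_between_rev[OF assms(1)] assms(2)] by simp
  also have "\<dots> = transport (\<lambda>t. g 0) e"
    using assms path_join_rev_right[of X g] by (intro transport_homotopic) (auto simp: path_between_def)
  also have "\<dots> = e"
    using assms by (intro transport_const) (auto simp: path_between_def)
  finally show ?thesis .
qed

lemma transport_bij:
  assumes "path_between X x y g"
  shows "bij_betw (transport g) (fibre x) (fibre y)"
proof (rule bij_betw_byWitness[where f' = "transport (path_rev g)"])
  show "\<forall>e\<in>fibre x. transport (path_rev g) (transport g e) = e"
    using transport_rev[OF assms] by blast
  show "\<forall>e\<in>fibre y. transport g (transport (path_rev g) e) = e"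
    using transport_rev[OF path_between_rev[OF assms]] by simp
  show "transport g ` fibre x \<subseteq> fibre y"
    using transport_in_fibre[OF assms] by auto
  show "transport (path_rev g) ` fibre y \<subseteq> fibre x"
    using transport_in_fibre[OF path_between_rev[OF assms]] by auto
qed

lemma transport_in_sheet:
  assumes "sheet V U" "path_between X x y g" "g \<in> {0..1} \<rightarrow> U" "e \<in> V" "e \<in> fibre x"
  shows "transport g e \<in> V"
proof -
  have inU: "g t \<in> U" if "t \<in> {0..1}" for t
    using that assms(3) by blast
  have "continuous_map (top_of_set {0..1}) (subtopology X U) g"
    using assms(2,3) by (auto simp: continuous_map_in_subtopology path_between_def pathin_def)
  then have "pathin E (inv_into V p \<circ> g)"
    unfolding pathin_def using sheet_inverse[OF assms(1)] by (rule continuous_map_compose)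
  moreover have "p ((inv_into V p \<circ> g) t) = g t" if "t \<in> {0..1}" for t
    using inU[OF that] sheet_bij[OF assms(1)] by (simp add: bij_betw_inv_into_right)
  ultimately have "transport g ((inv_into V p \<circ> g) 0) = (inv_into V p \<circ> g) 1"
    by (rule transport_eq)
  moreover have "(inv_into V p \<circ> g) 0 = e"
    using assms sheet_bij[OF assms(1)] by (auto simp: path_between_def fibre_def bij_betw_def)
  moreover have "(inv_into V p \<circ> g) 1 \<in> V"
    using inU[of 1] sheet_bij[OF assms(1)] by (auto simp: bij_betw_def intro: inv_into_into)
  ultimately show ?thesis by simp
qed

end

section \<open>Partitions of unity on paracompact Hausdorff spaces\<close>

text \<open>A property inherited by subsets survives the passage to a locally finite refinement, so
  it need only be known near each point.\<close>

lemma paracompact_refine: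
  assumes "paracompact_space X" "\<And>x. x \<in> topspace X \<Longrightarrow> \<exists>V. openin X V \<and> x \<in> V \<and> P V"
    and mono: "\<And>V W. P V \<Longrightarrow> W \<subseteq> V \<Longrightarrow> P W"
  obtains \<V> where "\<forall>V\<in>\<V>. openin X V \<and> P V" "\<Union>\<V> = topspace X" "locally_finite_in X \<V>"
proof -
  let ?U = "{V. openin X V \<and> P V}"
  have "\<Union>?U = topspace X"
  proof
    show "\<Union>?U \<subseteq> topspace X"
      using openin_subset by (metis (no_types, lifting) Sup_least mem_Collect_eq)
    show "topspace X \<subseteq> \<Union>?U"
    proof
      fix x assume "x \<in> topspace X"
      from assms(2)[OF this] show "x \<in> \<Union>?U"
        by auto
    qed
  qed
  then have "(\<forall>U\<in>?U. openin X U) \<and> \<Union>?U = topspace X"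
    by simp
  with assms(1)[unfolded paracompact_space_def, THEN spec[of _ ?U]]
  have "\<exists>\<V>. (\<forall>V\<in>\<V>. openin X V) \<and> \<Union>\<V> = topspace X \<and> (\<forall>V\<in>\<V>. \<exists>U\<in>?U. V \<subseteq> U) \<and> locally_finite_in X \<V>"
    by (rule mp)
  then obtain \<V> where \<V>: "\<forall>V\<in>\<V>. openin X V" "\<Union>\<V> = topspace X" "\<forall>V\<in>\<V>. \<exists>U\<in>?U. V \<subseteq> U"
    "locally_finite_in X \<V>"
    by (elim exE conjE)
  have "\<forall>V\<in>\<V>. openin X V \<and> P V"
  proof
    fix V assume "V \<in> \<V>"
    with \<V>(1,3) obtain U where "openin X V" "P U" "V \<subseteq> U"
      by auto
    then show "openin X V \<and> P V"
      using mono[of U V] by simp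
  qed
  with \<V>(2,4) show ?thesis
    by (intro that[of \<V>])
qed

text \<open>Serves twice: with \<open>D\<close> a point it leads from Hausdorff to regular, with
  \<open>D\<close> closed from regular to normal. By local finiteness the closure of the union of
  the sets that meet \<open>C\<close> is the union of their closures, and each of those misses
  \<open>D\<close>.\<close>

lemma paracompact_separation:
  assumes "paracompact_space X" "closedin X C"
    and sep: "\<And>c. c \<in> C \<Longrightarrow> \<exists>V. openin X V \<and> c \<in> V \<and> disjnt (X closure_of V) D" and D: "D \<subseteq> topspace X"
  obtains U W where "openin X U" "openin X W" "C \<subseteq> U" "D \<subseteq> W" "disjnt U W"
proof -
  let ?P = "\<lambda>V. V \<inter> C = {} \<or> disjnt (X closure_of V) D"
  have *: "\<exists>V. openin X V \<and> x \<in> V \<and> ?P V" if "x \<in> topspace X" for x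
  proof (cases "x \<in> C")
    case True
    from sep[OF this] show ?thesis
      by auto
  next
    case False
    then show ?thesis
      using assms(2) that by (intro exI[of _ "topspace X - C"]) auto
  qed
  have mono: "?P W" if "?P V" "W \<subseteq> V" for V W
    using that closure_of_mono[OF that(2), of X] by (auto simp: disjnt_iff)
  obtain \<V> where \<V>: "\<forall>V\<in>\<V>. openin X V \<and> ?P V" "\<Union>\<V> = topspace X" "locally_finite_in X \<V>"
    by (rule paracompact_refine[where P = ?P, OF assms(1) * mono])
  define \<W> where "\<W> = {V \<in> \<V>. V \<inter> C \<noteq> {}}"
  have lf: "locally_finite_in X \<W>"
    using \<V>(3) by (rule locally_finite_in_subset) (auto simp: \<W>_def)
  have disj: "disjnt (X closure_of V) D" if V: "V \<in> \<W>" for V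
    using V \<V>(1) by (auto simp: \<W>_def)
  show ?thesis
  proof (rule that)
    show "openin X (\<Union>\<W>)"
      using \<V>(1) by (intro openin_Union) (auto simp: \<W>_def)
    show "openin X (topspace X - X closure_of \<Union>\<W>)"
      by (intro openin_diff openin_topspace closedin_closure_of)
    show "C \<subseteq> \<Union>\<W>"
    proof
      fix x assume x: "x \<in> C"
      then have "x \<in> \<Union>\<V>"
        using \<V>(2) closedin_subset[OF assms(2)] by blast
      with x show "x \<in> \<Union>\<W>"
        by (auto simp: \<W>_def)
    qed
    show "D \<subseteq> topspace X - X closure_of \<Union>\<W>"
      using D disj unfolding closure_of_locally_finite_Union[OF lf] by (auto simp: disjnt_iff)
    have "\<Union>\<W> \<subseteq> X closure_of \<Union>\<W>"
      using \<V>(1) by (intro closure_of_subset) (auto simp: \<W>_def dest: openin_subset)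
    then show "disjnt (\<Union>\<W>) (topspace X - X closure_of \<Union>\<W>)"
      by (auto simp: disjnt_iff)
  qed
qed

lemma disjoint_open_closure:
  assumes "openin X U" "openin X W" "disjnt U W"
  shows "disjnt (X closure_of W) U"
proof -
  have "X closure_of W \<subseteq> topspace X - U"
    using assms openin_subset[OF assms(2)] by (intro closure_of_minimal) (auto simp: disjnt_iff)
  then show ?thesis
    by (auto simp: disjnt_iff)
qed

lemma paracompact_Hausdorff_regular:
  assumes "paracompact_space X" "Hausdorff_space X" "closedin X C" "x \<in> topspace X - C"
  obtains V where "openin X V" "x \<in> V" "disjnt (X closure_of V) C"
proof -
  have "\<exists>V. openin X V \<and> c \<in> V \<and> disjnt (X closure_of V) {x}" if c: "c \<in> C" for c
  proof -
    have "c \<in> topspace X" "c \<noteq> x"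
      using c assms(3,4) closedin_subset by auto
    then obtain U V where "openin X U" "openin X V" "x \<in> U" "c \<in> V" "disjnt U V"
      using assms(2,4) unfolding Hausdorff_space_def by (metis DiffD1)
    then show ?thesis
      using disjoint_open_closure[of X U V] by (auto simp: disjnt_iff)
  qed
  then obtain U W where UW: "openin X U" "openin X W" "C \<subseteq> U" "{x} \<subseteq> W" "disjnt U W"
    using paracompact_separation[of X C "{x}"] assms by auto
  show ?thesis
    by (rule that[OF UW(2)]) (use UW disjoint_open_closure[OF UW(1,2,5)] in \<open>auto simp: disjnt_iff\<close>)
qed

lemma paracompact_Hausdorff_normal:
  assumes "paracompact_space X" "Hausdorff_space X"
  shows "normal_space X"
  unfolding normal_space_def
proof (intro allI impI)
  fix C D assume CD: "closedin X C \<and> closedin X D \<and> disjnt C D"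
  have "\<exists>V. openin X V \<and> c \<in> V \<and> disjnt (X closure_of V) D" if c: "c \<in> C" for c
  proof -
    have "c \<in> topspace X - D"
      using c CD closedin_subset by (auto simp: disjnt_iff)
    then show ?thesis
      using paracompact_Hausdorff_regular[OF assms, of D c] CD by metis
  qed
  then obtain U W where "openin X U" "openin X W" "C \<subseteq> U" "D \<subseteq> W" "disjnt U W"
    using paracompact_separation[of X C D] assms(1) CD closedin_subset by metis
  then show "\<exists>U V. openin X U \<and> openin X V \<and> C \<subseteq> U \<and> D \<subseteq> V \<and> disjnt U V"
    by blast
qed

text \<open>Regularity yields a locally finite cover whose closures fit inside members of
  \<open>\<U>\<close>. For each \<open>U\<close> the union of the closures that fit into it is
  closed by local finiteness; these unions still cover, so making \<open>f U\<close> equal to 1 on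
  them gives the last property.\<close>

lemma urysohn_family:
  assumes "paracompact_space X" "Hausdorff_space X" "\<And>U. U \<in> \<U> \<Longrightarrow> openin X U" "\<Union>\<U> = topspace X"
  obtains f :: "'a set \<Rightarrow> 'a \<Rightarrow> real" where
    "\<And>U. U \<in> \<U> \<Longrightarrow> continuous_map X euclideanreal (f U)"
    "\<And>U x. U \<in> \<U> \<Longrightarrow> x \<in> topspace X - U \<Longrightarrow> f U x = 0"
    "\<And>x. x \<in> topspace X \<Longrightarrow> \<exists>U\<in>\<U>. f U x = 1"
proof -
  have shrink: "\<exists>V. openin X V \<and> x \<in> V \<and> (\<exists>U\<in>\<U>. X closure_of V \<subseteq> U)" if x: "x \<in> topspace X" for x
  proof -
    obtain U where U: "U \<in> \<U>" "x \<in> U"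
      using x assms(4) by auto
    then have "closedin X (topspace X - U)" "x \<in> topspace X - (topspace X - U)"
      using x assms(3) by auto
    then obtain V where "openin X V" "x \<in> V" "disjnt (X closure_of V) (topspace X - U)"
      using paracompact_Hausdorff_regular[OF assms(1,2)] by blast
    then show ?thesis
      using U(1) closure_of_subset_topspace[of X V] by (auto simp: disjnt_iff intro!: exI[of _ V])
  qed
  have mono: "\<exists>U\<in>\<U>. X closure_of W \<subseteq> U" if "\<exists>U\<in>\<U>. X closure_of V \<subseteq> U" "W \<subseteq> V" for V W
    using that closure_of_mono[OF that(2), of X] by (meson subset_trans)
  obtain \<V> where \<V>: "\<forall>V\<in>\<V>. openin X V \<and> (\<exists>U\<in>\<U>. X closure_of V \<subseteq> U)" "\<Union>\<V> = topspace X" "locally_finite_in X \<V>"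
    by (rule paracompact_refine[where P = "\<lambda>V. \<exists>U\<in>\<U>. X closure_of V \<subseteq> U", OF assms(1) shrink mono])
  define C where "C U = \<Union>((closure_of) X ` {V \<in> \<V>. X closure_of V \<subseteq> U})" for U
  have "\<exists>f. continuous_map X euclideanreal f \<and> (\<forall>x \<in> topspace X - U. f x = 0) \<and> (\<forall>x \<in> C U. f x = 1)" if U: "U \<in> \<U>" for U
  proof -
    have "closedin X (C U)"
      unfolding C_def by (intro closedin_Union_locally_finite_closure locally_finite_in_subset[OF \<V>(3)]) auto
    moreover have "closedin X (topspace X - U)"
      using U assms(3) by blast
    moreover have "disjnt (topspace X - U) (C U)"
      by (auto simp: disjnt_iff C_def)
    ultimately obtain f where "continuous_map X (top_of_set {0..1::real}) f" "f ` (topspace X - U) \<subseteq> {0}" "f ` C U \<subseteq> {1}"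
      using Urysohn_lemma[OF paracompact_Hausdorff_normal[OF assms(1,2)], of "topspace X - U" "C U" 0 1] by auto
    then show ?thesis
      by (intro exI[of _ f]) (auto simp: continuous_map_in_subtopology)
  qed
  then obtain f where f: "\<And>U. U \<in> \<U> \<Longrightarrow> continuous_map X euclideanreal (f U) \<and> (\<forall>x \<in> topspace X - U. f U x = 0) \<and> (\<forall>x \<in> C U. f U x = 1)"
    by metis
  show ?thesis
  proof (rule that[of f])
    fix x assume "x \<in> topspace X"
    then obtain V where V: "V \<in> \<V>" "x \<in> V"
      using \<V>(2) by auto
    then obtain U where U: "U \<in> \<U>" "X closure_of V \<subseteq> U"
      using \<V>(1) by blast
    have "openin X V"
      using V(1) \<V>(1) by simp
    then have "x \<in> X closure_of V"
      using closure_of_subset[OF openin_subset] V(2) by auto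
    with V(1) U(2) have "x \<in> C U"
      unfolding C_def by blast
    with f[OF U(1)] U(1) show "\<exists>U\<in>\<U>. f U x = 1"
      by auto
  qed (use f in auto)
qed

text \<open>Truncating the Urysohn functions at \<open>1/2\<close> keeps their closed supports inside the cover, so that
  near \<open>x\<close> only members of the cover that contain \<open>x\<close> contribute.\<close>

lemma paracompact_partition_of_unity:
  assumes "paracompact_space X" "Hausdorff_space X" "\<And>x. x \<in> topspace X \<Longrightarrow> \<exists>V. openin X V \<and> x \<in> V \<and> P V"
    and mono: "\<And>V W. P V \<Longrightarrow> W \<subseteq> V \<Longrightarrow> P W"
  obtains \<U> and \<phi> :: "'a set \<Rightarrow> 'a \<Rightarrow> real" where
    "\<And>U. U \<in> \<U> \<Longrightarrow> openin X U \<and> P U" "\<And>U x. \<phi> U x \<ge> 0"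
    "\<And>x. x \<in> topspace X \<Longrightarrow> finite {U \<in> \<U>. x \<in> U} \<and>
      (\<exists>N. openin X N \<and> x \<in> N \<and> (\<forall>U\<in>\<U>. x \<in> U \<longrightarrow> N \<subseteq> U \<and> continuous_map (subtopology X N) euclideanreal (\<phi> U)) \<and>
        (\<forall>y\<in>N. (\<forall>U\<in>\<U>. x \<notin> U \<longrightarrow> \<phi> U y = 0) \<and> sum (\<lambda>U. \<phi> U y) {U \<in> \<U>. x \<in> U} = 1))"
proof -
  obtain \<U> where \<U>: "\<forall>U\<in>\<U>. openin X U \<and> P U" "\<Union>\<U> = topspace X" "locally_finite_in X \<U>"
    by (rule paracompact_refine[where P = P, OF assms(1,3) mono])
  then have \<U>_open: "\<And>U. U \<in> \<U> \<Longrightarrow> openin X U"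
    by simp
  obtain f :: "'a set \<Rightarrow> 'a \<Rightarrow> real" where f: "\<And>U. U \<in> \<U> \<Longrightarrow> continuous_map X euclideanreal (f U)"
    "\<And>U x. U \<in> \<U> \<Longrightarrow> x \<in> topspace X - U \<Longrightarrow> f U x = 0" "\<And>x. x \<in> topspace X \<Longrightarrow> \<exists>U\<in>\<U>. f U x = 1"
    using urysohn_family[OF assms(1,2) \<U>_open \<U>(2)] by blast
  define g where "g U x = max 0 (f U x - 1/2)" for U x
  define s where "s x = sum (\<lambda>U. g U x) {U \<in> \<U>. x \<in> U}" for x
  have g0: "g U x \<ge> 0" for U x
    by (simp add: g_def)
  have s0: "s x \<ge> 0" for x
    unfolding s_def by (intro sum_nonneg g0)
  show ?thesis
  proof (rule that[of \<U> "\<lambda>U x. g U x / s x"])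
    fix x assume x: "x \<in> topspace X"
    obtain M where M: "openin X M" "x \<in> M" "finite {U \<in> \<U>. U \<inter> M \<noteq> {}}"
      using \<U>(3) x unfolding locally_finite_in_def by meson
    let ?F = "{U \<in> \<U>. x \<in> U}"
    have fin: "finite ?F"
      by (rule finite_subset[OF _ M(3)]) (use M(2) in auto)
    \<comment> \<open>Only the finitely many members meeting \<open>M\<close> restrict the
      neighbourhood. Where \<open>f U\<close> is below 1/2 the truncated function \<open>g U\<close>
      vanishes, so members missing \<open>x\<close> contribute nothing.\<close>
    define T where "T U = (if x \<in> U then U else {y \<in> topspace X. f U y < 1/2})" for U
    define N where "N = M \<inter> (\<Inter>U\<in>{U \<in> \<U>. U \<inter> M \<noteq> {}}. T U)"
    have T: "openin X (T U)" "x \<in> T U" if U: "U \<in> \<U>" for U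
    proof -
      have "openin X {y \<in> topspace X. f U y \<in> {..<1/2}}"
        using f(1)[OF U] by (intro openin_continuous_map_preimage[where Y = euclideanreal]) auto
      then show "openin X (T U)"
        using \<U>_open[OF U] by (simp add: T_def)
      show "x \<in> T U"
        using f(2)[OF U] x by (auto simp: T_def)
    qed
    have N: "openin X N"
      unfolding N_def by (rule openin_Int_Inter) (use M T(1) in auto)
    have xN: "x \<in> N"
      unfolding N_def using M(2) T(2) by auto
    have Nsub: "N \<subseteq> U" if "U \<in> \<U>" "x \<in> U" for U
      using that M(2) by (auto simp: N_def T_def)
    have gN: "g U y = 0" if "U \<in> \<U>" "x \<notin> U" "y \<in> N" for U y
    proof (cases "y \<in> U")
      case True
      with that have "U \<inter> M \<noteq> {}"
        by (auto simp: N_def)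
      with that have "y \<in> T U"
        by (auto simp: N_def)
      with that show ?thesis
        by (auto simp: T_def g_def)
    next
      case False
      have "y \<in> topspace X"
        using that(3) N openin_subset by blast
      with False that f(2) show ?thesis
        by (auto simp: g_def)
    qed
    have sN: "s y = sum (\<lambda>U. g U y) ?F" if y: "y \<in> N" for y
    proof -
      have "finite {U \<in> \<U>. y \<in> U}"
        by (rule finite_subset[OF _ M(3)]) (use y in \<open>auto simp: N_def\<close>)
      then show ?thesis
        unfolding s_def using gN y Nsub by (intro sum.mono_neutral_right) auto
    qed
    have spos: "s y > 0" if y: "y \<in> N" for y
    proof -
      have yX: "y \<in> topspace X"
        using y N openin_subset by blast
      then obtain U where U: "U \<in> \<U>" "f U y = 1"
        using f(3) by blast
      then have gU: "g U y > 0"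
        by (simp add: g_def)
      then have "x \<in> U"
        using gN[OF U(1) _ y] by fastforce
      then have "g U y \<le> s y"
        unfolding sN[OF y] using fin U(1) g0 by (intro member_le_sum) auto
      with gU show ?thesis by simp
    qed
    have contg: "continuous_map X euclideanreal (g U)" if "U \<in> \<U>" for U
      unfolding g_def using f(1)[OF that] by (intro continuous_intros)
    have conts: "continuous_map (subtopology X N) euclideanreal s"
    proof (rule continuous_map_eq)
      show "continuous_map (subtopology X N) euclideanreal (\<lambda>y. sum (\<lambda>U. g U y) ?F)"
        using fin contg by (intro continuous_map_sum continuous_map_from_subtopology) auto
    qed (use sN in auto)
    have "continuous_map (subtopology X N) euclideanreal (\<lambda>y. g U y / s y)" if U: "U \<in> \<U>" for U
    proof (rule continuous_map_real_divide[OF continuous_map_from_subtopology[OF contg[OF U]] conts])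
      fix y assume "y \<in> topspace (subtopology X N)"
      with spos[of y] show "s y \<noteq> 0"
        by simp
    qed
    moreover have "sum (\<lambda>U. g U y / s y) ?F = 1" if "y \<in> N" for y
      using sN[OF that] spos[OF that] by (simp flip: sum_divide_distrib)
    ultimately show "finite ?F \<and>
      (\<exists>N. openin X N \<and> x \<in> N \<and> (\<forall>U\<in>\<U>. x \<in> U \<longrightarrow> N \<subseteq> U \<and> continuous_map (subtopology X N) euclideanreal (\<lambda>x. g U x / s x)) \<and>
        (\<forall>y\<in>N. (\<forall>U\<in>\<U>. x \<notin> U \<longrightarrow> g U y / s y = 0) \<and> sum (\<lambda>U. g U y / s y) ?F = 1))"
      using fin N xN Nsub gN by (intro conjI exI[of _ N]) auto
  qed (use \<U> g0 s0 in auto)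
qed

section \<open>Canonical products of genus one\<close>

lemma continuous_map_locally:
  assumes "\<And>x. x \<in> topspace X \<Longrightarrow> \<exists>U. openin X U \<and> x \<in> U \<and> continuous_map (subtopology X U) Y f"
  shows "continuous_map X Y f"
  unfolding continuous_map_def
proof (intro conjI allI impI)
  show "f \<in> topspace X \<rightarrow> topspace Y"
    using assms by (fastforce simp: continuous_map_def)
  fix V assume V: "openin Y V"
  show "openin X {x \<in> topspace X. f x \<in> V}"
  proof (subst openin_subopen, intro ballI)
    fix x assume x: "x \<in> {x \<in> topspace X. f x \<in> V}"
    then obtain U where U: "openin X U" "x \<in> U" "continuous_map (subtopology X U) Y f"
      using assms by blast
    then have "openin (subtopology X U) {x \<in> topspace (subtopology X U). f x \<in> V}"
      using V unfolding continuous_map_def by blast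
    then have "openin X {x \<in> topspace (subtopology X U). f x \<in> V}"
      using U(1) openin_trans_full by blast
    with x U(2) show "\<exists>W. openin X W \<and> x \<in> W \<and> W \<subseteq> {x \<in> topspace X. f x \<in> V}"
      by (intro exI[of _ "{x \<in> topspace (subtopology X U). f x \<in> V}"]) auto
  qed
qed

lemma continuous_map_binop:
  fixes h :: "'b::topological_space \<times> 'c::topological_space \<Rightarrow> 'd::topological_space"
  assumes "continuous_on S h" "continuous_map X euclidean f" "continuous_map X euclidean g"
    and "\<And>x. x \<in> topspace X \<Longrightarrow> (f x, g x) \<in> S"
  shows "continuous_map X euclidean (\<lambda>x. h (f x, g x))"
proof -
  have "continuous_map X (prod_topology euclidean euclidean) (\<lambda>x. (f x, g x))"
    using assms(2,3) by (rule continuous_map_pairedI)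
  then have "continuous_map X (top_of_set S) (\<lambda>x. (f x, g x))"
    using assms(4) by (auto simp: continuous_map_in_subtopology)
  moreover have "continuous_map (top_of_set S) euclidean h"
    using assms(1) by simp
  ultimately have "continuous_map X euclidean (h \<circ> (\<lambda>x. (f x, g x)))"
    by (rule continuous_map_compose)
  then show ?thesis
    by (simp add: o_def)
qed

section \<open>Absolutely convergent products and their rearrangement\<close>

lemma norm_prod_minus_one_le:
  fixes f :: "nat \<Rightarrow> complex"
  assumes "\<And>k. k \<in> A \<Longrightarrow> norm (f k - 1) \<le> c k"
  shows "norm (prod f A - 1) \<le> exp (sum c A) - 1"
proof -
  have "norm (prod f A - 1) = norm (prod (\<lambda>n. 1 + (f n - 1)) A - 1)"
    by simp
  also have "\<dots> \<le> prod (\<lambda>n. 1 + norm (f n - 1)) A - 1"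
    by (rule norm_prod_minus1_le_prod_minus1)
  also have "prod (\<lambda>n. 1 + norm (f n - 1)) A \<le> exp (\<Sum>n\<in>A. norm (f n - 1))"
    by (rule prod_le_exp_sum) auto
  also have "(\<Sum>n\<in>A. norm (f n - 1)) \<le> sum c A"
    by (intro sum_mono assms)
  finally show ?thesis by simp
qed

text \<open>Stated for any finite \<open>B\<close> above an initial segment, so that one bound
  covers both longer partial products and rearranged ones.\<close>

lemma prod_diff_le:
  fixes f :: "nat \<Rightarrow> complex"
  assumes bound: "\<And>k. norm (f k - 1) \<le> c k" and c: "summable c" and B: "finite B" "{..<n} \<subseteq> B"
  shows "norm (prod f B - prod f {..<n}) \<le> exp (suminf c) * (exp (suminf (\<lambda>k. c (k + n))) - 1)"
proof -
  have c0: "c k \<ge> 0" for k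
    using bound[of k] norm_ge_zero order_trans by blast
  have "prod f B = prod f {..<n} * prod f (B - {..<n})"
    using B by (simp add: prod.subset_diff mult.commute)
  then have "norm (prod f B - prod f {..<n}) = norm (prod f {..<n}) * norm (prod f (B - {..<n}) - 1)"
    by (metis mult.right_neutral norm_mult right_diff_distrib)
  also have "\<dots> \<le> exp (suminf c) * (exp (suminf (\<lambda>k. c (k + n))) - 1)"
  proof (rule mult_mono)
    have "norm (prod f {..<n}) \<le> norm (prod f {..<n} - 1) + 1"
      using norm_triangle_ineq[of "prod f {..<n} - 1" 1] by simp
    also have "\<dots> \<le> exp (sum c {..<n})"
      using norm_prod_minus_one_le[of "{..<n}" f c] bound by simp
    also have "\<dots> \<le> exp (suminf c)"
      using c c0 by (simp add: sum_le_suminf)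
    finally show "norm (prod f {..<n}) \<le> exp (suminf c)" .
    have "sum c (B - {..<n}) = sum (\<lambda>k. c (k + n)) ((\<lambda>k. k - n) ` (B - {..<n}))"
      by (subst sum.reindex) (auto simp: inj_on_def intro!: sum.cong)
    also have "\<dots> \<le> suminf (\<lambda>k. c (k + n))"
      using c c0 B by (intro sum_le_suminf) (auto simp: summable_iff_shift)
    finally have "exp (sum c (B - {..<n})) \<le> exp (suminf (\<lambda>k. c (k + n)))"
      by simp
    moreover have "norm (prod f (B - {..<n}) - 1) \<le> exp (sum c (B - {..<n})) - 1"
      by (rule norm_prod_minus_one_le) (rule bound)
    ultimately show "norm (prod f (B - {..<n}) - 1) \<le> exp (suminf (\<lambda>k. c (k + n))) - 1"
      by linarith
  qed auto
  finally show ?thesis .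
qed

lemma tail_bound_tendsto_0:
  fixes c :: "nat \<Rightarrow> real"
  assumes "summable c"
  shows "(\<lambda>n. C * (exp (suminf (\<lambda>k. c (k + n))) - 1)) \<longlonglongrightarrow> 0"
proof -
  have "(\<lambda>n. C * (exp (suminf (\<lambda>k. c (k + n))) - 1)) \<longlonglongrightarrow> C * (exp 0 - 1)"
    by (intro tendsto_intros suminf_exist_split2 assms)
  then show ?thesis by simp
qed

lemma abs_convergent_prodI:
  fixes f :: "nat \<Rightarrow> complex"
  assumes "\<And>k. norm (f k - 1) \<le> c k" "summable c"
  shows "(\<lambda>n. prod f {..<n}) \<longlonglongrightarrow> prodinf f" "convergent_prod f"
proof -
  have "abs_convergent_prod f"
    unfolding abs_convergent_prod_conv_summable
    using assms by (intro summable_comparison_test[OF _ assms(2)]) auto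
  then show conv: "convergent_prod f"
    by (rule abs_convergent_prod_imp_convergent_prod)
  then show "(\<lambda>n. prod f {..<n}) \<longlonglongrightarrow> prodinf f"
    using convergent_prod_LIMSEQ LIMSEQ_lessThan_iff_atMost[of "\<lambda>A. prod f A"] by blast
qed

text \<open>As soon as the first \<open>m\<close> rearranged indices include all those below
  \<open>n\<close>, the rearranged partial product is within the tail bound of
  \<open>prod f {..<n}\<close>. First \<open>m\<close> and then \<open>n\<close> tends to
  infinity.\<close>

lemma prodinf_reorder:
  fixes f :: "nat \<Rightarrow> complex"
  assumes bound: "\<And>k. norm (f k - 1) \<le> c k" and c: "summable c" and \<sigma>: "bij \<sigma>"
  shows "prodinf (\<lambda>k. f (\<sigma> k)) = prodinf f"
proof -
  let ?b = "\<lambda>n. exp (suminf c) * (exp (suminf (\<lambda>k. c (k + n))) - 1)"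
  have c0: "c k \<ge> 0" for k
    using bound[of k] norm_ge_zero order_trans by blast
  have "summable (\<lambda>k. c (\<sigma> k))"
    using c c0 \<sigma> summable_reindex[of c \<sigma>] by (auto simp: bij_def o_def)
  then have lim: "(\<lambda>m. \<Prod>k<m. f (\<sigma> k)) \<longlonglongrightarrow> prodinf (\<lambda>k. f (\<sigma> k))"
    using abs_convergent_prodI(1)[of "\<lambda>k. f (\<sigma> k)" "\<lambda>k. c (\<sigma> k)"] bound by blast
  have "norm (prodinf (\<lambda>k. f (\<sigma> k)) - prod f {..<n}) \<le> ?b n" for n
  proof (rule Lim_norm_ubound[OF sequentially_bot tendsto_diff[OF lim tendsto_const]])
    obtain M where M: "inv_into UNIV \<sigma> ` {..<n} \<subseteq> {..<M}"
      by (meson finite_imageI finite_lessThan finite_nat_iff_bounded)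
    have "norm ((\<Prod>k<m. f (\<sigma> k)) - prod f {..<n}) \<le> ?b n" if "m \<ge> M" for m
    proof -
      have "(\<Prod>k<m. f (\<sigma> k)) = prod f (\<sigma> ` {..<m})"
        using \<sigma> by (subst prod.reindex) (auto simp: bij_def inj_on_def)
      moreover have "{..<n} \<subseteq> \<sigma> ` {..<m}"
      proof
        fix k assume "k \<in> {..<n}"
        with M that have "inv_into UNIV \<sigma> k \<in> {..<m}"
          by fastforce
        moreover have "k = \<sigma> (inv_into UNIV \<sigma> k)"
          using \<sigma> by (simp add: bij_is_surj surj_f_inv_f)
        ultimately show "k \<in> \<sigma> ` {..<m}" by blast
      qed
      ultimately show ?thesis
        using prod_diff_le[OF bound c, of "\<sigma> ` {..<m}" n] by simp
    qed
    then show "\<forall>\<^sub>F m in sequentially. norm ((\<Prod>k<m. f (\<sigma> k)) - prod f {..<n}) \<le> ?b n"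
      by (auto simp: eventually_sequentially)
  qed
  then have "(\<lambda>n. prodinf (\<lambda>k. f (\<sigma> k)) - prod f {..<n}) \<longlonglongrightarrow> 0"
    by (intro Lim_null_comparison[OF _ tail_bound_tendsto_0[OF c, where C = "exp (suminf c)"]]) auto
  moreover have "(\<lambda>n. prodinf (\<lambda>k. f (\<sigma> k)) - prod f {..<n}) \<longlonglongrightarrow> prodinf (\<lambda>k. f (\<sigma> k)) - prodinf f"
    by (intro tendsto_intros abs_convergent_prodI(1)[OF bound c])
  ultimately show ?thesis
    using LIMSEQ_unique by fastforce
qed

text \<open>Genus one suffices for zeros with \<open>\<Sum> 1/|a k|\<^sup>2 < \<infinity>\<close>, and a fixed genus makes the product
  independent of the enumeration of the zeros.\<close>

definition canonical_product :: "(nat \<Rightarrow> complex) \<Rightarrow> complex \<Rightarrow> complex" where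
  "canonical_product a z = prodinf (\<lambda>k. weierstrass_factor 1 (z / a k))"

text \<open>Up to 1/2 this is the quadratic estimate that makes the series summable; beyond 1/2 a
  crude triangle bound for (1 - w) exp w, which concerns finitely many factors. Its argument is a
  bound for |w| instead of w itself, so it is uniform over discs.\<close>

definition factor_bound :: "real \<Rightarrow> real" where
  "factor_bound r = (if r \<le> 1/2 then 3 * r\<^sup>2 else 1 + (1 + r) * exp r)"

lemma factor_bound:
  assumes "norm w \<le> r"
  shows "norm (weierstrass_factor 1 w - 1) \<le> factor_bound r"
proof (cases "r \<le> 1/2")
  case True
  then have "norm (weierstrass_factor 1 w - 1) \<le> 3 * (norm w)\<^sup>2"
    using weierstrass_factor_bound[of w 1] assms by (simp add: power2_eq_square)
  also have "\<dots> \<le> 3 * r\<^sup>2"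
    using assms by (intro mult_left_mono power_mono) auto
  finally show ?thesis
    using True by (simp add: factor_bound_def)
next
  case False
  have "norm (weierstrass_factor 1 w - 1) \<le> norm (weierstrass_factor 1 w) + 1"
    using norm_triangle_ineq4[of "weierstrass_factor 1 w" 1] by simp
  also have "norm (weierstrass_factor 1 w) = norm (1 - w) * norm (exp w)"
    by (simp add: weierstrass_factor_def norm_mult)
  also have "\<dots> \<le> (1 + r) * exp r"
  proof (rule mult_mono)
    show "norm (1 - w) \<le> 1 + r"
      using norm_triangle_ineq4[of 1 w] assms by simp
    show "norm (exp w) \<le> exp r"
      using norm_exp[of w] assms by (meson exp_le_cancel_iff order_trans)
  qed (use False in auto)
  finally show ?thesis
    using False by (simp add: factor_bound_def)
qed

lemma summable_factor_bound:
  assumes "summable (\<lambda>k. 1 / (m k)\<^sup>2)" "\<And>k. m k > 0" "R \<ge> 0"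
  shows "summable (\<lambda>k. factor_bound (R / m k))"
proof -
  have lim: "(\<lambda>k. (R / m k)\<^sup>2) \<longlonglongrightarrow> 0"
    using tendsto_mult[OF tendsto_const[of "R\<^sup>2"] summable_LIMSEQ_zero[OF assms(1)]] by (simp add: power_divide)
  have ev: "eventually (\<lambda>k. factor_bound (R / m k) = 3 * (R / m k)\<^sup>2) sequentially"
    using order_tendstoD(2)[OF lim, of "(1/2)\<^sup>2"]
  proof (rule eventually_mono)
    fix k assume "(R / m k)\<^sup>2 < (1/2)\<^sup>2"
    then have "R / m k < 1/2"
      using power_less_imp_less_base by fastforce
    then show "factor_bound (R / m k) = 3 * (R / m k)\<^sup>2"
      by (simp add: factor_bound_def)
  qed simp
  have "summable (\<lambda>k. 3 * (R / m k)\<^sup>2)"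
    using summable_mult[OF assms(1), of "3 * R\<^sup>2"] by (simp add: power_divide)
  then show ?thesis
    using summable_cong[OF ev] by simp
qed

context
  fixes a :: "nat \<Rightarrow> complex" and m :: "nat \<Rightarrow> real"
  assumes m: "\<And>k. m k > 0" "\<And>k. norm (a k) \<ge> m k" "summable (\<lambda>k. 1 / (m k)\<^sup>2)"
begin

lemma canonical_factor_bound:
  assumes "norm z \<le> R"
  shows "norm (weierstrass_factor 1 (z / a k) - 1) \<le> factor_bound (R / m k)"
proof (rule factor_bound)
  show "norm (z / a k) \<le> R / m k"
    using m(1,2)[of k] assms order_trans[OF norm_ge_zero assms] by (simp add: norm_divide frac_le)
qed

lemma canonical_product_reorder:
  assumes "bij \<sigma>"
  shows "canonical_product (\<lambda>k. a (\<sigma> k)) = canonical_product a"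
  unfolding canonical_product_def
  by (rule ext, rule prodinf_reorder[OF canonical_factor_bound[OF order_refl] _ assms])
     (use summable_factor_bound m(1,3) in auto)

lemma weierstrass_product_canonical: "weierstrass_product a (\<lambda>_. 1)"
proof
  show nz: "a k \<noteq> 0" for k
    using m(1,2)[of k] by auto
  have sm: "summable (\<lambda>k. 1 / (norm (a k))\<^sup>2)"
  proof (rule summable_comparison_test[OF _ m(3)], intro exI allI impI)
    fix k
    show "norm (1 / (norm (a k))\<^sup>2) \<le> 1 / (m k)\<^sup>2"
      using m(1,2)[of k] by (auto intro!: frac_le power_mono)
  qed
  have "filterlim (\<lambda>k. inverse (1 / (norm (a k))\<^sup>2)) at_top sequentially"
    using summable_LIMSEQ_zero[OF sm] nz
    by (intro filterlim_inverse_at_top) auto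
  then have "filterlim (\<lambda>k. sqrt ((norm (a k))\<^sup>2)) at_top sequentially"
    by (intro filterlim_compose[OF sqrt_at_top]) simp
  then show "filterlim a at_infinity sequentially"
    by (simp add: filterlim_at_infinity_conv_norm_at_top)
  show "summable (\<lambda>n. (r / norm (a n)) ^ Suc 1)" for r
    using summable_mult[OF sm, of "r\<^sup>2"] by (simp add: power_divide power2_eq_square)
qed

lemma canonical_product_holomorphic: "canonical_product a holomorphic_on A"
  and canonical_product_eq_0_iff: "canonical_product a z = 0 \<longleftrightarrow> z \<in> range a"
proof -
  interpret weierstrass_product a "\<lambda>_. 1"
    by (rule weierstrass_product_canonical)
  have "canonical_product a z = f z" for z
    by (simp only: canonical_product_def f_def)
  then have "canonical_product a = f" ..
  then show "canonical_product a holomorphic_on A" "canonical_product a z = 0 \<longleftrightarrow> z \<in> range a"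
    using holomorphic zero by auto
qed

end

text \<open>A Weierstrass M-test: the lower bounds \<open>m k\<close> do not depend on the
  parameter, so over a disc of \<open>z\<close> the partial products converge uniformly, with
  majorant \<open>factor_bound (R / m k)\<close>.\<close>

lemma continuous_map_canonical_product:
  fixes a :: "'y \<Rightarrow> nat \<Rightarrow> complex" and m :: "nat \<Rightarrow> real"
  assumes m: "\<And>k. m k > 0" "\<And>y k. y \<in> topspace T \<Longrightarrow> norm (a y k) \<ge> m k" "summable (\<lambda>k. 1 / (m k)\<^sup>2)"
    and cont: "\<And>k. continuous_map T euclidean (\<lambda>y. a y k)"
  shows "continuous_map (prod_topology T euclidean) euclidean (\<lambda>(y, z). canonical_product (a y) z)"
proof (rule continuous_map_locally)
  fix x assume x: "x \<in> topspace (prod_topology T (euclidean :: complex topology))"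
  define R where "R = norm (snd x) + 1"
  have R: "R \<ge> 0"
    by (simp add: R_def)
  let ?U = "topspace T \<times> ball (0::complex) R"
  let ?T = "subtopology (prod_topology T (euclidean :: complex topology)) ?U"
  let ?f = "\<lambda>k x. weierstrass_factor 1 (snd x / a (fst x) k)"
  let ?c = "\<lambda>k. factor_bound (R / m k)"
  have top: "fst w \<in> topspace T" "norm (snd w) \<le> R" if "w \<in> topspace ?T" for w
    using that by auto
  have c: "summable ?c"
    using summable_factor_bound m(1,3) R by blast
  have bound: "norm (?f k w - 1) \<le> ?c k" if "w \<in> topspace ?T" for k w
    using canonical_factor_bound[of m "a (fst w)" "snd w" R] m top[OF that] by blast
  have contf: "continuous_map ?T euclidean (?f k)" for k
  proof -
    have "continuous_map ?T euclidean (\<lambda>x. (\<lambda>(z, w). weierstrass_factor 1 (z / w)) (snd x, a (fst x) k))"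
    proof (rule continuous_map_binop[where S = "UNIV \<times> (- {0})"])
      show "continuous_on (UNIV \<times> (- {0})) (\<lambda>(z, w::complex). weierstrass_factor 1 (z / w))"
        unfolding case_prod_unfold by (intro continuous_intros) auto
      show "continuous_map ?T euclidean snd"
        by (intro continuous_map_from_subtopology continuous_map_snd)
      show "continuous_map ?T euclidean (\<lambda>x. a (fst x) k)"
        using continuous_map_compose[OF continuous_map_fst cont[of k]]
        by (intro continuous_map_from_subtopology) (simp add: o_def)
      show "(snd w, a (fst w) k) \<in> UNIV \<times> - {0}" if "w \<in> topspace ?T" for w
        using m(1)[of k] m(2)[OF top(1)[OF that], of k] by auto
    qed
    then show ?thesis by simp
  qed
  have contp: "continuous_map ?T euclidean (\<lambda>w. \<Prod>k<n. ?f k w)" for n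
  proof (induction n)
    case (Suc n)
    have "continuous_map ?T euclidean (\<lambda>w. (\<lambda>(u, v). u * v :: complex) (\<Prod>k<n. ?f k w, ?f n w))"
      by (rule continuous_map_binop[where S = UNIV, OF _ Suc contf])
         (auto simp: case_prod_unfold intro!: continuous_intros)
    then show ?case by simp
  qed simp
  have "continuous_map ?T Met_TC.mtopology (\<lambda>w. prodinf (\<lambda>k. ?f k w))"
  proof (rule Met_TC.continuous_map_uniform_limit[where F = sequentially and f = "\<lambda>n w. \<Prod>k<n. ?f k w"])
    fix \<epsilon> :: real assume \<epsilon>: "\<epsilon> > 0"
    have "eventually (\<lambda>n. exp (suminf ?c) * (exp (suminf (\<lambda>k. ?c (k + n))) - 1) < \<epsilon>) sequentially"
      by (rule order_tendstoD(2)[OF tail_bound_tendsto_0[OF c] \<epsilon>])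
    then show "\<forall>\<^sub>F n in sequentially. \<forall>w\<in>topspace ?T. prodinf (\<lambda>k. ?f k w) \<in> UNIV \<and> dist (\<Prod>k<n. ?f k w) (prodinf (\<lambda>k. ?f k w)) < \<epsilon>"
    proof (rule eventually_mono, intro ballI conjI)
      fix n w assume n: "exp (suminf ?c) * (exp (suminf (\<lambda>k. ?c (k + n))) - 1) < \<epsilon>" and w: "w \<in> topspace ?T"
      have "norm (prodinf (\<lambda>k. ?f k w) - (\<Prod>k<n. ?f k w)) \<le> exp (suminf ?c) * (exp (suminf (\<lambda>k. ?c (k + n))) - 1)"
      proof (rule Lim_norm_ubound[OF sequentially_bot
            tendsto_diff[OF abs_convergent_prodI(1)[OF bound[OF w] c] tendsto_const]])
        have "norm ((\<Prod>k<j. ?f k w) - (\<Prod>k<n. ?f k w)) \<le> exp (suminf ?c) * (exp (suminf (\<lambda>k. ?c (k + n))) - 1)" if "j \<ge> n" for j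
          by (rule prod_diff_le[OF bound[OF w] c]) (use that in auto)
        then show "\<forall>\<^sub>F j in sequentially. norm ((\<Prod>k<j. ?f k w) - (\<Prod>k<n. ?f k w)) \<le> exp (suminf ?c) * (exp (suminf (\<lambda>k. ?c (k + n))) - 1)"
          by (auto simp: eventually_sequentially)
      qed
      with n show "dist (\<Prod>k<n. ?f k w) (prodinf (\<lambda>k. ?f k w)) < \<epsilon>"
        by (simp add: dist_norm norm_minus_commute)
    qed simp
  qed (use contp in auto)
  then have "continuous_map ?T euclidean (\<lambda>(y, z). canonical_product (a y) z)"
    by (simp add: canonical_product_def case_prod_unfold)
  moreover have "openin (prod_topology T euclidean) ?U"
    by (simp add: openin_prod_Times_iff)
  moreover have "x \<in> ?U"
    using x by (auto simp: R_def)
  ultimately show "\<exists>U. openin (prod_topology T euclidean) U \<and> x \<in> U \<and>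
      continuous_map (subtopology (prod_topology T euclidean) U) euclidean (\<lambda>(y, z). canonical_product (a y) z)"
    by blast
qed

section \<open>From fibrewise embeddings to entire families\<close>

lemma covering_map_homeomorphic:
  assumes hom: "homeomorphic_map E E' h" and cov: "covering_map E X p"
    and eq: "\<And>e. e \<in> topspace E \<Longrightarrow> p' (h e) = p e"
  shows "covering_map E' X p'"
proof -
  obtain k where hk: "homeomorphic_maps E E' h k"
    using hom homeomorphic_map_maps by blast
  have hE: "h ` topspace E = topspace E'" "inj_on h (topspace E)"
    using hom homeomorphic_imp_surjective_map homeomorphic_imp_injective_map by blast+
  have k: "k e' \<in> topspace E" "h (k e') = e'" if "e' \<in> topspace E'" for e'
    using hk that unfolding homeomorphic_maps_def by (auto simp: continuous_map_def)
  have kh: "k (h e) = e" if "e \<in> topspace E" for e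
    using hk that unfolding homeomorphic_maps_def by auto
  have p': "p' e' = p (k e')" if "e' \<in> topspace E'" for e'
    using eq[OF k(1)[OF that]] k(2)[OF that] by simp
  show ?thesis
    unfolding covering_map_def
  proof (intro conjI ballI)
    have "continuous_map E' X (p \<circ> k)"
      using hk cov unfolding homeomorphic_maps_def covering_map_def
      by (intro continuous_map_compose[of E' E]) auto
    then show "continuous_map E' X p'"
      by (rule continuous_map_eq) (use p' in auto)
    have "p' ` topspace E' = p ` topspace E"
      unfolding hE(1)[symmetric] image_image using eq by (intro image_cong) auto
    then show "p' ` topspace E' = topspace X"
      using cov by (simp add: covering_map_def)
    fix x assume "x \<in> topspace X"
    with cov have "\<exists>U. openin X U \<and> x \<in> U \<and>
        (\<exists>\<V>. \<Union>\<V> = {e \<in> topspace E. p e \<in> U} \<and> pairwise disjnt \<V> \<and>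
              (\<forall>V \<in> \<V>. openin E V \<and> homeomorphic_map (subtopology E V) (subtopology X U) p))"
      unfolding covering_map_def by simp
    then obtain U \<V> where U: "openin X U" "x \<in> U" "\<Union>\<V> = {e \<in> topspace E. p e \<in> U}" "pairwise disjnt \<V>"
      and \<V>: "\<forall>V \<in> \<V>. openin E V \<and> homeomorphic_map (subtopology E V) (subtopology X U) p"
      by (elim exE conjE)
    have sub: "V \<subseteq> topspace E" if "V \<in> \<V>" for V
      using that \<V> openin_subset by blast
    show "\<exists>U. openin X U \<and> x \<in> U \<and>
        (\<exists>\<V>. \<Union>\<V> = {e \<in> topspace E'. p' e \<in> U} \<and> pairwise disjnt \<V> \<and>
              (\<forall>V \<in> \<V>. openin E' V \<and> homeomorphic_map (subtopology E' V) (subtopology X U) p'))"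
    proof (intro exI[of _ U] exI[of _ "(`) h ` \<V>"] conjI U(1,2))
      have "\<Union>((`) h ` \<V>) = h ` {e \<in> topspace E. p e \<in> U}"
        unfolding U(3)[symmetric] by (rule image_Union[symmetric])
      also have "\<dots> = {e \<in> topspace E'. p' e \<in> U}"
        unfolding hE(1)[symmetric] using eq by auto
      finally show "\<Union>((`) h ` \<V>) = {e \<in> topspace E'. p' e \<in> U}" .
      show "pairwise disjnt ((`) h ` \<V>)"
        unfolding pairwise_def
      proof (intro ballI impI)
        fix A B assume "A \<in> (`) h ` \<V>" "B \<in> (`) h ` \<V>" "A \<noteq> B"
        then obtain V W where VW: "V \<in> \<V>" "W \<in> \<V>" "A = h ` V" "B = h ` W" "V \<noteq> W"
          by auto
        then have "disjnt V W"
          using U(4) by (auto simp: pairwise_def)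
        then show "disjnt A B"
          using inj_on_image_Int[OF hE(2) sub[OF VW(1)] sub[OF VW(2)]] VW(3,4) by (simp add: disjnt_def)
      qed
      show "\<forall>V\<in>(`) h ` \<V>. openin E' V \<and> homeomorphic_map (subtopology E' V) (subtopology X U) p'"
      proof
        fix A assume "A \<in> (`) h ` \<V>"
        then obtain V where V: "V \<in> \<V>" "A = h ` V"
          by auto
        have A: "openin E' A"
          using V \<V> sub homeomorphic_map_openness[OF hom] by auto
        have "homeomorphic_map E' E k"
          using hk homeomorphic_maps_sym homeomorphic_maps_map by blast
        moreover have "k ` (topspace E' \<inter> A) = topspace E \<inter> V"
        proof -
          have "topspace E' \<inter> A = h ` V" "topspace E \<inter> V = V"
            using openin_subset[OF A] V(2) sub[OF V(1)] by auto
          moreover have "k ` h ` V = (\<lambda>x. x) ` V"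
            unfolding image_image by (intro image_cong refl kh) (use sub[OF V(1)] in auto)
          ultimately show ?thesis by simp
        qed
        ultimately have "homeomorphic_map (subtopology E' A) (subtopology E V) k"
          by (rule homeomorphic_map_subtopologies)
        then have "homeomorphic_map (subtopology E' A) (subtopology X U) (p \<circ> k)"
          by (rule homeomorphic_map_compose) (use V(1) \<V> in simp)
        then have "homeomorphic_map (subtopology E' A) (subtopology X U) p'"
          by (rule homeomorphic_map_eq) (use p' in auto)
        with A show "openin E' A \<and> homeomorphic_map (subtopology E' A) (subtopology X U) p'" ..
      qed
    qed
  qed
qed

lemma countably_infinite_sheeted_homeomorphic:
  assumes hom: "homeomorphic_map E E' h" and cov: "countably_infinite_sheeted E X p"
    and eq: "\<And>e. e \<in> topspace E \<Longrightarrow> p' (h e) = p e"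
  shows "countably_infinite_sheeted E' X p'"
  unfolding countably_infinite_sheeted_def
proof (intro conjI ballI)
  have hE: "h ` topspace E = topspace E'" "inj_on h (topspace E)"
    using hom homeomorphic_imp_surjective_map homeomorphic_imp_injective_map by blast+
  show "covering_map E' X p'"
    by (rule covering_map_homeomorphic[where p = p, OF hom])
       (use cov eq in \<open>auto simp: countably_infinite_sheeted_def\<close>)
  fix x assume x: "x \<in> topspace X"
  have *: "{e \<in> topspace E'. p' e = x} = h ` {e \<in> topspace E. p e = x}"
    unfolding hE(1)[symmetric] using eq by auto
  have "inj_on h {e \<in> topspace E. p e = x}"
    using hE(2) by (rule inj_on_subset) auto
  then show "countable {e \<in> topspace E'. p' e = x}" "infinite {e \<in> topspace E'. p' e = x}"
    using cov x unfolding * countably_infinite_sheeted_def by (auto simp: finite_image_iff)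
qed

section \<open>The zero locus as a copy of the covering\<close>

context covering
begin

text \<open>The local form of an embedding of \<open>E\<close> into \<open>X \<times> \<complex>\<close> over \<open>X\<close>: \<open>s y e\<close> is the point over \<open>y\<close>
  in the sheet of \<open>e\<close>, and \<open>m\<close> bounds \<open>\<zeta>\<close> from below so that canonical products converge.\<close>

definition sparse_trivialization ::
  "('e \<Rightarrow> complex) \<Rightarrow> 'a \<Rightarrow> 'a set \<Rightarrow> ('a \<Rightarrow> 'e \<Rightarrow> 'e) \<Rightarrow> ('e \<Rightarrow> real) \<Rightarrow> bool" where
  "sparse_trivialization \<zeta> x V s m \<longleftrightarrow> openin X V \<and> x \<in> V \<and>
     (\<forall>y\<in>V. bij_betw (s y) (fibre x) (fibre y)) \<and>
     (\<forall>e\<in>fibre x. s x e = e \<and> continuous_map (subtopology X V) E (\<lambda>y. s y e) \<and>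
        openin E ((\<lambda>y. s y e) ` V) \<and> continuous_map (subtopology X V) euclidean (\<lambda>y. \<zeta> (s y e)) \<and>
        0 < m e \<and> (\<forall>y\<in>V. m e \<le> norm (\<zeta> (s y e)))) \<and>
     (\<forall>f. bij_betw f UNIV (fibre x) \<longrightarrow> summable (\<lambda>k::nat. 1 / (m (f k))\<^sup>2))"

text \<open>\<open>F\<close> is defined with an arbitrary enumeration of each fibre; near
  \<open>x\<close> it may be computed with the enumeration carried over from \<open>x\<close>, whose
  terms vary continuously. The delicate point is that e \<mapsto> (\<open>p e\<close>,
  \<open>\<zeta> e\<close>) is open: zeros from other sheets must not approach
  \<open>\<zeta> e\<close>. The lower bounds \<open>m\<close> leave only finitely many sheets that
  could do so.\<close>

theorem weierstrass_family_of_embedding: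
  assumes sheets: "countably_infinite_sheeted E X p"
    and inj: "\<And>x. x \<in> topspace X \<Longrightarrow> inj_on \<zeta> (fibre x)"
    and loc: "\<And>x. x \<in> topspace X \<Longrightarrow> \<exists>V s m. sparse_trivialization \<zeta> x V s m"
  shows "\<exists>F. weierstrass_entire_family X F \<and> equivalent_coverings E p (zero_space X F) fst"
proof -
  define en where "en x = from_nat_into (fibre x)" for x
  have en: "bij_betw (en x) UNIV (fibre x)" if "x \<in> topspace X" for x
    using sheets that bij_betw_from_nat_into unfolding en_def fibre_def countably_infinite_sheeted_def by blast
  define F where "F x = canonical_product (\<lambda>k. \<zeta> (en x k))" for x
  have VX: "y \<in> topspace X" if "sparse_trivialization \<zeta> x V s m" "y \<in> V" for x V s m y
    using that openin_subset unfolding sparse_trivialization_def by blast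
  have trivD: "m e > 0" "y \<in> V \<Longrightarrow> m e \<le> norm (\<zeta> (s y e))" "s x e = e"
    "continuous_map (subtopology X V) E (\<lambda>y. s y e)" "openin E ((\<lambda>y. s y e) ` V)"
    "continuous_map (subtopology X V) euclidean (\<lambda>y. \<zeta> (s y e))"
    if "sparse_trivialization \<zeta> x V s m" "e \<in> fibre x" for x V s m y e
    using that unfolding sparse_trivialization_def by blast+
  have trivV: "openin X V" "x \<in> V" "y \<in> V \<Longrightarrow> bij_betw (s y) (fibre x) (fibre y)"
    "summable (\<lambda>k. 1 / (m (en x k))\<^sup>2)"
    if "sparse_trivialization \<zeta> x V s m" for x V s m y
    using that en[OF VX[OF that, of x]] unfolding sparse_trivialization_def by blast+
  have en_in: "en x k \<in> fibre x" if "x \<in> topspace X" for x k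
    using en[OF that] by (auto simp: bij_betw_def)

  have F_local: "F y = canonical_product (\<lambda>k. \<zeta> (s y (en x k)))"
    if t: "sparse_trivialization \<zeta> x V s m" and y: "y \<in> V" for x V s m y
  proof -
    have x: "x \<in> topspace X" and yX: "y \<in> topspace X"
      using VX[OF t] trivV(2)[OF t] y by auto
    \<comment> \<open>The enumeration chosen at \<open>y\<close> and the one carried over from
      \<open>x\<close> differ by this permutation, to which the canonical product is blind.\<close>
    define \<sigma> where "\<sigma> = inv_into UNIV (\<lambda>k. s y (en x k)) \<circ> en y"
    have b: "bij_betw (\<lambda>k. s y (en x k)) UNIV (fibre y)"
      using bij_betw_trans[OF en[OF x] trivV(3)[OF t y]] by (simp add: o_def)
    have "bij \<sigma>"
      unfolding \<sigma>_def by (rule bij_betw_trans[OF en[OF yX] bij_betw_inv_into[OF b]])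
    moreover have "s y (en x (\<sigma> k)) = en y k" for k
      unfolding \<sigma>_def using bij_betw_inv_into_right[OF b en_in[OF yX]] by simp
    ultimately show ?thesis
      unfolding F_def
      using canonical_product_reorder[of "\<lambda>k. m (en x k)" "\<lambda>k. \<zeta> (s y (en x k))" \<sigma>]
        trivD(1,2)[OF t en_in[OF x]] y trivV(4)[OF t] by simp
  qed

  have F_zero: "F x z = 0 \<longleftrightarrow> z \<in> \<zeta> ` fibre x" and F_hol: "F x holomorphic_on UNIV"
    if x: "x \<in> topspace X" for x z
  proof -
    obtain V s m where t: "sparse_trivialization \<zeta> x V s m"
      using loc[OF x] by blast
    note bounds = trivD(1)[OF t en_in[OF x]] _ trivV(4)[OF t]
    have b2: "m (en x k) \<le> norm (\<zeta> (en x k))" for k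
      using trivD(2)[OF t en_in[OF x] trivV(2)[OF t], of k] trivD(3)[OF t en_in[OF x], of k] by simp
    show "F x holomorphic_on UNIV"
      unfolding F_def by (rule canonical_product_holomorphic[OF bounds]) (rule b2)
    have "F x z = 0 \<longleftrightarrow> z \<in> range (\<lambda>k. \<zeta> (en x k))"
      unfolding F_def by (rule canonical_product_eq_0_iff[OF bounds]) (rule b2)
    also have "range (\<lambda>k. \<zeta> (en x k)) = \<zeta> ` fibre x"
      using bij_betw_imp_surj_on[OF en[OF x]] by (metis image_image)
    finally show "F x z = 0 \<longleftrightarrow> z \<in> \<zeta> ` fibre x" .
  qed

  have F_cont: "continuous_map (prod_topology X euclidean) euclidean (\<lambda>(x, z). F x z)"
  proof (rule continuous_map_locally)
    fix w assume "w \<in> topspace (prod_topology X (euclidean :: complex topology))"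
    then have x: "fst w \<in> topspace X"
      by auto
    obtain V s m where t: "sparse_trivialization \<zeta> (fst w) V s m"
      using loc[OF x] by blast
    have "continuous_map (prod_topology (subtopology X V) euclidean) euclidean
        (\<lambda>(y, z). canonical_product (\<lambda>k. \<zeta> (s y (en (fst w) k))) z)"
      by (rule continuous_map_canonical_product[of "\<lambda>k. m (en (fst w) k)"])
         (use trivD(1,2,6)[OF t en_in[OF x]] trivV(4)[OF t] in auto)
    then have "continuous_map (prod_topology (subtopology X V) euclidean) euclidean (\<lambda>(x, z). F x z)"
      by (rule continuous_map_eq) (use F_local[OF t] in auto)
    moreover have "prod_topology (subtopology X V) (euclidean :: complex topology) = subtopology (prod_topology X euclidean) (V \<times> UNIV)"
      using subtopology_Times[of X "euclidean :: complex topology" V UNIV] by simp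
    moreover have "openin (prod_topology X (euclidean :: complex topology)) (V \<times> UNIV)"
      using trivV(1)[OF t] by (simp add: openin_prod_Times_iff)
    moreover have "w \<in> V \<times> UNIV"
      using trivV(2)[OF t] by (cases w) auto
    ultimately show "\<exists>U. openin (prod_topology X euclidean) U \<and> w \<in> U \<and>
        continuous_map (subtopology (prod_topology X euclidean) U) euclidean (\<lambda>(x, z). F x z)"
      by (intro exI[of _ "V \<times> UNIV"]) auto
  qed

  let ?Z = "zero_space X F"
  let ?h = "\<lambda>e. (p e, \<zeta> e)"
  have topZ: "topspace ?Z = ?h ` topspace E"
  proof -
    have "topspace ?Z = {(x, z). x \<in> topspace X \<and> z \<in> \<zeta> ` fibre x}"
      using F_zero by (auto simp: zero_space_def)
    also have "\<dots> = ?h ` topspace E"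
      using p_in_topspace by (auto simp: fibre_def)
    finally show ?thesis .
  qed
  have p_s: "p (s y e) = y" if "sparse_trivialization \<zeta> x V s m" "e \<in> fibre x" "y \<in> V" for x V s m e y
    using bij_betwE[OF trivV(3)[OF that(1,3)]] that(2) by (auto simp: fibre_def)
  have sheet_eq: "e' = s (p e') e" if t: "sparse_trivialization \<zeta> x V s m" and e: "e \<in> fibre x"
    and e': "e' \<in> (\<lambda>y. s y e) ` V" for x V s m e e'
  proof -
    obtain y where y: "y \<in> V" "e' = s y e"
      using e' by blast
    with p_s[OF t e y(1)] show ?thesis
      by simp
  qed
  have \<zeta>_cont: "continuous_map E euclidean \<zeta>"
  proof (rule continuous_map_locally)
    fix e assume e: "e \<in> topspace E"
    then have x: "p e \<in> topspace X" and ef: "e \<in> fibre (p e)"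
      by (auto simp: p_in_topspace fibre_def)
    obtain V s m where t: "sparse_trivialization \<zeta> (p e) V s m"
      using loc[OF x] by blast
    let ?B = "(\<lambda>y. s y e) ` V"
    \<comment> \<open>On the open set \<open>?B\<close> a point is determined by its projection, so
      \<open>\<zeta>\<close> factors there as a continuous function on \<open>V\<close> after
      \<open>p\<close>.\<close>
    have "p e' \<in> V" if "e' \<in> ?B" for e'
      using that p_s[OF t ef] by auto
    then have "continuous_map (subtopology E ?B) (subtopology X V) p"
      using continuous_p by (auto simp: continuous_map_in_subtopology continuous_map_from_subtopology)
    then have "continuous_map (subtopology E ?B) euclidean ((\<lambda>y. \<zeta> (s y e)) \<circ> p)"
      using trivD(6)[OF t ef] by (rule continuous_map_compose)
    then have "continuous_map (subtopology E ?B) euclidean \<zeta>"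
      by (rule continuous_map_eq) (use sheet_eq[OF t ef] in auto)
    moreover have "e \<in> ?B"
      using trivD(3)[OF t ef] trivV(2)[OF t] by (metis image_eqI)
    ultimately show "\<exists>U. openin E U \<and> e \<in> U \<and> continuous_map (subtopology E U) euclidean \<zeta>"
      using trivD(5)[OF t ef] by blast
  qed
  have h_hom: "homeomorphic_map E ?Z ?h"
  proof (rule bijective_open_imp_homeomorphic_map)
    have "continuous_map E (prod_topology X euclidean) ?h"
      using continuous_p \<zeta>_cont by (rule continuous_map_pairedI)
    then show "continuous_map E ?Z ?h"
      unfolding zero_space_def
      by (rule continuous_map_into_subtopology) (use F_zero p_in_topspace in \<open>auto simp: fibre_def\<close>)
    show "?h ` topspace E = topspace ?Z"
      by (rule topZ[symmetric])
    show "inj_on ?h (topspace E)"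
      using inj p_in_topspace by (auto simp: inj_on_def fibre_def)
    show "open_map E ?Z ?h"
      unfolding open_map_def
    proof (intro allI impI)
      fix W assume W: "openin E W"
      show "openin ?Z (?h ` W)"
      proof (subst openin_subopen, intro ballI)
        fix w assume "w \<in> ?h ` W"
        then obtain e where e: "e \<in> W" "w = ?h e"
          by blast
        then have eE: "e \<in> topspace E"
          using W openin_subset by blast
        then have x: "p e \<in> topspace X" and ef: "e \<in> fibre (p e)"
          by (auto simp: p_in_topspace fibre_def)
        obtain V s m where t: "sparse_trivialization \<zeta> (p e) V s m"
          using loc[OF x] by blast
        \<comment> \<open>The sheets that might interfere. On every other sheet the modulus of
          \<open>\<zeta>\<close> exceeds \<open>norm (\<zeta> e) + 1\<close> over all of
          \<open>V\<close>; and \<open>M\<close> is finite because the terms 1/m^2 tend to 0 along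
          the fibre.\<close>
        define M where "M = {e' \<in> fibre (p e). m e' \<le> norm (\<zeta> e) + 1} - {e}"
        have "finite M"
        proof -
          have "(\<lambda>k. 1 / (m (en (p e) k))\<^sup>2) \<longlonglongrightarrow> 0"
            using trivV(4)[OF t] by (rule summable_LIMSEQ_zero)
          from order_tendstoD(2)[OF this, of "1 / (norm (\<zeta> e) + 1)\<^sup>2"]
          have "eventually (\<lambda>k. 1 / (m (en (p e) k))\<^sup>2 < 1 / (norm (\<zeta> e) + 1)\<^sup>2) sequentially"
            using norm_ge_zero[of "\<zeta> e"] by (simp add: add_eq_0_iff)
          then obtain K where K: "\<And>k. k \<ge> K \<Longrightarrow> 1 / (m (en (p e) k))\<^sup>2 < 1 / (norm (\<zeta> e) + 1)\<^sup>2"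
            by (auto simp: eventually_sequentially)
          have "M \<subseteq> en (p e) ` {..<K}"
          proof
            fix e' assume e': "e' \<in> M"
            then have "e' \<in> fibre (p e)"
              by (simp add: M_def)
            then obtain k where k: "e' = en (p e) k"
              using en[OF x] by (auto simp: bij_betw_def)
            have "0 < m e'" "m e' \<le> norm (\<zeta> e) + 1"
              using e' trivD(1)[OF t] by (auto simp: M_def)
            then have "1 / (norm (\<zeta> e) + 1)\<^sup>2 \<le> 1 / (m e')\<^sup>2"
              by (intro frac_le power_mono) auto
            with K[of k] k have "k < K"
              by force
            with k show "e' \<in> en (p e) ` {..<K}"
              by blast
          qed
          then show ?thesis
            by (rule finite_subset) simp
        qed
        \<comment> \<open>Half the least distance: a competing zero that moves by less than
          \<open>d\<close> stays farther than \<open>d\<close> from \<open>\<zeta> e\<close>. The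
          bound 1 deals with the sheets outside \<open>M\<close> and with empty
          \<open>M\<close>.\<close>
        define d where "d = Min (insert 1 ((\<lambda>e'. dist (\<zeta> e') (\<zeta> e) / 2) ` M))"
        have ne: "\<zeta> e' \<noteq> \<zeta> e" if "e' \<in> M" for e'
          using that inj[OF x] ef by (auto simp: M_def dest: inj_onD)
        then have d: "d > 0" "d \<le> 1"
          using \<open>finite M\<close> by (auto simp: d_def)
        have dM: "2 * d \<le> dist (\<zeta> e') (\<zeta> e)" if "e' \<in> M" for e'
        proof -
          have "d \<le> dist (\<zeta> e') (\<zeta> e) / 2"
            unfolding d_def using \<open>finite M\<close> that by (intro Min_le) auto
          then show ?thesis by simp
        qed
        define T where "T e' = {y \<in> V. \<zeta> (s y e') \<in> ball (\<zeta> e') d}" for e'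
        define O' where "O' = {y \<in> V. s y e \<in> W} \<inter> \<Inter>(T ` M)"
        have topV: "topspace (subtopology X V) = V"
          using openin_subset[OF trivV(1)[OF t]] by auto
        have openV: "openin X A" if "openin (subtopology X V) A" for A
          using that trivV(1)[OF t] openin_trans_full by blast
        have T: "openin X (T e')" if "e' \<in> M" for e'
        proof (rule openV)
          have "continuous_map (subtopology X V) euclidean (\<lambda>y. \<zeta> (s y e'))"
            using that trivD(6)[OF t] by (simp add: M_def)
          from openin_continuous_map_preimage[OF this, of "ball (\<zeta> e') d"]
          show "openin (subtopology X V) (T e')"
            unfolding topV T_def by simp
        qed
        have "openin X O'"
          unfolding O'_def
        proof (rule openin_Int_Inter)
          show "openin X {y \<in> V. s y e \<in> W}"
            using openin_continuous_map_preimage[OF trivD(4)[OF t ef] W] unfolding topV by (rule openV)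
        qed (use \<open>finite M\<close> T in auto)
        then have "openin ?Z (topspace ?Z \<inter> (O' \<times> ball (\<zeta> e) d))"
          unfolding zero_space_def
          by (subst openin_subtopology) (auto simp: openin_prod_Times_iff intro!: exI[of _ "O' \<times> ball (\<zeta> e) d"])
        moreover have "w \<in> topspace ?Z \<inter> (O' \<times> ball (\<zeta> e) d)"
        proof -
          have "p e \<in> O'"
            using trivV(2)[OF t] trivD(3)[OF t] ef e(1) d(1) by (auto simp: O'_def T_def M_def)
          moreover have "w \<in> topspace ?Z"
            using e eE topZ by auto
          ultimately show ?thesis
            using e(2) d(1) by auto
        qed
        moreover have "topspace ?Z \<inter> (O' \<times> ball (\<zeta> e) d) \<subseteq> ?h ` W"
        proof
          fix v assume v: "v \<in> topspace ?Z \<inter> (O' \<times> ball (\<zeta> e) d)"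
          then obtain e1 where e1: "e1 \<in> topspace E" "v = ?h e1"
            unfolding topZ by blast
          with v have y: "p e1 \<in> O'" "dist (\<zeta> e1) (\<zeta> e) < d"
            by (auto simp: dist_commute)
          then have yV: "p e1 \<in> V"
            by (simp add: O'_def)
          obtain e' where e': "e' \<in> fibre (p e)" "e1 = s (p e1) e'"
            using trivV(3)[OF t yV] e1(1) unfolding bij_betw_def fibre_def by (metis (mono_tags, lifting) imageE mem_Collect_eq)
          have "e' = e"
          proof (rule ccontr)
            assume "e' \<noteq> e"
            show False
            proof (cases "m e' \<le> norm (\<zeta> e) + 1")
              case True
              then have M: "e' \<in> M"
                using \<open>e' \<noteq> e\<close> e'(1) by (simp add: M_def)
              then have "dist (\<zeta> e') (\<zeta> e1) < d"
                using y(1) e'(2) by (auto simp: O'_def T_def)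
              then show False
                using dM[OF M] y(2) dist_triangle[of "\<zeta> e'" "\<zeta> e" "\<zeta> e1"] by linarith
            next
              case False
              then have "norm (\<zeta> e1) > norm (\<zeta> e) + 1"
                using trivD(2)[OF t e'(1) yV] e'(2) by simp
              moreover have "norm (\<zeta> e1) \<le> norm (\<zeta> e) + dist (\<zeta> e1) (\<zeta> e)"
                by (metis dist_norm norm_triangle_sub)
              ultimately show False
                using y(2) d(2) by linarith
            qed
          qed
          with y(1) e'(2) have "e1 \<in> W"
            by (auto simp: O'_def)
          with e1(2) show "v \<in> ?h ` W" by blast
        qed
        ultimately show "\<exists>T. openin ?Z T \<and> w \<in> T \<and> T \<subseteq> ?h ` W"
          by blast
      qed
    qed
  qed
  have "countably_infinite_sheeted ?Z X fst"
    by (rule countably_infinite_sheeted_homeomorphic[OF h_hom sheets]) simp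
  with F_cont F_hol have "weierstrass_entire_family X F"
    by (simp add: weierstrass_entire_family_def)
  moreover have "equivalent_coverings E p ?Z fst"
    unfolding equivalent_coverings_def using h_hom by (intro exI[of _ ?h]) simp
  ultimately show ?thesis by blast
qed

end

section \<open>Placing the points of the fibres\<close>

lemma path_homotopic_if_loop_trivial:
  assumes f: "path_between X x y f" and g: "path_between X x y g"
    and trivial: "path_homotopic X (path_join f (path_rev g)) (\<lambda>t. x)"
  shows "path_homotopic X f g"
proof -
  note ps = f[unfolded path_between_def] g[unfolded path_between_def]
  have "path_homotopic X f (path_join (path_join f (path_rev g)) g)"
    using path_homotopic_cancel_right[OF f path_between_rev[OF g]] by (simp add: path_homotopic_sym)
  also have "path_homotopic X \<dots> (path_join (\<lambda>t. x) g)"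
    using ps trivial by (intro path_join_cong path_homotopic_refl) auto
  also have "path_homotopic X \<dots> g"
    using ps by (intro path_join_const_left) auto
  finally show ?thesis .
qed

text \<open>Sets inside which all paths with the same ends are homotopic in \<open>X\<close>; monotone, unlike
  simple connectedness.\<close>

definition relatively_simple :: "'a topology \<Rightarrow> 'a set \<Rightarrow> bool" where
  "relatively_simple X V \<longleftrightarrow> (\<exists>G b. V \<subseteq> G \<and> path_connectedin X G \<and> b \<in> G \<and>
     (\<forall>g. loop_in (subtopology X G) b g \<longrightarrow> path_homotopic X g (\<lambda>t. b)))"

lemma relatively_simple_mono: "relatively_simple X V \<Longrightarrow> W \<subseteq> V \<Longrightarrow> relatively_simple X W"
  unfolding relatively_simple_def by (meson subset_trans)

lemma relatively_simple_exists:
  assumes "locally_path_connected_space X" "semilocally_simply_connected_space X" "x \<in> topspace X"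
  shows "\<exists>V. openin X V \<and> x \<in> V \<and> relatively_simple X V"
proof -
  obtain U where U: "openin X U" "x \<in> U" "\<forall>g. loop_in (subtopology X U) x g \<longrightarrow> path_homotopic X g (\<lambda>t. x)"
    using assms(2,3) unfolding semilocally_simply_connected_space_def by blast
  obtain V where V: "openin X V" "path_connectedin X V" "x \<in> V" "V \<subseteq> U"
    using assms(1) U(1,2) unfolding locally_path_connected_space by blast
  have "path_homotopic X g (\<lambda>t. x)" if "loop_in (subtopology X V) x g" for g
    using that U(3) V(4) by (auto simp: loop_in_def pathin_subtopology)
  with V show ?thesis
    unfolding relatively_simple_def by blast
qed

lemma path_connectedin_path:
  assumes "path_connectedin X G" "x \<in> G" "y \<in> G"
  obtains g where "path_between X x y g" "g \<in> {0..1} \<rightarrow> G"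
proof -
  have "\<exists>g. pathin X g \<and> g \<in> {0..1} \<rightarrow> G \<and> g 0 = x \<and> g 1 = y"
    using assms(1)[unfolded path_connectedin] assms(2,3) by simp
  then obtain g where "pathin X g" "g \<in> {0..1} \<rightarrow> G" "g 0 = x" "g 1 = y"
    by (elim exE conjE)
  then show ?thesis
    by (intro that[of g]) (simp_all add: path_between_def)
qed

lemma path_connected_space_path:
  assumes "path_connected_space X" "x \<in> topspace X" "y \<in> topspace X"
  shows "\<exists>g. path_between X x y g"
  using assms(1)[unfolded path_connected_space_def, rule_format, OF assms(2,3)] unfolding path_between_def .

text \<open>Every \<open>c x\<close> first runs to one point \<open>b\<close> along a fixed path and
  then stays inside \<open>G\<close>, where the class in \<open>X\<close> of a path from
  \<open>b\<close> depends only on its end. Continuing along \<open>\<delta>\<close> therefore lands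
  in the class chosen at the other end.\<close>

lemma coherent_paths:
  assumes "path_connected_space X" "x0 \<in> topspace X" "relatively_simple X V"
  obtains c where "\<And>x. x \<in> V \<Longrightarrow> path_between X x0 x (c x)"
    "\<And>x y \<delta>. x \<in> V \<Longrightarrow> path_between X x y \<delta> \<Longrightarrow> \<delta> \<in> {0..1} \<rightarrow> V \<Longrightarrow> path_homotopic X (path_join (c x) \<delta>) (c y)"
proof -
  obtain G b where G: "V \<subseteq> G" "path_connectedin X G" "b \<in> G"
    "\<forall>g. loop_in (subtopology X G) b g \<longrightarrow> path_homotopic X g (\<lambda>t. b)"
    using assms(3) unfolding relatively_simple_def by blast
  have "b \<in> topspace X"
    using G(2,3) path_connectedin_subset_topspace by blast
  then obtain \<gamma> where \<gamma>: "path_between X x0 b \<gamma>"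
    using path_connected_space_path[OF assms(1,2)] by auto
  have "\<forall>x\<in>G. \<exists>d. path_between X b x d \<and> d \<in> {0..1} \<rightarrow> G"
  proof
    fix x assume "x \<in> G"
    from path_connectedin_path[OF G(2,3) this]
    show "\<exists>d. path_between X b x d \<and> d \<in> {0..1} \<rightarrow> G" by metis
  qed
  from bchoice[OF this] obtain d where "\<forall>x\<in>G. path_between X b x (d x) \<and> d x \<in> {0..1} \<rightarrow> G"
    by (elim exE)
  then have d: "\<And>x. x \<in> G \<Longrightarrow> path_between X b x (d x)" "\<And>x. x \<in> G \<Longrightarrow> d x \<in> {0..1} \<rightarrow> G"
    by auto
  show ?thesis
  proof (rule that[of "\<lambda>x. path_join \<gamma> (d x)"])
    fix x assume "x \<in> V"
    then have "x \<in> G"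
      using G(1) by auto
    then show "path_between X x0 x (path_join \<gamma> (d x))"
      by (intro path_between_join[OF \<gamma>] d(1))
  next
    fix x y \<delta> assume x: "x \<in> V" and \<delta>: "path_between X x y \<delta>" "\<delta> \<in> {0..1} \<rightarrow> V"
    have "\<delta> 1 \<in> V"
      using \<delta>(2) by (rule funcset_mem) simp
    with x \<delta> have xG: "x \<in> G" and yG: "y \<in> G" and \<delta>G: "\<delta> \<in> {0..1} \<rightarrow> G"
      using G(1) by (auto simp: path_between_def)
    have xd: "path_between X b y (path_join (d x) \<delta>)"
      using path_between_join[OF d(1)[OF xG] \<delta>(1)] .
    have "path_homotopic X (path_join (d x) \<delta>) (d y)"
    proof (rule path_homotopic_if_loop_trivial[OF xd d(1)[OF yG]])
      let ?l = "path_join (path_join (d x) \<delta>) (path_rev (d y))"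
      have "?l t \<in> G" if "t \<in> {0..1}" for t
      proof -
        have join: "path_join f g \<in> {0..1} \<rightarrow> G" if "f \<in> {0..1} \<rightarrow> G" "g \<in> {0..1} \<rightarrow> G" for f g
          using that unfolding path_join_def by (auto simp: Pi_iff)
        have "path_rev (d y) \<in> {0..1} \<rightarrow> G"
          using d(2)[OF yG] by (auto simp: path_rev_def Pi_iff)
        from funcset_mem[OF join[OF join[OF d(2)[OF xG] \<delta>G] this] that]
        show ?thesis .
      qed
      then have "path_between (subtopology X G) b b ?l"
        using path_between_join[OF xd path_between_rev[OF d(1)[OF yG]]]
        by (auto simp: path_between_subtopology)
      with G(4) show "path_homotopic X ?l (\<lambda>t. b)"
        unfolding loop_in_iff_path_between by blast
    qed
    then have "path_homotopic X (path_join \<gamma> (path_join (d x) \<delta>)) (path_join \<gamma> (d y))"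
      using \<gamma> xd by (intro path_join_cong path_homotopic_refl) (auto simp: path_between_def)
    from path_homotopic_trans[OF _ this]
    show "path_homotopic X (path_join (path_join \<gamma> (d x)) \<delta>) (path_join \<gamma> (d y))"
      using \<gamma> d(1)[OF xG] \<delta>(1) path_join_assoc[of X \<gamma> "d x" \<delta>] by (auto simp: path_between_def)
  qed
qed

text \<open>By \<open>c_move\<close>, the class of \<open>c U\<close> is locally constant along
  paths in \<open>U\<close>: a vertex of the tree attached to the set \<open>U\<close>. The family
  \<open>\<phi>\<close> puts weights on these vertices.\<close>

locale free_covering = covering E X p + free_basis "fundamental_group X x0" S
  for E :: "'e topology" and X :: "'a topology" and p x0 S +
  fixes \<U> :: "'a set set" and \<phi> :: "'a set \<Rightarrow> 'a \<Rightarrow> real" and c :: "'a set \<Rightarrow> 'a \<Rightarrow> real \<Rightarrow> 'a"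
  assumes x0: "x0 \<in> topspace X"
    and path_conn: "path_connected_space X" and loc_path_conn: "locally_path_connected_space X"
    and sheets: "countably_infinite_sheeted E X p"
    and cover_open: "U \<in> \<U> \<Longrightarrow> openin X U"
    and weight_nonneg: "\<phi> U x \<ge> 0"
    and partition: "x \<in> topspace X \<Longrightarrow> finite {U \<in> \<U>. x \<in> U} \<and>
      (\<exists>N. openin X N \<and> x \<in> N \<and> (\<forall>U\<in>\<U>. x \<in> U \<longrightarrow> N \<subseteq> U \<and> continuous_map (subtopology X N) euclideanreal (\<phi> U)) \<and>
        (\<forall>y\<in>N. (\<forall>U\<in>\<U>. x \<notin> U \<longrightarrow> \<phi> U y = 0) \<and> sum (\<lambda>U. \<phi> U y) {U \<in> \<U>. x \<in> U} = 1))"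
    and c_path: "U \<in> \<U> \<Longrightarrow> x \<in> U \<Longrightarrow> path_between X x0 x (c U x)"
    and c_move: "U \<in> \<U> \<Longrightarrow> x \<in> U \<Longrightarrow> path_between X x y \<delta> \<Longrightarrow> \<delta> \<in> {0..1} \<rightarrow> U \<Longrightarrow>
      path_homotopic X (path_join (c U x) \<delta>) (c U y)"
begin

section \<open>Path classes as vertices and the position of the barycentre\<close>

abbreviation \<pi> where "\<pi> \<equiv> fundamental_group X x0"

abbreviation cls :: "(real \<Rightarrow> 'a) \<Rightarrow> (real \<Rightarrow> 'a) set" where "cls \<equiv> loop_class X x0"

lemma cls_eqI: "path_between X x0 x0 g \<Longrightarrow> path_homotopic X g h \<Longrightarrow> cls g = cls h"
  using loop_class_eq_iff path_between_homotopic loop_in_iff_path_between by metis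

lemma cls_closed: "path_between X x0 x0 g \<Longrightarrow> cls g \<in> carrier \<pi>"
  by (simp add: fundamental_group_closed loop_in_iff_path_between)

lemma cls_mult: "path_between X x0 x0 g \<Longrightarrow> path_between X x0 x0 h \<Longrightarrow> cls g \<otimes>\<^bsub>\<pi>\<^esub> cls h = cls (path_join g h)"
  by (simp add: fundamental_group_mult loop_in_iff_path_between)

lemma cls_one: "cls (\<lambda>t. x0) = \<one>\<^bsub>\<pi>\<^esub>"
  by (simp add: fundamental_group_def)

lemma cls_homotopic:
  "path_between X x0 x0 g \<Longrightarrow> path_between X x0 x0 h \<Longrightarrow> cls g = cls h \<Longrightarrow> path_homotopic X g h"
  by (simp add: loop_class_eq_iff loop_in_iff_path_between)

text \<open>Homotopy classes of paths from \<open>x0\<close> to \<open>x\<close> form a \<open>\<pi>\<close>-torsor; \<open>direction q x a\<close> is the mean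
  signed coordinate, along the edge in direction \<open>a\<close> at the vertex \<open>q\<close>, of the classes \<open>c U x\<close>
  weighted by \<open>\<phi> U x\<close>.\<close>

definition members :: "'a \<Rightarrow> 'a set set" where
  "members x = {U \<in> \<U>. x \<in> U}"

definition relative_class :: "(real \<Rightarrow> 'a) \<Rightarrow> 'a \<Rightarrow> 'a set \<Rightarrow> (real \<Rightarrow> 'a) set" where
  "relative_class q x U = cls (path_join q (path_rev (c U x)))"

definition direction :: "(real \<Rightarrow> 'a) \<Rightarrow> 'a \<Rightarrow> (real \<Rightarrow> 'a) set \<times> bool \<Rightarrow> real" where
  "direction q x a = mean_coord (members x) (\<lambda>U. \<phi> U x) (relative_class q x) a \<one>\<^bsub>\<pi>\<^esub>"

text \<open>The barycentre lies in the open star of the vertex \<open>q\<close>: it is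
  \<open>q\<close> itself if no direction is positive, and an interior point of the edge in
  direction \<open>a\<close> if \<open>direction q x a\<close> is positive.\<close>

definition good :: "(real \<Rightarrow> 'a) \<Rightarrow> 'a \<Rightarrow> bool" where
  "good q x \<longleftrightarrow> path_between X x0 x q \<and> (\<forall>a. fst a \<in> S \<longrightarrow> direction q x a < 1)"

definition inv_loop :: "(real \<Rightarrow> 'a) set \<times> bool \<Rightarrow> real \<Rightarrow> 'a" where
  "inv_loop a = (SOME l. path_between X x0 x0 l \<and> cls l = inv\<^bsub>\<pi>\<^esub> letter_val \<pi> a)"

text \<open>An edge step multiplies from the left by the inverse letter, in agreement with
  \<open>length_letter_mult\<close>.\<close>

definition neighbour :: "(real \<Rightarrow> 'a) set \<times> bool \<Rightarrow> (real \<Rightarrow> 'a) \<Rightarrow> real \<Rightarrow> 'a" where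
  "neighbour a q = path_join (inv_loop a) q"

text \<open>\<open>Suc\<close> keeps labels positive: canonical products require nonzero
  zeros.\<close>

definition label :: "(real \<Rightarrow> 'a) \<Rightarrow> 'e \<Rightarrow> real" where
  "label q e = real (Suc (to_nat_on (fibre x0) (transport (path_rev q) e)))"

text \<open>The imaginary part, proportional to the label at the start of the positively oriented edge,
  keeps different points apart for \<open>0 < t < 1\<close>.\<close>

definition displacement :: "real \<Rightarrow> (real \<Rightarrow> 'a) set \<times> bool \<Rightarrow> (real \<Rightarrow> 'a) \<Rightarrow> 'e \<Rightarrow> complex" where
  "displacement t a q e = Complex (t * (label (neighbour a q) e - label q e))
     (t * (1 - t) * (if snd a then label q e else label (neighbour a q) e))"

definition active :: "(real \<Rightarrow> 'a) \<Rightarrow> 'a \<Rightarrow> ((real \<Rightarrow> 'a) set \<times> bool) set" where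
  "active q x = {a. fst a \<in> S \<and> direction q x a > 0}"

text \<open>For a path \<open>q\<close> to \<open>x\<close> the sum has at most one term. Written as
  a sum, it can be extended to a fixed finite set of directions, which is how continuity is
  seen.\<close>

definition point :: "(real \<Rightarrow> 'a) \<Rightarrow> 'a \<Rightarrow> 'e \<Rightarrow> complex" where
  "point q x e = of_real (label q e) + (\<Sum>a\<in>active q x. displacement (direction q x a) a q e)"

lemma goodD:
  assumes "good q x"
  shows "path_between X x0 x q" "fst a \<in> S \<Longrightarrow> direction q x a < 1"
  using assms unfolding good_def by blast+

lemma inv_loop:
  assumes "fst a \<in> S"
  shows "path_between X x0 x0 (inv_loop a)" "cls (inv_loop a) = inv\<^bsub>\<pi>\<^esub> letter_val \<pi> a"
proof -
  have "inv\<^bsub>\<pi>\<^esub> letter_val \<pi> a \<in> carrier \<pi>"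
    using assms by simp
  then have "\<exists>l. path_between X x0 x0 l \<and> cls l = inv\<^bsub>\<pi>\<^esub> letter_val \<pi> a"
    by (metis fundamental_group_rep loop_in_iff_path_between)
  then have "path_between X x0 x0 (inv_loop a) \<and> cls (inv_loop a) = inv\<^bsub>\<pi>\<^esub> letter_val \<pi> a"
    unfolding inv_loop_def by (rule someI_ex)
  then show "path_between X x0 x0 (inv_loop a)" "cls (inv_loop a) = inv\<^bsub>\<pi>\<^esub> letter_val \<pi> a"
    by auto
qed

lemma neighbour_path: "fst a \<in> S \<Longrightarrow> path_between X x0 x q \<Longrightarrow> path_between X x0 x (neighbour a q)"
  unfolding neighbour_def by (rule path_between_join[OF inv_loop(1)])

lemma relative_path: "path_between X x0 x q \<Longrightarrow> U \<in> members x \<Longrightarrow> path_between X x0 x0 (path_join q (path_rev (c U x)))"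
  unfolding members_def by (auto intro!: path_between_join path_between_rev c_path)

lemma weights:
  assumes "path_between X x0 x q"
  shows "finite (members x)" "\<And>U. U \<in> members x \<Longrightarrow> \<phi> U x \<ge> 0" "(\<Sum>U\<in>members x. \<phi> U x) = 1"
    "\<And>U. U \<in> members x \<Longrightarrow> relative_class q x U \<in> carrier \<pi>"
proof -
  have "x \<in> topspace X"
    using path_between_topspace[OF assms] by simp
  from partition[OF this] show "finite (members x)" "(\<Sum>U\<in>members x. \<phi> U x) = 1"
    unfolding members_def by auto
  show "\<And>U. U \<in> members x \<Longrightarrow> relative_class q x U \<in> carrier \<pi>"
    unfolding relative_class_def by (rule cls_closed[OF relative_path[OF assms]])
qed (simp add: weight_nonneg)

text \<open>Changing the vertex is the same as moving the argument of \<open>mean_coord\<close> with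
  \<open>q\<close> fixed. This makes the results on central vertices available for paths.\<close>

lemma direction_loop_join:
  assumes q: "path_between X x0 x q" and l: "path_between X x0 x0 l"
  shows "direction (path_join l q) x a = mean_coord (members x) (\<lambda>U. \<phi> U x) (relative_class q x) a (cls l)"
  unfolding direction_def mean_coord_def
proof (intro sum.cong refl)
  fix U assume U: "U \<in> members x"
  have "relative_class (path_join l q) x U = cls (path_join l (path_join q (path_rev (c U x))))"
    unfolding relative_class_def
  proof (rule cls_eqI)
    show "path_between X x0 x0 (path_join (path_join l q) (path_rev (c U x)))"
      using relative_path[OF path_between_join[OF l q] U] .
    show "path_homotopic X (path_join (path_join l q) (path_rev (c U x))) (path_join l (path_join q (path_rev (c U x))))"
      using l q relative_path[OF q U] path_between_rev[OF c_path, of U x] U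
      by (intro path_join_assoc) (auto simp: path_between_def members_def)
  qed
  also have "\<dots> = cls l \<otimes>\<^bsub>\<pi>\<^esub> relative_class q x U"
    unfolding relative_class_def using cls_mult[OF l relative_path[OF q U]] by simp
  finally show "\<phi> U x * edge_coord a (\<one>\<^bsub>\<pi>\<^esub> \<otimes>\<^bsub>\<pi>\<^esub> relative_class (path_join l q) x U) =
    \<phi> U x * edge_coord a (cls l \<otimes>\<^bsub>\<pi>\<^esub> relative_class q x U)"
    using weights(4)[OF q U] cls_closed[OF l] by simp
qed

lemma direction_homotopic:
  assumes q: "path_between X x0 x q" and "path_homotopic X q r"
  shows "direction q x = direction r x"
proof -
  have "relative_class q x U = relative_class r x U" if U: "U \<in> members x" for U
    unfolding relative_class_def
  proof (rule cls_eqI[OF relative_path[OF q U]])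
    show "path_homotopic X (path_join q (path_rev (c U x))) (path_join r (path_rev (c U x)))"
      using assms path_between_rev[OF c_path, of U x] U
      by (intro path_join_cong path_homotopic_refl) (auto simp: path_between_def members_def)
  qed
  then show ?thesis
    by (simp add: direction_def mean_coord_def fun_eq_iff)
qed

lemma label_homotopic:
  assumes "path_between X x0 x q" "path_homotopic X q r" "e \<in> fibre x"
  shows "label q e = label r e"
  unfolding label_def using assms transport_homotopic[OF path_rev_cong[OF assms(2)], of e]
  by (simp add: path_between_def)

lemma neighbour_homotopic:
  assumes "fst a \<in> S" "path_between X x0 x q" "path_homotopic X q r"
  shows "path_homotopic X (neighbour a q) (neighbour a r)"
  unfolding neighbour_def using assms inv_loop(1)[OF assms(1)]
  by (intro path_join_cong path_homotopic_refl) (auto simp: path_between_def)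

lemma point_homotopic:
  assumes "path_between X x0 x q" "path_homotopic X q r" "e \<in> fibre x"
  shows "point q x e = point r x e"
proof -
  have "active q x = active r x"
    by (simp add: active_def direction_homotopic[OF assms(1,2)])
  moreover have "displacement t a q e = displacement t a r e" if "fst a \<in> S" for t a
    using label_homotopic[OF assms]
      label_homotopic[OF neighbour_path[OF that assms(1)] neighbour_homotopic[OF that assms(1,2)] assms(3)]
    by (simp add: displacement_def)
  ultimately show ?thesis
    unfolding point_def using label_homotopic[OF assms] direction_homotopic[OF assms(1,2)]
    by (auto simp: active_def intro!: sum.cong)
qed

section \<open>Existence of a good vertex and independence of its choice\<close>

lemma good_exists:
  assumes "x \<in> topspace X"
  obtains q where "good q x"
proof -
  obtain q where q: "path_between X x0 x q"
    using path_connected_space_path[OF path_conn x0 assms] by auto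
  have "\<exists>g. g \<in> carrier \<pi> \<and> (\<forall>a. fst a \<in> S \<longrightarrow> mean_coord (members x) (\<lambda>U. \<phi> U x) (relative_class q x) a g < 1)"
  proof (rule central_vertex_exists[OF weights[OF q]])
    fix g assume "g \<in> carrier \<pi>"
      "\<And>a. fst a \<in> S \<Longrightarrow> mean_coord (members x) (\<lambda>U. \<phi> U x) (relative_class q x) a g < 1"
    then show ?thesis
      by (intro exI[of _ g]) simp
  qed
  then obtain g where g: "g \<in> carrier \<pi>"
    "\<forall>a. fst a \<in> S \<longrightarrow> mean_coord (members x) (\<lambda>U. \<phi> U x) (relative_class q x) a g < 1"
    by (elim exE conjE)
  obtain l where "loop_in X x0 l" "g = cls l"
    by (rule fundamental_group_rep[OF g(1)])
  then have l: "path_between X x0 x0 l" "g = cls l"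
    by (simp_all add: loop_in_iff_path_between)
  have "good (path_join l q) x"
    unfolding good_def using direction_loop_join[OF q l(1)] path_between_join[OF l(1) q] g(2) l(2) by simp
  then show ?thesis
    by (rule that)
qed

text \<open>Two different directions have coordinates with sum at most 0, so they are never both
  positive.\<close>

lemma active_cases:
  assumes "path_between X x0 x q"
  obtains "active q x = {}" | a where "active q x = {a}"
proof -
  have eq: "a = b" if ab: "a \<in> active q x" "b \<in> active q x" for a b
  proof (rule ccontr)
    assume "a \<noteq> b"
    from mean_coord_add_le[OF weights[OF assms] this, where g = "\<one>\<^bsub>\<pi>\<^esub>"]
    have "direction q x a + direction q x b \<le> 0"
      by (simp add: direction_def)
    with ab show False
      by (simp add: active_def)
  qed
  show ?thesis
  proof (cases "active q x = {}")
    case False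
    then obtain a where a: "a \<in> active q x"
      by auto
    have "active q x = {a}"
    proof
      show "active q x \<subseteq> {a}"
        using eq[OF _ a] by (simp add: subset_iff)
    qed (use a in simp)
    then show ?thesis
      by (rule that(2))
  qed (rule that(1))
qed

lemma point_active:
  assumes "path_between X x0 x q" "a \<in> active q x"
  shows "active q x = {a}" "point q x e = of_real (label q e) + displacement (direction q x a) a q e"
proof -
  from assms(1) show "active q x = {a}"
  proof (cases rule: active_cases)
    case (2 b)
    with assms(2) show ?thesis by simp
  qed (use assms(2) in simp)
  then show "point q x e = of_real (label q e) + displacement (direction q x a) a q e"
    by (simp add: point_def)
qed

lemma neighbour_neighbour:
  assumes a: "fst a \<in> S" and q: "path_between X x0 x q"
  shows "path_homotopic X (neighbour (inv_letter a) (neighbour a q)) q"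
proof -
  let ?l = "inv_loop (inv_letter a)" and ?m = "inv_loop a"
  have l: "path_between X x0 x0 ?l" "cls ?l = letter_val \<pi> a"
    using inv_loop[of "inv_letter a"] a by simp_all
  note m = inv_loop[OF a]
  have eq: "cls (path_join ?l ?m) = cls (\<lambda>t. x0)"
    using cls_mult[OF l(1) m(1)] a by (simp add: l(2) m(2) cls_one)
  have triv: "path_homotopic X (path_join ?l ?m) (\<lambda>t. x0)"
    by (rule cls_homotopic[OF path_between_join[OF l(1) m(1)] path_between_const[OF x0] eq])
  have "path_homotopic X (path_join ?l (path_join ?m q)) (path_join (path_join ?l ?m) q)"
    using l(1) m(1) q by (intro path_homotopic_sym[OF path_join_assoc]) (auto simp: path_between_def)
  also have "path_homotopic X \<dots> (path_join (\<lambda>t. x0) q)"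
    using triv m(1) q by (intro path_join_cong path_homotopic_refl) (auto simp: path_between_def)
  also have "path_homotopic X \<dots> q"
    using q by (intro path_join_const_left) (auto simp: path_between_def)
  finally show ?thesis
    by (simp add: neighbour_def)
qed

text \<open>The formula is symmetric under exchanging the ends of the edge and t with 1 - t: the
  real part is affine in t, and in the imaginary part t(1 - t) is symmetric while the orientation
  bit makes both ends select the same label.\<close>

lemma point_neighbour:
  assumes a: "fst a \<in> S" and q: "path_between X x0 x q" and e: "e \<in> fibre x"
    and dir: "0 < direction q x a" "direction q x a < 1"
    and flip: "direction (neighbour a q) x (inv_letter a) = 1 - direction q x a"
  shows "point (neighbour a q) x e = point q x e"
proof -
  let ?r = "neighbour a q"
  have r: "path_between X x0 x ?r"
    using neighbour_path[OF a q] .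
  have "a \<in> active q x" "inv_letter a \<in> active ?r x"
    using a dir flip by (auto simp: active_def)
  then have "point q x e = of_real (label q e) + displacement (direction q x a) a q e"
    "point ?r x e = of_real (label ?r e) + displacement (1 - direction q x a) (inv_letter a) ?r e"
    using point_active(2)[OF q] point_active(2)[OF r] flip by auto
  moreover have "label (neighbour (inv_letter a) ?r) e = label q e"
    using label_homotopic[OF neighbour_path[OF _ r] neighbour_neighbour[OF a q] e] a by simp
  ultimately show ?thesis
    by (cases "snd a") (simp_all add: displacement_def complex_eq_iff inv_letter_def algebra_simps)
qed

text \<open>Two good vertices are equal or adjacent by \<open>central_vertex_adjacent\<close>, and
  adjacent ones are handled by \<open>point_neighbour\<close>. The loop \<open>l\<close> measures
  the difference between \<open>q\<close> and \<open>r\<close>.\<close>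

lemma point_independent:
  assumes q: "good q x" and r: "good r x" and e: "e \<in> fibre x"
  shows "point q x e = point r x e"
proof -
  have qp: "path_between X x0 x q" and rp: "path_between X x0 x r"
    using q r by (auto simp: good_def)
  define l where "l = path_join r (path_rev q)"
  have l: "path_between X x0 x0 l"
    unfolding l_def using path_between_join[OF rp path_between_rev[OF qp]] .
  have lq: "path_between X x0 x (path_join l q)"
    using path_between_join[OF l qp] .
  have r_lq: "path_homotopic X (path_join l q) r"
    unfolding l_def using path_homotopic_cancel_right[OF rp path_between_rev[OF qp]] by simp
  have replace: "path_homotopic X (path_join l q) (path_join m q)"
    if "path_between X x0 x0 m" "cls l = cls m" for m
    using cls_homotopic[OF l that] l qp
    by (intro path_join_cong path_homotopic_refl) (auto simp: path_between_def)
  let ?M = "mean_coord (members x) (\<lambda>U. \<phi> U x) (relative_class q x)"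
  have Mq: "?M a \<one>\<^bsub>\<pi>\<^esub> = direction q x a" and Mr: "?M a (cls l) = direction r x a" for a
    using direction_loop_join[OF qp l, of a] direction_homotopic[OF lq r_lq] by (auto simp: direction_def)
  show ?thesis
  proof (cases "cls l = \<one>\<^bsub>\<pi>\<^esub>")
    case True
    then have "path_homotopic X (path_join l q) (path_join (\<lambda>t. x0) q)"
      using replace[OF path_between_const[OF x0]] by (simp add: cls_one)
    also have "path_homotopic X \<dots> q"
      using qp by (intro path_join_const_left) (auto simp: path_between_def)
    finally have "point (path_join l q) x e = point q x e"
      by (rule point_homotopic[OF lq _ e])
    with point_homotopic[OF lq r_lq e] show ?thesis by simp
  next
    case False
    have central: "?M a \<one>\<^bsub>\<pi>\<^esub> < 1" "?M a (cls l) < 1" if "fst a \<in> S" for a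
      unfolding Mq Mr by (rule goodD(2)[OF q that], rule goodD(2)[OF r that])
    obtain a where a: "fst a \<in> S" "cls l = inv\<^bsub>\<pi>\<^esub> letter_val \<pi> a \<otimes>\<^bsub>\<pi>\<^esub> \<one>\<^bsub>\<pi>\<^esub>" "0 < ?M a \<one>\<^bsub>\<pi>\<^esub>"
      "?M (inv_letter a) (cls l) = 1 - ?M a \<one>\<^bsub>\<pi>\<^esub>"
      by (rule central_vertex_adjacent[OF weights[OF qp] one_closed cls_closed[OF l] False central])
    then have "cls l = cls (inv_loop a)"
      using inv_loop(2)[OF a(1)] by simp
    from replace[OF inv_loop(1)[OF a(1)] this]
    have ln: "path_homotopic X (path_join l q) (neighbour a q)"
      by (simp add: neighbour_def)
    have "direction (neighbour a q) x (inv_letter a) = direction r x (inv_letter a)"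
      using direction_homotopic[OF lq ln] direction_homotopic[OF lq r_lq] by simp
    also have "\<dots> = 1 - direction q x a"
      using a(4) unfolding Mq Mr .
    finally have "point (neighbour a q) x e = point q x e"
      by (rule point_neighbour[OF a(1) qp e a(3)[unfolded Mq] goodD(2)[OF q a(1)]])
    moreover have "point (neighbour a q) x e = point r x e"
      using point_homotopic[OF lq ln e] point_homotopic[OF lq r_lq e] by simp
    ultimately show ?thesis by simp
  qed
qed

lemma countable_fibre: "x \<in> topspace X \<Longrightarrow> countable (fibre x)" "x \<in> topspace X \<Longrightarrow> infinite (fibre x)"
  using sheets unfolding countably_infinite_sheeted_def fibre_def by blast+

lemma label_bij:
  assumes "path_between X x0 x q"
  shows "bij_betw (\<lambda>e. to_nat_on (fibre x0) (transport (path_rev q) e)) (fibre x) UNIV"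
  using bij_betw_trans[OF transport_bij[OF path_between_rev[OF assms]]
      to_nat_on_infinite[OF countable_fibre[OF x0]]] by (simp add: o_def)

lemma label_inj:
  assumes "path_between X x0 x q" "e \<in> fibre x" "e' \<in> fibre x" "label q e = label q e'"
  shows "e = e'"
  using label_bij[OF assms(1)] assms(2-4) by (auto simp: label_def bij_betw_def dest: inj_onD)

lemma point_inj:
  assumes "good q x"
  shows "inj_on (point q x) (fibre x)"
proof (rule inj_onI)
  fix e e' assume e: "e \<in> fibre x" "e' \<in> fibre x" and eq: "point q x e = point q x e'"
  have q: "path_between X x0 x q"
    using assms by (simp add: good_def)
  from q show "e = e'"
  proof (cases rule: active_cases)
    case 1
    then have "label q e = label q e'"
      using eq by (simp add: point_def)
    then show ?thesis
      by (rule label_inj[OF q e])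
  next
    case (2 a)
    then have a: "a \<in> active q x"
      by simp
    have S: "fst a \<in> S" and dir: "0 < direction q x a" "direction q x a < 1"
      using a goodD(2)[OF assms, of a] by (simp_all add: active_def)
    \<comment> \<open>Since \<open>0 < t < 1\<close>, the factor t(1 - t) can be cancelled from the
      imaginary parts.\<close>
    have "label (if snd a then q else neighbour a q) e = label (if snd a then q else neighbour a q) e'"
      using eq dir unfolding point_active(2)[OF q a] by (auto simp: displacement_def complex_eq_iff)
    then show ?thesis
      by (rule label_inj[rotated 3]) (use q neighbour_path[OF S q] e in auto)
  qed
qed

end

section \<open>Continuity of the embedding\<close>

lemma summable_inverse_square_bij:
  assumes "bij (f :: nat \<Rightarrow> nat)"
  shows "summable (\<lambda>k. 1 / (real (Suc (f k)))\<^sup>2)"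
proof -
  have "summable (\<lambda>n. inverse (real n ^ 2))"
    using inverse_power_summable[of 2, where 'a = real] by simp
  then have "summable (\<lambda>n. inverse (real (Suc n) ^ 2))"
    using summable_Suc_iff[of "\<lambda>n. inverse (real n ^ 2)"] by simp
  then have "summable ((\<lambda>n. inverse (real (Suc n) ^ 2)) \<circ> f)"
    using assms by (intro summable_reindex) (auto simp: bij_def)
  then show ?thesis
    by (simp add: o_def inverse_eq_divide)
qed

context free_covering
begin

definition embedding :: "'e \<Rightarrow> complex" where
  "embedding e = point (SOME q. good q (p e)) (p e) e"

lemma embedding_eq:
  assumes "good q x" "e \<in> fibre x"
  shows "embedding e = point q x e"
proof -
  have x: "p e = x"
    using assms(2) by (simp add: fibre_def)
  have "good (SOME q. good q x) x"
    by (rule someI[of "\<lambda>q. good q x", OF assms(1)])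
  then show ?thesis
    unfolding embedding_def x by (rule point_independent[OF _ assms])
qed

lemma embedding_inj:
  assumes "x \<in> topspace X"
  shows "inj_on embedding (fibre x)"
proof -
  obtain q where q: "good q x"
    by (rule good_exists[OF assms])
  show ?thesis
    using point_inj[OF q] embedding_eq[OF q] by (simp add: inj_on_def)
qed

section \<open>Behaviour of labels and relative classes along a path\<close>

lemma label_move:
  assumes r: "path_between X x0 x r" and \<delta>: "path_between X x y \<delta>" and e: "e \<in> fibre x"
  shows "label (path_join r \<delta>) (transport \<delta> e) = label r e"
proof -
  note e' = transport_in_fibre[OF \<delta> e]
  have "path_homotopic X (path_rev (path_join r \<delta>)) (path_join (path_rev \<delta>) (path_rev r))"
    using r \<delta> by (intro path_rev_join) (auto simp: path_between_def)
  then have "transport (path_rev (path_join r \<delta>)) (transport \<delta> e) =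
      transport (path_join (path_rev \<delta>) (path_rev r)) (transport \<delta> e)"
    by (rule transport_homotopic) (use e' \<delta> in \<open>auto simp: path_between_def\<close>)
  also have "\<dots> = transport (path_rev r) e"
    using transport_join[OF path_between_rev[OF \<delta>] path_between_rev[OF r] e'] transport_rev[OF \<delta> e] by simp
  finally show ?thesis
    by (simp add: label_def)
qed

lemma neighbour_label_move:
  assumes a: "fst a \<in> S" and r: "path_between X x0 x r" and \<delta>: "path_between X x y \<delta>" and e: "e \<in> fibre x"
  shows "label (neighbour a (path_join r \<delta>)) (transport \<delta> e) = label (neighbour a r) e"
proof -
  have "path_homotopic X (path_join (neighbour a r) \<delta>) (neighbour a (path_join r \<delta>))"
    unfolding neighbour_def using inv_loop(1)[OF a] r \<delta>
    by (intro path_join_assoc) (auto simp: path_between_def)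
  from label_homotopic[OF path_between_join[OF neighbour_path[OF a r] \<delta>] this transport_in_fibre[OF \<delta> e]]
  show ?thesis
    using label_move[OF neighbour_path[OF a r] \<delta> e] by simp
qed

text \<open>Both \<open>q\<close> and the coherent path are prolonged by \<open>\<delta>\<close>,
  and the two copies cancel in the middle.\<close>

lemma relative_class_move:
  assumes q: "path_between X x0 x q" and U: "U \<in> \<U>" "x \<in> U" and \<delta>: "path_between X x y \<delta>" "\<delta> \<in> {0..1} \<rightarrow> U"
  shows "relative_class (path_join q \<delta>) y U = relative_class q x U"
  unfolding relative_class_def
proof (rule cls_eqI)
  have "\<delta> 1 \<in> U"
    using \<delta>(2) by (rule funcset_mem) simp
  with \<delta>(1) have y: "y \<in> U"
    by (simp add: path_between_def)
  note c = c_path[OF U] and cy = c_path[OF U(1) y]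
  show "path_between X x0 x0 (path_join (path_join q \<delta>) (path_rev (c U y)))"
    using path_between_join[OF path_between_join[OF q \<delta>(1)] path_between_rev[OF cy]] .
  have "path_homotopic X (path_join (path_join q \<delta>) (path_rev (c U y)))
      (path_join (path_join q \<delta>) (path_rev (path_join (c U x) \<delta>)))"
    using path_between_join[OF q \<delta>(1)] cy path_rev_cong[OF c_move[OF U \<delta>]]
    by (intro path_join_cong path_homotopic_refl path_homotopic_sym[OF path_rev_cong[OF c_move[OF U \<delta>]]])
       (auto simp: path_between_def)
  also have "path_homotopic X \<dots> (path_join q (path_rev (c U x)))"
    by (rule path_homotopic_cancel_middle[OF q \<delta>(1) c])
  finally show "path_homotopic X (path_join (path_join q \<delta>) (path_rev (c U y))) (path_join q (path_rev (c U x)))" .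
qed

text \<open>The real part is a convex combination of the labels at the ends of the edge, or the
  single label at a vertex.\<close>

lemma point_norm_ge:
  assumes q: "good q x" and m: "m \<le> label q e" "\<And>a. a \<in> active q x \<Longrightarrow> m \<le> label (neighbour a q) e"
  shows "m \<le> norm (point q x e)"
proof -
  have "m \<le> Re (point q x e)"
    using goodD(1)[OF q]
  proof (cases rule: active_cases)
    case 1
    then show ?thesis
      using m(1) by (simp add: point_def)
  next
    case (2 a)
    then have a: "a \<in> active q x"
      by simp
    let ?t = "direction q x a"
    have t: "0 < ?t" "?t < 1"
      using a goodD(2)[OF q, of a] by (simp_all add: active_def)
    have "m = (1 - ?t) * m + ?t * m"
      by (simp add: algebra_simps)
    also have "\<dots> \<le> (1 - ?t) * label q e + ?t * label (neighbour a q) e"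
      using t m(1) m(2)[OF a] by (intro add_mono mult_left_mono) auto
    also have "\<dots> = Re (point q x e)"
      unfolding point_active(2)[OF goodD(1)[OF q] a] by (simp add: displacement_def algebra_simps)
    finally show ?thesis .
  qed
  also have "\<dots> \<le> norm (point q x e)"
    by (rule complex_Re_le_cmod)
  finally show ?thesis .
qed

lemma continuous_displacement: "continuous_on UNIV (\<lambda>t. displacement t a q e)"
  unfolding displacement_def by (intro continuous_intros)

text \<open>Near \<open>x\<close> the relative classes do not change, so a direction depends on
  \<open>y\<close> through the weights alone. A direction that is not the first letter of any of
  these finitely many classes stays nonpositive, so goodness is only finitely many open
  conditions.\<close>

lemma direction_locally_finite:
  assumes x: "x \<in> topspace X" and q: "good q x"
  obtains N L d where "openin X N" "x \<in> N" "finite L" "\<And>a. a \<in> L \<Longrightarrow> fst a \<in> S"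
    "\<And>a. a \<in> L \<Longrightarrow> continuous_map (subtopology X N) euclideanreal (d a)"
    "\<And>y \<delta>. y \<in> N \<Longrightarrow> path_between X x y \<delta> \<Longrightarrow> \<delta> \<in> {0..1} \<rightarrow> N \<Longrightarrow>
      good (path_join q \<delta>) y \<and> active (path_join q \<delta>) y \<subseteq> L \<and> (\<forall>a. direction (path_join q \<delta>) y a = d a y)"
proof -
  have qp: "path_between X x0 x q"
    by (rule goodD(1)[OF q])
  obtain N where N: "openin X N" "x \<in> N" "\<forall>U\<in>\<U>. x \<in> U \<longrightarrow> N \<subseteq> U \<and> continuous_map (subtopology X N) euclideanreal (\<phi> U)"
    "\<forall>y\<in>N. (\<forall>U\<in>\<U>. x \<notin> U \<longrightarrow> \<phi> U y = 0) \<and> sum (\<lambda>U. \<phi> U y) {U \<in> \<U>. x \<in> U} = 1"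
    using partition[OF x] by (elim conjE exE)
  have fin: "finite (members x)"
    by (rule weights(1)[OF qp])
  define d where "d a y = mean_coord (members x) (\<lambda>U. \<phi> U y) (relative_class q x) a \<one>\<^bsub>\<pi>\<^esub>" for a y
  define nf where "nf U = normal_form (\<one>\<^bsub>\<pi>\<^esub> \<otimes>\<^bsub>\<pi>\<^esub> relative_class q x U)" for U
  define L where "L = {a \<in> (\<lambda>U. hd (nf U)) ` members x. fst a \<in> S}"
  have finL: "finite L"
    unfolding L_def using fin by simp
  have cont: "continuous_map (subtopology X N) euclideanreal (d a)" for a
    unfolding d_def mean_coord_def using N(3)
    by (intro continuous_map_sum fin continuous_map_real_mult) (auto simp: members_def)
  have d_le: "d a y \<le> 0" if a: "fst a \<in> S" "a \<notin> L" for a y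
    unfolding d_def mean_coord_def
  proof (rule sum_nonpos, rule mult_nonneg_nonpos)
    fix U assume "U \<in> members x"
    then have "a \<noteq> hd (nf U)"
      using a by (auto simp: L_def)
    then show "edge_coord a (\<one>\<^bsub>\<pi>\<^esub> \<otimes>\<^bsub>\<pi>\<^esub> relative_class q x U) \<le> 0"
      unfolding nf_def by (intro edge_coord_le_0) simp
  qed (rule weight_nonneg)
  define T where "T a = {y \<in> N. d a y < 1}" for a
  define M where "M = N \<inter> \<Inter>(T ` L)"
  have topN: "topspace (subtopology X N) = N"
    using openin_subset[OF N(1)] by auto
  have T: "openin X (T a)" for a
  proof -
    have "openin (subtopology X N) {y \<in> topspace (subtopology X N). d a y \<in> {..<1}}"
      using cont by (rule openin_continuous_map_preimage) simp
    then have "openin (subtopology X N) (T a)"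
      unfolding topN T_def by simp
    then show ?thesis
      using N(1) openin_trans_full by blast
  qed
  show ?thesis
  proof (rule that[of M L d])
    show "openin X M"
      unfolding M_def by (rule openin_Int_Inter) (use finL N(1) T in auto)
    have "d a x < 1" if "a \<in> L" for a
    proof -
      have "d a x = direction q x a"
        by (simp add: d_def direction_def)
      with goodD(2)[OF q, of a] that show ?thesis
        by (simp add: L_def)
    qed
    then show "x \<in> M"
      using N(2) by (simp add: M_def T_def)
    show "finite L"
      by (rule finL)
    show "fst a \<in> S" if "a \<in> L" for a
      using that by (simp add: L_def)
    show "continuous_map (subtopology X M) euclideanreal (d a)" for a
      by (rule continuous_map_from_subtopology_mono[OF cont]) (simp add: M_def)
    fix y \<delta> assume y: "y \<in> M" and \<delta>: "path_between X x y \<delta>" "\<delta> \<in> {0..1} \<rightarrow> M"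
    then have yN: "y \<in> N" and \<delta>N: "\<delta> \<in> {0..1} \<rightarrow> N"
      by (auto simp: M_def)
    have r: "path_between X x0 y (path_join q \<delta>)"
      by (rule path_between_join[OF qp \<delta>(1)])
    have sub: "members x \<subseteq> members y"
      using N(3) yN by (auto simp: members_def)
    have zero: "\<phi> U y = 0" if "U \<in> members y - members x" for U
      using that N(4) yN by (simp add: members_def)
    have move: "relative_class (path_join q \<delta>) y U = relative_class q x U" if "U \<in> members x" for U
    proof (rule relative_class_move[OF qp _ _ \<delta>(1)])
      show "\<delta> \<in> {0..1} \<rightarrow> U"
        using that N(3) \<delta>N by (auto simp: members_def)
    qed (use that in \<open>auto simp: members_def\<close>)
    have dir: "direction (path_join q \<delta>) y a = d a y" for a
    proof -
      have "direction (path_join q \<delta>) y a =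
        (\<Sum>U\<in>members x. \<phi> U y * edge_coord a (\<one>\<^bsub>\<pi>\<^esub> \<otimes>\<^bsub>\<pi>\<^esub> relative_class (path_join q \<delta>) y U))"
        unfolding direction_def mean_coord_def
        by (rule sum.mono_neutral_right[OF weights(1)[OF r] sub]) (simp add: zero)
      also have "\<dots> = d a y"
        unfolding d_def mean_coord_def by (rule sum.cong) (simp_all add: move)
      finally show ?thesis .
    qed
    have "d a y < 1" if "fst a \<in> S" for a
    proof (cases "a \<in> L")
      case True
      with y show ?thesis
        by (auto simp: M_def T_def)
    next
      case False
      with d_le[OF that False, of y] show ?thesis
        by simp
    qed
    then have "good (path_join q \<delta>) y"
      unfolding good_def dir using r by blast
    moreover have "active (path_join q \<delta>) y \<subseteq> L"
    proof
      fix a assume "a \<in> active (path_join q \<delta>) y"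
      then have "fst a \<in> S" "d a y > 0"
        by (simp_all add: active_def dir)
      with d_le[of a y] show "a \<in> L"
        by force
    qed
    ultimately show "good (path_join q \<delta>) y \<and> active (path_join q \<delta>) y \<subseteq> L \<and>
        (\<forall>a. direction (path_join q \<delta>) y a = d a y)"
      using dir by simp
  qed
qed

text \<open>Carrying the vertex \<open>q\<close> along with the point keeps all labels fixed, so on
  a sheet only the directions vary. As \<open>displacement\<close> vanishes at 0, truncating them at
  0 turns the sum over active directions into a sum over the fixed set \<open>L\<close>, which is
  continuous where a direction becomes active.\<close>

lemma embedding_sparse_trivialization:
  assumes x: "x \<in> topspace X"
  shows "\<exists>V s m. sparse_trivialization embedding x V s m"
proof -
  obtain q where q: "good q x"
    by (rule good_exists[OF x])
  have qp: "path_between X x0 x q"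
    by (rule goodD(1)[OF q])
  obtain N L d where N: "openin X N" "x \<in> N" and L: "finite L" "\<And>a. a \<in> L \<Longrightarrow> fst a \<in> S"
    and cont: "\<And>a. a \<in> L \<Longrightarrow> continuous_map (subtopology X N) euclideanreal (d a)"
    and near: "\<And>y \<delta>. y \<in> N \<Longrightarrow> path_between X x y \<delta> \<Longrightarrow> \<delta> \<in> {0..1} \<rightarrow> N \<Longrightarrow>
      good (path_join q \<delta>) y \<and> active (path_join q \<delta>) y \<subseteq> L \<and> (\<forall>a. direction (path_join q \<delta>) y a = d a y)"
    by (rule direction_locally_finite[OF x q]) blast
  obtain U where U: "evenly_covered U" "x \<in> U"
    by (rule evenly_covered_exists[OF x])
  have "openin X (N \<inter> U)" "x \<in> N \<inter> U"
    using N U by (auto simp: evenly_covered_def)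
  then obtain V where V: "openin X V" "path_connectedin X V" "x \<in> V" "V \<subseteq> N \<inter> U"
    using loc_path_conn unfolding locally_path_connected_space by meson
  have "\<forall>y\<in>V. \<exists>\<delta>. path_between X x y \<delta> \<and> \<delta> \<in> {0..1} \<rightarrow> V"
  proof
    fix y assume "y \<in> V"
    from path_connectedin_path[OF V(2,3) this]
    show "\<exists>\<delta>. path_between X x y \<delta> \<and> \<delta> \<in> {0..1} \<rightarrow> V" by metis
  qed
  from bchoice[OF this] obtain \<delta> where "\<forall>y\<in>V. path_between X x y (\<delta> y) \<and> \<delta> y \<in> {0..1} \<rightarrow> V"
    by (elim exE)
  then have \<delta>: "\<And>y. y \<in> V \<Longrightarrow> path_between X x y (\<delta> y)" "\<And>y. y \<in> V \<Longrightarrow> \<delta> y \<in> {0..1} \<rightarrow> V"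
    by auto
  have \<delta>N: "\<delta> y \<in> {0..1} \<rightarrow> N" and \<delta>U: "\<delta> y \<in> {0..1} \<rightarrow> U" if "y \<in> V" for y
    using \<delta>(2)[OF that] V(4) by auto
  define s where "s y = transport (\<delta> y)" for y
  \<comment> \<open>The real part of the embedding is a mean of labels at \<open>q\<close> and at
    neighbours in \<open>L\<close>, so their minimum is a lower bound on all of \<open>V\<close>. As
    the minimum is attained, 1/m^2 is at most the sum of the finitely many summable
    families.\<close>
  define m where "m e = Min (insert (label q e) ((\<lambda>a. label (neighbour a q) e) ` L))" for e
  have nearV: "good (path_join q (\<delta> y)) y" "active (path_join q (\<delta> y)) y \<subseteq> L"
    "direction (path_join q (\<delta> y)) y a = d a y" if "y \<in> V" for y a
  proof -
    have "y \<in> N"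
      using that V(4) by auto
    note n = near[OF this \<delta>(1)[OF that] \<delta>N[OF that]]
    show "good (path_join q (\<delta> y)) y" "active (path_join q (\<delta> y)) y \<subseteq> L" "direction (path_join q (\<delta> y)) y a = d a y"
      using n[THEN conjunct1] n[THEN conjunct2, THEN conjunct1] n[THEN conjunct2, THEN conjunct2, THEN spec[of _ a]] .
  qed
  have s_bij: "bij_betw (s y) (fibre x) (fibre y)" if "y \<in> V" for y
    unfolding s_def by (rule transport_bij[OF \<delta>(1)[OF that]])
  have s_fibre: "s y e \<in> fibre y" if "y \<in> V" "e \<in> fibre x" for y e
    unfolding s_def by (rule transport_in_fibre[OF \<delta>(1)[OF that(1)] that(2)])
  have labels: "label (path_join q (\<delta> y)) (s y e) = label q e"
    "a \<in> L \<Longrightarrow> label (neighbour a (path_join q (\<delta> y))) (s y e) = label (neighbour a q) e"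
    if "y \<in> V" "e \<in> fibre x" for y e a
    unfolding s_def
    by (rule label_move[OF qp \<delta>(1)[OF that(1)] that(2)],
        rule neighbour_label_move[OF L(2) qp \<delta>(1)[OF that(1)] that(2)])
  have emb: "embedding (s y e) = of_real (label q e) + (\<Sum>a\<in>L. displacement (max 0 (d a y)) a q e)"
    if y: "y \<in> V" and e: "e \<in> fibre x" for y e
  proof -
    let ?r = "path_join q (\<delta> y)"
    have "embedding (s y e) = point ?r y (s y e)"
      by (rule embedding_eq[OF nearV(1)[OF y] s_fibre[OF y e]])
    also have "\<dots> = of_real (label q e) + (\<Sum>a\<in>active ?r y. displacement (max 0 (d a y)) a q e)"
      unfolding point_def labels(1)[OF y e]
    proof (intro arg_cong2[where f = "(+)"] sum.cong refl)
      fix a assume a: "a \<in> active ?r y"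
      then have "a \<in> L" "max 0 (d a y) = d a y"
        using nearV(2,3)[OF y] by (auto simp: active_def)
      then show "displacement (direction ?r y a) a ?r (s y e) = displacement (max 0 (d a y)) a q e"
        using labels[OF y e] nearV(3)[OF y] by (simp add: displacement_def)
    qed
    also have "(\<Sum>a\<in>active ?r y. displacement (max 0 (d a y)) a q e) = (\<Sum>a\<in>L. displacement (max 0 (d a y)) a q e)"
    proof (rule sum.mono_neutral_left[OF L(1) nearV(2)[OF y]], rule ballI)
      fix a assume "a \<in> L - active ?r y"
      then have "d a y \<le> 0"
        using L(2)[of a] nearV(3)[OF y, of a] by (simp add: active_def)
      then show "displacement (max 0 (d a y)) a q e = 0"
        by (simp add: displacement_def complex_eq_iff)
    qed
    finally show ?thesis .
  qed
  have "sparse_trivialization embedding x V s m"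
    unfolding sparse_trivialization_def
  proof (intro conjI ballI allI impI)
    show "openin X V" "x \<in> V"
      by (rule V(1), rule V(3))
    show "bij_betw (s y) (fibre x) (fibre y)" if "y \<in> V" for y
      by (rule s_bij[OF that])
  next
    fix e assume e: "e \<in> fibre x"
    obtain B where B: "sheet B U" "e \<in> B"
      by (rule sheet_at[OF U(1), of e]) (use e U(2) in \<open>auto simp: fibre_def\<close>)
    have sB: "s y e \<in> B" if "y \<in> V" for y
      unfolding s_def by (rule transport_in_sheet[OF B(1) \<delta>(1)[OF that] \<delta>U[OF that] B(2) e])
    \<comment> \<open>The paths \<open>\<delta> y\<close> are chosen without any continuity in
      \<open>y\<close>; transport inside a sheet nevertheless equals the continuous inverse of
      \<open>p\<close>.\<close>
    have s_eq: "s y e = inv_into B p y" if "y \<in> V" for y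
      using bij_betw_inv_into_left[OF sheet_bij[OF B(1)] sB[OF that]] s_fibre[OF that e] by (simp add: fibre_def)
    show "s x e = e"
      using s_eq[OF V(3)] bij_betw_inv_into_left[OF sheet_bij[OF B(1)] B(2)] e by (simp add: fibre_def)
    show "continuous_map (subtopology X V) E (\<lambda>y. s y e)"
    proof (rule continuous_map_eq)
      show "continuous_map (subtopology X V) E (inv_into B p)"
        by (rule continuous_map_from_subtopology_mono[OF sheet_inverse[OF B(1)]]) (use V(4) in auto)
    qed (use s_eq in simp)
    have "(\<lambda>y. s y e) ` V = B \<inter> {e' \<in> topspace E. p e' \<in> V}"
    proof
      show "(\<lambda>y. s y e) ` V \<subseteq> B \<inter> {e' \<in> topspace E. p e' \<in> V}"
        using sB s_fibre[OF _ e] by (auto simp: fibre_def)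
      show "B \<inter> {e' \<in> topspace E. p e' \<in> V} \<subseteq> (\<lambda>y. s y e) ` V"
      proof
        fix e' assume e': "e' \<in> B \<inter> {e' \<in> topspace E. p e' \<in> V}"
        then have "e' = s (p e') e"
          using s_eq[of "p e'"] bij_betw_inv_into_left[OF sheet_bij[OF B(1)], of e'] by simp
        with e' show "e' \<in> (\<lambda>y. s y e) ` V"
          by blast
      qed
    qed
    moreover have "openin E (B \<inter> {e' \<in> topspace E. p e' \<in> V})"
    proof (rule openin_Int)
      show "openin E B"
        using B(1) by (simp add: sheet_def)
      show "openin E {e' \<in> topspace E. p e' \<in> V}"
        by (rule openin_continuous_map_preimage[OF continuous_p V(1)])
    qed
    ultimately show "openin E ((\<lambda>y. s y e) ` V)"
      by simp
    show "continuous_map (subtopology X V) euclidean (\<lambda>y. embedding (s y e))"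
    proof (rule continuous_map_eq)
      have "continuous_map (subtopology X V) euclidean (\<lambda>y. displacement (max 0 (d a y)) a q e)" if a: "a \<in> L" for a
      proof -
        have "continuous_map (subtopology X V) euclideanreal (d a)"
          by (rule continuous_map_from_subtopology_mono[OF cont[OF a]]) (use V(4) in auto)
        then have "continuous_map (subtopology X V) euclideanreal (\<lambda>y. max 0 (d a y))"
          by (intro continuous_map_real_max) auto
        moreover have "continuous_map euclideanreal euclidean (\<lambda>t. displacement t a q e)"
          using continuous_displacement by simp
        ultimately have "continuous_map (subtopology X V) euclidean ((\<lambda>t. displacement t a q e) \<circ> (\<lambda>y. max 0 (d a y)))"
          by (rule continuous_map_compose)
        then show ?thesis
          by (simp add: o_def)
      qed
      then have "continuous_map (subtopology X V) euclidean (\<lambda>y. \<Sum>a\<in>L. displacement (max 0 (d a y)) a q e)"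
        by (intro continuous_map_sum L(1))
      then show "continuous_map (subtopology X V) euclidean
          (\<lambda>y. of_real (label q e) + (\<Sum>a\<in>L. displacement (max 0 (d a y)) a q e))"
        by (intro continuous_map_add) auto
    qed (use emb[OF _ e] in simp)
    have "label r e > 0" for r
      by (simp add: label_def)
    then show "0 < m e"
      unfolding m_def using L(1) by simp
    fix y assume y: "y \<in> V"
    have "m e \<le> norm (point (path_join q (\<delta> y)) y (s y e))"
    proof (rule point_norm_ge[OF nearV(1)[OF y]])
      show "m e \<le> label (path_join q (\<delta> y)) (s y e)"
        unfolding labels(1)[OF y e] m_def using L(1) by (intro Min_le) auto
      fix a assume "a \<in> active (path_join q (\<delta> y)) y"
      then have "a \<in> L"
        using nearV(2)[OF y] by blast
      then show "m e \<le> label (neighbour a (path_join q (\<delta> y))) (s y e)"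
        unfolding labels(2)[OF y e \<open>a \<in> L\<close>] m_def using L(1) by (intro Min_le) auto
    qed
    then show "m e \<le> norm (embedding (s y e))"
      using embedding_eq[OF nearV(1)[OF y] s_fibre[OF y e]] by simp
  next
    fix f :: "nat \<Rightarrow> 'e" assume f: "bij_betw f UNIV (fibre x)"
    have label_summable: "summable (\<lambda>k. 1 / (label r (f k))\<^sup>2)" if r: "path_between X x0 x r" for r
      unfolding label_def using summable_inverse_square_bij[OF bij_betw_trans[OF f label_bij[OF r]]]
      by (simp add: o_def)
    show "summable (\<lambda>k. 1 / (m (f k))\<^sup>2)"
    proof (rule summable_comparison_test)
      show "summable (\<lambda>k. 1 / (label q (f k))\<^sup>2 + (\<Sum>a\<in>L. 1 / (label (neighbour a q) (f k))\<^sup>2))"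
        by (intro summable_add summable_sum label_summable qp neighbour_path L(2))
      have "1 / (m e)\<^sup>2 \<le> 1 / (label q e)\<^sup>2 + (\<Sum>a\<in>L. 1 / (label (neighbour a q) e)\<^sup>2)" for e
      proof -
        have "m e \<in> insert (label q e) ((\<lambda>a. label (neighbour a q) e) ` L)"
          unfolding m_def using L(1) by (intro Min_in) auto
        then consider "m e = label q e" | a where "a \<in> L" "m e = label (neighbour a q) e"
          by auto
        then show ?thesis
        proof cases
          case 1
          then show ?thesis
            by (simp add: sum_nonneg)
        next
          case (2 a)
          have "1 / (label (neighbour a q) e)\<^sup>2 \<le> (\<Sum>a\<in>L. 1 / (label (neighbour a q) e)\<^sup>2)"
            using 2(1) L(1) by (intro member_le_sum) auto
          moreover have "0 \<le> 1 / (label q e)\<^sup>2"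
            by simp
          ultimately show ?thesis
            unfolding 2(2) by linarith
        qed
      qed
      then show "\<exists>K. \<forall>k\<ge>K. norm (1 / (m (f k))\<^sup>2) \<le>
          1 / (label q (f k))\<^sup>2 + (\<Sum>a\<in>L. 1 / (label (neighbour a q) (f k))\<^sup>2)"
        by (auto simp: norm_divide)
    qed
  qed
  then show ?thesis
    by blast
qed

end

theorem mainTheorem18:
  fixes X :: "'a topology" and Y :: "'b topology" and x0 :: 'a
    and E :: "'e topology" and p :: "'e \<Rightarrow> 'a"
  assumes "path_connected_space X"
    and "locally_path_connected_space X"
    and "semilocally_simply_connected_space X"
    and "cw_complex Y" and "X homotopy_equivalent_space Y"
    and "Hausdorff_space X"
    and "paracompact_space X"
    and "locally_contractible_space X"
    and "x0 \<in> topspace X" and "is_free_group (fundamental_group X x0)"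
    and "H2_int_vanishes X"
    and "countably_infinite_sheeted E X p"
  shows "\<exists>F. weierstrass_entire_family X F \<and> equivalent_coverings E p (zero_space X F) fst"
proof -
  obtain S where "free_group_on (fundamental_group X x0) S"
    using assms(10) unfolding is_free_group_def by (elim exE)
  then have basis: "free_basis (fundamental_group X x0) S"
    by (rule free_basis_of_free_group_on)
  show ?thesis
  \<comment> \<open>Relative simplicity is inherited by subsets, hence by the locally finite
    refinement that carries the partition of unity.\<close>
  proof (rule paracompact_partition_of_unity[where P = "relatively_simple X",
      OF assms(7,6) relatively_simple_exists[OF assms(2,3)] relatively_simple_mono])
    fix \<U> :: "'a set set" and \<phi> :: "'a set \<Rightarrow> 'a \<Rightarrow> real"
    assume \<U>: "\<And>U. U \<in> \<U> \<Longrightarrow> openin X U \<and> relatively_simple X U" and \<phi>: "\<And>U x. \<phi> U x \<ge> 0"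
      "\<And>x. x \<in> topspace X \<Longrightarrow> finite {U \<in> \<U>. x \<in> U} \<and>
        (\<exists>N. openin X N \<and> x \<in> N \<and> (\<forall>U\<in>\<U>. x \<in> U \<longrightarrow> N \<subseteq> U \<and> continuous_map (subtopology X N) euclideanreal (\<phi> U)) \<and>
          (\<forall>y\<in>N. (\<forall>U\<in>\<U>. x \<notin> U \<longrightarrow> \<phi> U y = 0) \<and> sum (\<lambda>U. \<phi> U y) {U \<in> \<U>. x \<in> U} = 1))"
    have "\<forall>U\<in>\<U>. \<exists>c. (\<forall>x\<in>U. path_between X x0 x (c x)) \<and>
      (\<forall>x y \<delta>. x \<in> U \<longrightarrow> path_between X x y \<delta> \<longrightarrow> \<delta> \<in> {0..1} \<rightarrow> U \<longrightarrow> path_homotopic X (path_join (c x) \<delta>) (c y))"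
    proof
      fix U assume "U \<in> \<U>"
      with \<U> have "relatively_simple X U"
        by simp
      then show "\<exists>c. (\<forall>x\<in>U. path_between X x0 x (c x)) \<and>
        (\<forall>x y \<delta>. x \<in> U \<longrightarrow> path_between X x y \<delta> \<longrightarrow> \<delta> \<in> {0..1} \<rightarrow> U \<longrightarrow> path_homotopic X (path_join (c x) \<delta>) (c y))"
      proof (rule coherent_paths[OF assms(1,9)])
        fix c assume "\<And>x. x \<in> U \<Longrightarrow> path_between X x0 x (c x)"
          "\<And>x y \<delta>. x \<in> U \<Longrightarrow> path_between X x y \<delta> \<Longrightarrow> \<delta> \<in> {0..1} \<rightarrow> U \<Longrightarrow> path_homotopic X (path_join (c x) \<delta>) (c y)"
        then show ?thesis
          by (intro exI[of _ c]) simp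
      qed
    qed
    from bchoice[OF this] obtain c where c: "\<forall>U\<in>\<U>. (\<forall>x\<in>U. path_between X x0 x (c U x)) \<and>
      (\<forall>x y \<delta>. x \<in> U \<longrightarrow> path_between X x y \<delta> \<longrightarrow> \<delta> \<in> {0..1} \<rightarrow> U \<longrightarrow> path_homotopic X (path_join (c U x) \<delta>) (c U y))"
      by (elim exE)
    have "covering E X p"
      using assms(12) by (simp add: covering_def countably_infinite_sheeted_def)
    then interpret free_covering E X p x0 S \<U> \<phi> c
      unfolding free_covering_def free_covering_axioms_def using basis assms(1,2,9,12) \<U> \<phi> c by simp
    show ?thesis
      by (rule weierstrass_family_of_embedding[OF assms(12) embedding_inj embedding_sparse_trivialization])
  qed
qed

end
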